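(* Let $\Gamma$ be a cofinite Fuchsian group containing at least one parabolic element. Then $\mathrm{Tr}(\Gamma)$ satisfies the B-C property if and only if $\Gamma$ is an arithmetic group.
   Context: A Fuchsian group is a discrete subgroup $\Gamma$ of $PSL(2,\mathbb{R})=SL(2,\mathbb{R})/\{\pm 1_2\}$, where $1_2$ is the $2\times 2$ identity matrix; it acts on the hyperbolic plane $\mathbb{H}=\{z\in\mathbb{C} : \mathrm{Im}\, z>0\}$ by fractional linear transformations. It is cofinite if the quotient $\Gamma\backslash\mathbb{H}$ has finite hyperbolic area. Trace set: for $T=\begin{bmatrix} a&b\\c&d\end{bmatrix}\in PSL(2,\mathbb{R})$ put $\mathrm{tr}(T)=|a+d|$, and $\mathrm{Tr}(\Gamma)=\{\mathrm{tr}(T) : T\in\Gamma\}\subset\mathbb{R}$ (a set, without multiplicities). B-C (bounded clustering) property: $\mathrm{Tr}(\Gamma)$ satisfies the B-C property iff there exists a constant $B(\Gamma)$ such that for all integers $n$ the set $\mathrm{Tr}(\Gamma)\cap[n,n+1]$ has less than $B(\Gamma)$ elements. Arithmetic Fuchsian groups: Let $F$ be a totally real algebraic number field of degree $n$, with ring of integers $\mathcal{O}_F$, and let $\varphi_1=\mathrm{id},\varphi_2,\dots,\varphi_n$ be the $n$ distinct embeddings of $F$ into $\mathbb{C}$ (so $F\subset\mathbb{R}$). For a field $K$ and $a,b\in K^*$, $\left(\frac{a,b}{K}\right)$ denotes the quaternion algebra over $K$ with basis $1,i,j,k$, where $i^2=a$, $j^2=b$, $k=ij=-ji$. Let $A=\left(\frac{a,b}{F}\right)$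 be a quaternion algebra over $F$ such that there exist $\mathbb{R}$-algebra isomorphisms $\rho_1:\left(\frac{\varphi_1(a),\varphi_1(b)}{\mathbb{R}}\right)\to M(2,\mathbb{R})$ and, for $2\le i\le n$, $\rho_i:\left(\frac{\varphi_i(a),\varphi_i(b)}{\mathbb{R}}\right)\to\left(\frac{-1,-1}{\mathbb{R}}\right)$. The reduced norm of $x=x_0+x_1i+x_2j+x_3k\in A$ is $\mathrm{Nrd}(x)=x_0^2-x_1^2a-x_2^2b+x_3^2ab$. An order $\mathcal{O}$ in $A$ is a subring of $A$ containing $1$ which is a finitely generated $\mathcal{O}_F$-module and generates $A$ over $F$; put $\mathcal{O}^1=\{x\in\mathcal{O} : \mathrm{Nrd}(x)=1\}$. Then $\Gamma(A,\mathcal{O}):=\rho_1(\mathcal{O}^1)/\{+1_2,-1_2\}$ is a Fuchsian group. Two Fuchsian groups are commensurable iff their intersection has finite index in each of them. A Fuchsian group is arithmetic iff it is commensurable with some $\Gamma(A,\mathcal{O})$ of this kind. *)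

theory Defs
  imports "HOL-Analysis.Analysis" "HOL-Algebra.Algebraic_Closure_Type"
begin

section \<open>The group \<open>PSL(2,\<real>)\<close>\<close>

definition SL2R :: "(real^2^2) monoid" where
  "SL2R = \<lparr>carrier = {A. det A = 1}, monoid.mult = (**), one = mat 1\<rparr>"

definition pm_one :: "(real^2^2) set" where
  "pm_one = {mat 1, - mat 1}"

definition PSL2R :: "(real^2^2) set monoid" where
  "PSL2R = SL2R Mod pm_one"

definition proj :: "real^2^2 \<Rightarrow> (real^2^2) set" where
  "proj A = pm_one #>\<^bsub>SL2R\<^esub> A"

definition PSL2R_topology :: "(real^2^2) set topology" where
  "PSL2R_topology = topology (\<lambda>U. U \<subseteq> carrier PSL2R \<and>
     openin (top_of_set (carrier SL2R)) {A \<in> carrier SL2R. proj A \<in> U})"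

lemma group_SL2R: "group SL2R"
proof (rule groupI)
  fix A assume "A \<in> carrier SL2R"
  then have A: "det A = 1" by (simp add: SL2R_def)
  then have "invertible A" by (simp add: invertible_det_nz)
  then obtain B where B: "A ** B = mat 1" "B ** A = mat 1"
    unfolding invertible_def by blast
  from arg_cong[OF B(2), of det] A have "det B = 1" by (simp add: det_mul)
  then show "\<exists>B\<in>carrier SL2R. B \<otimes>\<^bsub>SL2R\<^esub> A = \<one>\<^bsub>SL2R\<^esub>"
    using B by (auto simp: SL2R_def)
qed (auto simp: SL2R_def det_mul matrix_mul_assoc)

lemma uminus_matrix_mult: "(- A) ** B = - (A ** B)" "A ** (- B) = - (A ** B)"
  for A B :: "real^2^2"
  by (simp_all add: matrix_matrix_mult_def vec_eq_iff sum_negf)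

lemma proj_eq: "proj A = {A, - A}"
  by (auto simp: proj_def pm_one_def r_coset_def SL2R_def uminus_matrix_mult)

lemma det_uminus_2: "det (- A) = det (A :: real^2^2)"
  by (simp add: det_2)

lemma pm_one_normal: "pm_one \<lhd> SL2R"
proof -
  interpret group SL2R by (rule group_SL2R)
  have l: "(- mat 1) ** A = - A" and r: "A ** (- mat 1) = - A" for A :: "real^2^2"
    by (simp_all add: uminus_matrix_mult)
  have sub: "subgroup pm_one SL2R"
  proof (rule subgroupI)
    show "pm_one \<subseteq> carrier SL2R" "pm_one \<noteq> {}"
      by (auto simp: pm_one_def SL2R_def det_uminus_2)
    fix A B assume "A \<in> pm_one"
    then have "A \<otimes>\<^bsub>SL2R\<^esub> A = \<one>\<^bsub>SL2R\<^esub>" "A \<in> carrier SL2R"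
      by (auto simp: pm_one_def SL2R_def l det_uminus_2)
    then have "inv\<^bsub>SL2R\<^esub> A = A" by (simp add: inv_equality)
    then show "inv\<^bsub>SL2R\<^esub> A \<in> pm_one" using \<open>A \<in> pm_one\<close> by simp
    assume "B \<in> pm_one"
    then show "A \<otimes>\<^bsub>SL2R\<^esub> B \<in> pm_one"
      using \<open>A \<in> pm_one\<close> by (auto simp: pm_one_def SL2R_def l)
  qed
  then show ?thesis
    by (intro normalI ballI) (auto simp: r_coset_def l_coset_def pm_one_def SL2R_def l r)
qed

lemma group_PSL2R: "group PSL2R"
  unfolding PSL2R_def by (rule normal.factorgroup_is_group[OF pm_one_normal])

lemma carrier_PSL2R: "carrier PSL2R = proj ` carrier SL2R"
  by (simp add: PSL2R_def carrier_FactGroup proj_def image_def)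

lemma openin_PSL2R_topology:
  "openin PSL2R_topology U \<longleftrightarrow> U \<subseteq> carrier PSL2R \<and>
     openin (top_of_set (carrier SL2R)) {A \<in> carrier SL2R. proj A \<in> U}"
proof -
  have "istopology (\<lambda>U. U \<subseteq> carrier PSL2R \<and>
     openin (top_of_set (carrier SL2R)) {A \<in> carrier SL2R. proj A \<in> U})"
    unfolding istopology_def
  proof (intro conjI allI impI)
    fix S T
    assume S: "S \<subseteq> carrier PSL2R \<and> openin (top_of_set (carrier SL2R)) {A \<in> carrier SL2R. proj A \<in> S}"
      and T: "T \<subseteq> carrier PSL2R \<and> openin (top_of_set (carrier SL2R)) {A \<in> carrier SL2R. proj A \<in> T}"
    show "S \<inter> T \<subseteq> carrier PSL2R" using S by auto
    have "{A \<in> carrier SL2R. proj A \<in> S \<inter> T} =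
      {A \<in> carrier SL2R. proj A \<in> S} \<inter> {A \<in> carrier SL2R. proj A \<in> T}" by auto
    then show "openin (top_of_set (carrier SL2R)) {A \<in> carrier SL2R. proj A \<in> S \<inter> T}"
      using S T by (simp add: openin_Int)
  next
    fix K
    assume K: "\<forall>S\<in>K. S \<subseteq> carrier PSL2R \<and> openin (top_of_set (carrier SL2R)) {A \<in> carrier SL2R. proj A \<in> S}"
    show "\<Union>K \<subseteq> carrier PSL2R" using K by auto
    have eq: "{A \<in> carrier SL2R. proj A \<in> \<Union>K} = (\<Union>S\<in>K. {A \<in> carrier SL2R. proj A \<in> S})" by auto
    show "openin (top_of_set (carrier SL2R)) {A \<in> carrier SL2R. proj A \<in> \<Union>K}"
      unfolding eq by (rule openin_Union) (use K in blast)
  qed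
  then show ?thesis by (simp add: PSL2R_topology_def topology_inverse')
qed

lemma quotient_map_proj: "quotient_map (top_of_set (carrier SL2R)) PSL2R_topology proj"
proof -
  have "topspace PSL2R_topology = carrier PSL2R"
  proof
    have "{A \<in> carrier SL2R. proj A \<in> carrier PSL2R} = carrier SL2R"
      by (auto simp: carrier_PSL2R)
    then have "openin PSL2R_topology (carrier PSL2R)"
      by (simp add: openin_PSL2R_topology)
    then show "carrier PSL2R \<subseteq> topspace PSL2R_topology" by (rule openin_subset)
    show "topspace PSL2R_topology \<subseteq> carrier PSL2R"
      using openin_topspace openin_PSL2R_topology by blast
  qed
  then show ?thesis
    by (auto simp: quotient_map_def openin_PSL2R_topology carrier_PSL2R)
qed


section \<open>Cofinite Fuchsian groups\<close>

definition fuchsian :: "(real^2^2) set set \<Rightarrow> bool" where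
  "fuchsian \<Gamma> \<longleftrightarrow> subgroup \<Gamma> PSL2R \<and> subtopology PSL2R_topology \<Gamma> = discrete_topology \<Gamma>"

definition upper_half_plane :: "complex set" where
  "upper_half_plane = {z. Im z > 0}"

definition frac_lin :: "real^2^2 \<Rightarrow> complex \<Rightarrow> complex" where
  "frac_lin A z = (of_real (A$1$1) * z + of_real (A$1$2)) / (of_real (A$2$1) * z + of_real (A$2$2))"

text \<open>Functions of \<open>\<plusminus>A\<close> are evaluated as the common value on the two representatives.\<close>

definition act :: "(real^2^2) set \<Rightarrow> complex \<Rightarrow> complex" where
  "act T z = the_elem ((\<lambda>A. frac_lin A z) ` T)"

lemma act_proj: "act (proj A) z = frac_lin A z"
proof -
  have "frac_lin (- A) z = frac_lin A z"
  proof -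
    have "of_real ((- A)$i$1) * z + of_real ((- A)$i$2) = - (of_real (A$i$1) * z + of_real (A$i$2))"
      for i by simp
    then show ?thesis by (simp only: frac_lin_def minus_divide_divide)
  qed
  then show ?thesis by (simp add: act_def proj_eq)
qed

definition hyperbolic_area :: "complex measure" where
  "hyperbolic_area = density lborel (\<lambda>z. ennreal (indicator upper_half_plane z / (Im z)\<^sup>2))"

text \<open>A Borel set meeting every orbit in exactly one point is mapped bijectively onto
  the quotient of the upper half plane by \<open>\<Gamma>\<close>; its area is the area of the quotient and does not
  depend on its choice.\<close>

definition fundamental_set :: "(real^2^2) set set \<Rightarrow> complex set \<Rightarrow> bool" where
  "fundamental_set \<Gamma> D \<longleftrightarrow> D \<in> sets borel \<and> D \<subseteq> upper_half_plane \<and>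
     (\<forall>z\<in>upper_half_plane. \<exists>!w. w \<in> D \<and> (\<exists>T\<in>\<Gamma>. w = act T z))"

definition cofinite_area :: "(real^2^2) set set \<Rightarrow> bool" where
  "cofinite_area \<Gamma> \<longleftrightarrow> (\<exists>D. fundamental_set \<Gamma> D \<and> emeasure hyperbolic_area D < \<infinity>)"


section \<open>Traces\<close>

definition tr :: "(real^2^2) set \<Rightarrow> real" where
  "tr T = the_elem ((\<lambda>A. \<bar>trace A\<bar>) ` T)"

lemma tr_proj: "tr (proj A) = \<bar>A$1$1 + A$2$2\<bar>"
proof -
  have *: "trace B = B$1$1 + B$2$2" for B :: "real^2^2"
    by (simp add: trace_def sum_2)
  have "\<bar>trace (- A)\<bar> = \<bar>trace A\<bar>" unfolding * by simp
  then show ?thesis using *[of A] by (simp add: tr_def proj_eq)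
qed

definition Tr :: "(real^2^2) set set \<Rightarrow> real set" where
  "Tr \<Gamma> = tr ` \<Gamma>"

definition parabolic :: "(real^2^2) set \<Rightarrow> bool" where
  "parabolic T \<longleftrightarrow> T \<in> carrier PSL2R \<and> T \<noteq> \<one>\<^bsub>PSL2R\<^esub> \<and> tr T = 2"

definition bounded_clustering :: "real set \<Rightarrow> bool" where
  "bounded_clustering S \<longleftrightarrow>
     (\<exists>B::nat. \<forall>n::int. finite (S \<inter> {of_int n..of_int n + 1}) \<and>
                        card (S \<inter> {of_int n..of_int n + 1}) < B)"


section \<open>Totally real number fields\<close>

abbreviation real_ring :: "real ring" where
  "real_ring \<equiv> ring_of_type_algebra"

abbreviation complex_ring :: "complex ring" where
  "complex_ring \<equiv> ring_of_type_algebra"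

text \<open>Number fields are given together with a real embedding, that is, as subfields of \<open>\<real>\<close>.\<close>

definition real_number_field :: "real set \<Rightarrow> bool" where
  "real_number_field F \<longleftrightarrow> subfield F real_ring \<and> (\<exists>n. ring.dimension real_ring n \<rat> F)"

text \<open>Only the values on \<open>F\<close> of an embedding are meaningful.\<close>

definition embeddings :: "real set \<Rightarrow> (real \<Rightarrow> complex) set" where
  "embeddings F = ring_hom (real_ring\<lparr>carrier := F\<rparr>) complex_ring"

definition totally_real :: "real set \<Rightarrow> bool" where
  "totally_real F \<longleftrightarrow> (\<forall>\<phi>\<in>embeddings F. \<phi> ` F \<subseteq> \<real>)"

definition integers_of :: "real set \<Rightarrow> real set" where
  "integers_of F = {x \<in> F. algebraic_int x}"


section \<open>Quaternion algebras and orders\<close>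

text \<open>The tuple \<open>(x0, x1, x2, x3)\<close> stands for \<open>x0 + x1 i + x2 j + x3 k\<close>.\<close>

type_synonym quat = "real \<times> real \<times> real \<times> real"

fun qmult :: "real \<Rightarrow> real \<Rightarrow> quat \<Rightarrow> quat \<Rightarrow> quat" where
  "qmult a b (x0, x1, x2, x3) (y0, y1, y2, y3) =
     (x0 * y0 + a * x1 * y1 + b * x2 * y2 - a * b * x3 * y3,
      x0 * y1 + x1 * y0 - b * x2 * y3 + b * x3 * y2,
      x0 * y2 + x2 * y0 + a * x1 * y3 - a * x3 * y1,
      x0 * y3 + x3 * y0 + x1 * y2 - x2 * y1)"

definition quaternion_algebra :: "real set \<Rightarrow> real \<Rightarrow> real \<Rightarrow> quat ring" where
  "quaternion_algebra K a b =
     \<lparr>carrier = K \<times> K \<times> K \<times> K, monoid.mult = qmult a b, one = (1, 0, 0, 0),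
      ring.zero = 0, add = (+)\<rparr>"

lemma qmult_basis:
  defines "i \<equiv> (0, 1, 0, 0)" and "j \<equiv> (0, 0, 1, 0)" and "k \<equiv> (0, 0, 0, 1)"
  shows "qmult a b i i = (a, 0, 0, 0)" "qmult a b j j = (b, 0, 0, 0)"
    "qmult a b i j = k" "qmult a b j i = - k"
  by (simp_all add: i_def j_def k_def)

lemma ring_quaternion_algebra:
  assumes K: "subring K real_ring" and "a \<in> K" "b \<in> K"
  shows "ring (quaternion_algebra K a b)"
proof -
  have R: "abelian_group real_ring"
    using ring_from_type_algebra by (rule ring.is_abelian_group)
  have inv: "\<ominus>\<^bsub>real_ring\<^esub> x = - x" for x
    by (rule abelian_group.minus_equality[OF R]) (simp_all add: ring_of_type_algebra_def)
  have zero: "0 \<in> K" and one: "1 \<in> K"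
    using subringE(2,3)[OF K] by (simp_all add: ring_of_type_algebra_def)
  have uminus: "- x \<in> K" if "x \<in> K" for x
    using subringE(5)[OF K that] by (simp add: inv)
  have add: "x + y \<in> K" if "x \<in> K" "y \<in> K" for x y
    using subringE(7)[OF K that] by (simp add: ring_of_type_algebra_def)
  have mult: "x * y \<in> K" if "x \<in> K" "y \<in> K" for x y
    using subringE(6)[OF K that] by (simp add: ring_of_type_algebra_def)
  have diff: "x - y \<in> K" if "x \<in> K" "y \<in> K" for x y
    using add[OF that(1) uminus[OF that(2)]] by simp
  let ?Q = "quaternion_algebra K a b"
  have assoc: "qmult a b (qmult a b x y) z = qmult a b x (qmult a b y z)" for x y z
    by (cases x; cases y; cases z) (simp add: algebra_simps)
  have distrib: "qmult a b (x + y) z = qmult a b x z + qmult a b y z"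
    "qmult a b z (x + y) = qmult a b z x + qmult a b z y" for x y z
    by (cases x; cases y; cases z; simp add: algebra_simps)+
  have unit: "qmult a b (1, 0, 0, 0) x = x" "qmult a b x (1, 0, 0, 0) = x" for x
    by (cases x; simp)+
  have closed: "qmult a b x y \<in> carrier ?Q" "x + y \<in> carrier ?Q"
    if "x \<in> carrier ?Q" "y \<in> carrier ?Q" for x y
    using that assms(2,3)
    by (auto simp: quaternion_algebra_def intro!: add mult diff)
  have neg: "- x \<in> carrier ?Q" if "x \<in> carrier ?Q" for x
    using that by (auto simp: quaternion_algebra_def intro!: uminus)
  have zero_one: "(1, 0, 0, 0) \<in> carrier ?Q" "0 \<in> carrier ?Q"
    by (auto simp: quaternion_algebra_def zero_prod_def zero one)
  have ops: "x \<otimes>\<^bsub>?Q\<^esub> y = qmult a b x y" "x \<oplus>\<^bsub>?Q\<^esub> y = x + y"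
    "\<one>\<^bsub>?Q\<^esub> = (1, 0, 0, 0)" "\<zero>\<^bsub>?Q\<^esub> = 0" for x y
    by (simp_all add: quaternion_algebra_def)
  have "abelian_group ?Q"
  proof (rule abelian_groupI, unfold ops)
    fix x assume "x \<in> carrier ?Q"
    then show "\<exists>y\<in>carrier ?Q. y + x = 0"
      using neg by (intro bexI[of _ "- x"]) auto
  qed (use closed zero_one in \<open>simp_all add: add.commute add.left_commute\<close>)
  moreover have "monoid ?Q"
    by (rule monoidI, unfold ops) (use closed zero_one in \<open>simp_all add: assoc unit\<close>)
  ultimately show ?thesis
    by (rule ringI, unfold ops) (rule distrib)+
qed

fun nrd :: "real \<Rightarrow> real \<Rightarrow> quat \<Rightarrow> real" where
  "nrd a b (x0, x1, x2, x3) = x0\<^sup>2 - x1\<^sup>2 * a - x2\<^sup>2 * b + x3\<^sup>2 * a * b"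

definition M2R :: "(real^2^2) ring" where
  "M2R = \<lparr>carrier = UNIV, monoid.mult = (**), one = mat 1, ring.zero = 0, add = (+)\<rparr>"

definition real_algebra_iso ::
    "('a::real_vector) ring \<Rightarrow> ('b::real_vector) ring \<Rightarrow> ('a \<Rightarrow> 'b) set" where
  "real_algebra_iso A B = {\<rho> \<in> ring_iso A B.
     \<forall>c. \<forall>x\<in>carrier A. \<rho> (c *\<^sub>R x) = c *\<^sub>R \<rho> x}"

definition lin_span :: "real set \<Rightarrow> quat set \<Rightarrow> quat set" where
  "lin_span C Y = {\<Sum>s\<in>S. c s *\<^sub>R s | S c. finite S \<and> S \<subseteq> Y \<and> c ` S \<subseteq> C}"

text \<open>Since an order is closed under multiplication, the \<open>F\<close>-algebra it generates is its
  \<open>F\<close>-linear span.\<close>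

definition is_order :: "real set \<Rightarrow> real \<Rightarrow> real \<Rightarrow> quat set \<Rightarrow> bool" where
  "is_order F a b \<O> \<longleftrightarrow>
     subring \<O> (quaternion_algebra F a b) \<and>
     (\<exists>S. finite S \<and> \<O> = lin_span (integers_of F) S) \<and>
     lin_span F \<O> = carrier (quaternion_algebra F a b)"

definition norm_one_group :: "real \<Rightarrow> real \<Rightarrow> quat set \<Rightarrow> quat set" where
  "norm_one_group a b \<O> = {x \<in> \<O>. nrd a b x = 1}"


section \<open>Arithmetic Fuchsian groups\<close>

text \<open>The identity embedding is \<open>complex_of_real\<close> on \<open>F\<close>. As \<open>F\<close> is totally real, \<open>Re\<close> only
  transports \<open>\<phi> a\<close> and \<open>\<phi> b\<close> from \<open>\<complex>\<close> to \<open>\<real>\<close>.\<close>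

definition arithmetic_datum ::
    "real set \<Rightarrow> real \<Rightarrow> real \<Rightarrow> (quat \<Rightarrow> real^2^2) \<Rightarrow> quat set \<Rightarrow> bool" where
  "arithmetic_datum F a b \<rho>\<^sub>1 \<O> \<longleftrightarrow>
     real_number_field F \<and> totally_real F \<and>
     a \<in> F \<and> b \<in> F \<and> a \<noteq> 0 \<and> b \<noteq> 0 \<and>
     \<rho>\<^sub>1 \<in> real_algebra_iso (quaternion_algebra UNIV a b) M2R \<and>
     (\<forall>\<phi>\<in>embeddings F. (\<exists>x\<in>F. \<phi> x \<noteq> complex_of_real x) \<longrightarrow>
        real_algebra_iso (quaternion_algebra UNIV (Re (\<phi> a)) (Re (\<phi> b)))
          (quaternion_algebra UNIV (-1) (-1)) \<noteq> {}) \<and>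
     is_order F a b \<O>"

definition \<Gamma>_of :: "real \<Rightarrow> real \<Rightarrow> (quat \<Rightarrow> real^2^2) \<Rightarrow> quat set \<Rightarrow> (real^2^2) set set" where
  "\<Gamma>_of a b \<rho>\<^sub>1 \<O> = proj ` \<rho>\<^sub>1 ` norm_one_group a b \<O>"

definition commensurable :: "(real^2^2) set set \<Rightarrow> (real^2^2) set set \<Rightarrow> bool" where
  "commensurable \<Gamma> \<Delta> \<longleftrightarrow>
     finite (rcosets\<^bsub>PSL2R\<lparr>carrier := \<Gamma>\<rparr>\<^esub> (\<Gamma> \<inter> \<Delta>)) \<and>
     finite (rcosets\<^bsub>PSL2R\<lparr>carrier := \<Delta>\<rparr>\<^esub> (\<Gamma> \<inter> \<Delta>))"

definition arithmetic :: "(real^2^2) set set \<Rightarrow> bool" where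
  "arithmetic \<Gamma> \<longleftrightarrow> fuchsian \<Gamma> \<and>
     (\<exists>F a b \<rho>\<^sub>1 \<O>. arithmetic_datum F a b \<rho>\<^sub>1 \<O> \<and> commensurable \<Gamma> (\<Gamma>_of a b \<rho>\<^sub>1 \<O>))"

end

theory Submission
  imports Defs "HOL-Number_Theory.Number_Theory"
begin

text \<open>
  Replace \<open>\<Gamma>\<close> by its preimage \<open>G\<close> in \<open>SL(2,\<real>)\<close>, conjugated so that a parabolic element becomes
  the shear \<open>U = shear 1\<close>. For \<open>A \<in> G\<close> with lower left entry \<open>c\<close> the traces
  \<open>trace (A U\<^sup>k) = trace A + k c\<close> form a complete arithmetic progression in the trace set, and both
  implications are about these progressions.

  From bounded clustering to arithmeticity. Bounded clustering leaves at most \<open>B L + B\<close> traces in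
  \<open>[-L, L]\<close>. Progressions with pairwise incommensurable differences \<open>m\<^sub>i\<close> meet pairwise in at most
  one point, so they satisfy \<open>\<Sum> 2 / \<bar>m\<^sub>i\<bar> \<le> B\<close> (\<open>incommensurable_progressions\<close>). If \<open>trace A / c\<close> were
  irrational, the products \<open>A U\<^sup>n A\<close> would provide the differences \<open>c (trace A + n c)\<close> and the sum
  would be a harmonic series. Hence \<open>trace A / c\<close> is rational; applied to \<open>A U\<^sup>n A\<close> and to
  \<open>V U\<^sup>n Y\<close> this gives \<open>c\<^sup>2 \<in> \<rat>\<close> and rational differences of cusps. After a translation every
  matrix of \<open>G\<close> is the square root of an integer times a rational matrix.

  It remains to bound denominators. A rational trace is an integer: if \<open>trace A = u / v\<close>, then for
  each power \<open>A\<^sup>m\<close> the traces of \<open>A\<^sup>m U\<^sup>n A U\<^sup>k\<close> are \<open>s x y - \<kappa>\<close> with \<open>x\<close>, \<open>y\<close> running through a fixed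
  residue class modulo some \<open>q\<close> prime to it. Since almost every integer has a divisor in that class
  (\<open>divisor_generic_coprime\<close>), the products \<open>x y\<close> fill almost all of the residue class that contains them, and
  the linear bound on the number of traces gives \<open>1 \<le> 2 B \<bar>s\<bar> q\<close>
  (\<open>products_in_class_density\<close>), and the Lucas recurrence of the powers turns this
  into a bound for \<open>v\<^sup>m\<close>, uniform in \<open>m\<close>; so \<open>v = 1\<close> (\<open>rational_trace_integral\<close>). So the
  squares of all traces are integers. Up to square roots of integers the traces
  of \<open>A\<close>, \<open>A U\<close>, \<open>A \<gamma>\<close> and \<open>A \<gamma> U\<close> for one rational \<open>\<gamma>\<close> are then integers that determine \<open>A\<close> with a
  fixed denominator, hence \<open>G \<inter> SL(2,\<int>)\<close> has finite index in \<open>G\<close> (\<open>commensurable_with_integral_matrices\<close>). It inherits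
  finite coarea, and in the modular group finite coarea means finite index, because the translates
  of a small cell with respect to different cosets use disjoint parts of a fundamental set
  (\<open>finite_coarea_finite_index\<close>). So \<open>\<Gamma>\<close> is commensurable with a conjugate of the modular group,
  which is the group of the quaternion algebra with \<open>a = b = 1\<close> over \<open>\<rat>\<close>.

  From arithmeticity to bounded clustering. A parabolic element, less the identity, is a nonzero
  quaternion of norm zero. A nonidentity embedding of the field would carry it into
  the Hamilton quaternions, where the norm is definite; so the identity is the only embedding
  and the field is \<open>\<rat>\<close> (\<open>arithmetic_with_parabolic_rational\<close>). The trace form then makes the matrices
  of the order rational in a suitable basis, with bounded denominators since the order is finitely
  generated. An element of \<open>\<Gamma>\<close> commensurates this rational algebra and is therefore a multiple of a
  rational matrix. Over each of the finitely many cosets the traces lie in one progression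
  \<open>\<kappa> \<int>\<close>, and a finite union of these clusters boundedly
  (\<open>progressions_bounded_clustering\<close>).
\<close>

(* The dollar sign denotes matrix entries, and primes are those of the type class. *)
no_notation fps_nth (infixl "$" 75)
hide_const (open) Divisibility.prime

section \<open>Almost every integer has a divisor in a given residue class\<close>

definition recip_summable :: "nat set \<Rightarrow> bool" where
  "recip_summable A \<longleftrightarrow> (\<exists>C. \<forall>F. finite F \<and> F \<subseteq> A \<longrightarrow> (\<Sum>p\<in>F. 1 / real p) \<le> C)"

lemma recip_summable_mono: "recip_summable B \<Longrightarrow> A \<subseteq> B \<Longrightarrow> recip_summable A"
  unfolding recip_summable_def by (meson subset_trans)

lemma recip_summable_finite: "finite A \<Longrightarrow> recip_summable A"
  unfolding recip_summable_def by (intro exI[of _ "\<Sum>p\<in>A. 1 / real p"]) (auto intro: sum_mono2)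

lemma recip_summable_Un:
  assumes "recip_summable A" "recip_summable B" shows "recip_summable (A \<union> B)"
proof -
  obtain C where C: "\<And>F. finite F \<Longrightarrow> F \<subseteq> A \<Longrightarrow> (\<Sum>p\<in>F. 1 / real p) \<le> C"
    using assms(1) unfolding recip_summable_def by blast
  obtain D where D: "\<And>F. finite F \<Longrightarrow> F \<subseteq> B \<Longrightarrow> (\<Sum>p\<in>F. 1 / real p) \<le> D"
    using assms(2) unfolding recip_summable_def by blast
  have "(\<Sum>p\<in>F. 1 / real p) \<le> C + D" if F: "finite F" "F \<subseteq> A \<union> B" for F
  proof -
    have "(\<Sum>p\<in>F. 1 / real p) = (\<Sum>p\<in>F \<inter> A. 1 / real p) + (\<Sum>p\<in>F - A. 1 / real p)"
      using F(1) by (metis sum.Int_Diff)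
    also have "\<dots> \<le> C + D" using F by (intro add_mono C D) auto
    finally show ?thesis .
  qed
  then show ?thesis unfolding recip_summable_def by blast
qed

lemma recip_summable_UN:
  assumes "finite I" "\<And>i. i \<in> I \<Longrightarrow> recip_summable (A i)" shows "recip_summable (\<Union>i\<in>I. A i)"
  using assms by (induction I) (auto intro: recip_summable_Un recip_summable_finite)

lemma recip_summable_tail:
  assumes A: "recip_summable A" and e: "e > 0"
  obtains F where "finite F" "F \<subseteq> A" "\<And>F'. finite F' \<Longrightarrow> F' \<subseteq> A - F \<Longrightarrow> (\<Sum>p\<in>F'. 1 / real p) \<le> e"
proof (rule ccontr)
  note T = that
  assume neg: "\<not> thesis"
  have step: "\<exists>F'. finite F' \<and> F' \<subseteq> A - F \<and> (\<Sum>p\<in>F'. 1 / real p) > e"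
    if assms_F: "finite F" "F \<subseteq> A" for F
  proof (rule ccontr)
    assume no: "\<not> ?thesis"
    have c: "(\<Sum>p\<in>F'. 1 / real p) \<le> e" if "finite F'" "F' \<subseteq> A - F" for F'
    proof (rule ccontr)
      assume "\<not> (\<Sum>p\<in>F'. 1 / real p) \<le> e"
      then have "finite F' \<and> F' \<subseteq> A - F \<and> (\<Sum>p\<in>F'. 1 / real p) > e" using that by simp
      then show False using no by blast
    qed
    have thesis by (rule T[OF assms_F]) (rule c)
    then show False using neg by simp
  qed
  have "\<exists>F. finite F \<and> F \<subseteq> A \<and> (\<Sum>p\<in>F. 1 / real p) \<ge> n * e" for n :: nat
  proof (induction n)
    case 0 then show ?case by (intro exI[of _ "{}"]) auto
  next
    case (Suc n)
    then obtain F where F: "finite F" "F \<subseteq> A" "(\<Sum>p\<in>F. 1 / real p) \<ge> n * e" by blast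
    obtain F' where F': "finite F'" "F' \<subseteq> A - F" "(\<Sum>p\<in>F'. 1 / real p) > e"
      using step[OF F(1,2)] by blast
    have "(\<Sum>p\<in>F \<union> F'. 1 / real p) = (\<Sum>p\<in>F. 1 / real p) + (\<Sum>p\<in>F'. 1 / real p)"
      using F F' by (intro sum.union_disjoint) auto
    moreover have "Suc n * e = n * e + e" by (simp add: algebra_simps)
    ultimately have "(\<Sum>p\<in>F \<union> F'. 1 / real p) \<ge> Suc n * e" using F(3) F'(3) by linarith
    moreover have "finite (F \<union> F')" "F \<union> F' \<subseteq> A" using F F' by auto
    ultimately show ?case by blast
  qed
  note large = this
  obtain C where C: "\<And>F. finite F \<Longrightarrow> F \<subseteq> A \<Longrightarrow> (\<Sum>p\<in>F. 1 / real p) \<le> C"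
    using A unfolding recip_summable_def by blast
  have "n * e \<le> C" for n :: nat
  proof -
    obtain F where F: "finite F" "F \<subseteq> A" "(\<Sum>p\<in>F. 1 / real p) \<ge> n * e" using large by blast
    show ?thesis using F(3) C[OF F(1,2)] by linarith
  qed
  moreover obtain n :: nat where "C < n * e" using ex_less_of_nat_mult[OF e] by blast
  ultimately show False by (meson not_le)
qed

lemma card_dvd_progression_le:
  fixes p M n0 K :: nat
  assumes "coprime p M" "p > 0"
  shows "real (card {k\<in>{1..K}. p dvd n0 + k * M}) \<le> K / p + 1"
proof -
  let ?S = "{k\<in>{1..K}. p dvd n0 + k * M}"
  \<comment> \<open>the solutions form one class modulo \<open>p\<close>\<close>
  have "inj_on (\<lambda>k. k div p) ?S"
  proof (rule inj_onI)
    fix k k' assume k: "k \<in> ?S" "k' \<in> ?S" and eq: "k div p = k' div p"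
    have "[n0 + k * M = n0 + k' * M] (mod p)" using k by (simp add: cong_def dvd_eq_mod_eq_0)
    then have "[k * M = k' * M] (mod p)" by (simp add: cong_add_lcancel_nat)
    then have "[k = k'] (mod p)" using cong_mult_rcancel_nat[of M p k k'] assms(1) by (simp add: coprime_commute)
    then have "k mod p = k' mod p" by (simp add: cong_def)
    then show "k = k'" using eq by (metis div_mult_mod_eq)
  qed
  moreover have "(\<lambda>k. k div p) ` ?S \<subseteq> {0..K div p}" by (auto intro: div_le_mono)
  ultimately have "card ?S \<le> card {0..K div p}" by (meson card_inj_on_le finite_atLeastAtMost)
  then have "real (card ?S) \<le> real (K div p) + 1" by simp
  also have "real (K div p) \<le> K / p" by (rule of_nat_div_le_of_nat)
  finally show ?thesis by simp
qed

text \<open>A sieve: if every member of the class had a prime factor in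
  the sparse set \<open>E\<close>, then so would \<open>K\<close> consecutive members congruent to \<open>1\<close> modulo the
  first primes of \<open>E\<close>. The remaining primes have so small a reciprocal sum that they divide fewer
  than \<open>K\<close> of them; the error terms \<open>1\<close> per prime are controlled by a second, much later tail.\<close>
lemma exists_cong_avoiding_sparse_primes:
  fixes q b :: nat
  assumes q: "q > 0" and b: "coprime b q" and prime: "\<And>p. p \<in> E \<Longrightarrow> prime p"
    and cop: "\<And>p. p \<in> E \<Longrightarrow> coprime p q" and E: "recip_summable E"
  shows "\<exists>n>0. [n = b] (mod q) \<and> (\<forall>p\<in>E. \<not> p dvd n)"
proof (rule ccontr)
  assume "\<not> ?thesis"
  then have "\<forall>n. n > 0 \<longrightarrow> [n = b] (mod q) \<longrightarrow> (\<exists>p\<in>E. p dvd n)"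
    by (simp only: not_ex de_Morgan_conj ball_simps not_not) blast
  then have neg: "\<exists>p\<in>E. p dvd n" if "n > 0" "[n = b] (mod q)" for n using that by simp
  obtain E1 where E1: "finite E1" "E1 \<subseteq> E"
    and tail1: "\<And>F. finite F \<Longrightarrow> F \<subseteq> E - E1 \<Longrightarrow> (\<Sum>p\<in>F. 1 / real p) \<le> 1/2"
    using recip_summable_tail[OF E, of "1/2"] by auto
  define Q where "Q = \<Prod>E1"
  have Qcop: "coprime q Q"
    unfolding Q_def using cop E1 by (intro prod_coprime_right) (auto simp: coprime_commute)
  have Qpos: "Q > 0" unfolding Q_def using prime E1 by (intro prod_pos) (auto simp: prime_gt_0_nat)
  define M where "M = q * Q"
  have Mpos: "M > 0" using q Qpos by (simp add: M_def)
  obtain E2 where E2: "finite E2" "E2 \<subseteq> E"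
    and tail2: "\<And>F. finite F \<Longrightarrow> F \<subseteq> E - E2 \<Longrightarrow> (\<Sum>p\<in>F. 1 / real p) \<le> 1/(4*M)"
    using recip_summable_tail[OF E, of "1/(4*M)"] Mpos by auto
  obtain x where x: "[x = b] (mod q)" "[x = 1] (mod Q)"
    using binary_chinese_remainder_nat[OF Qcop] by blast
  define n0 where "n0 = x mod M"
  have n0: "[n0 = b] (mod q)" "[n0 = 1] (mod Q)" "n0 < M"
    using x Mpos unfolding n0_def M_def by (auto simp: cong_def mod_mod_cancel)
  \<comment> \<open>large enough that \<open>K/2 + card E2 + (K+1)/4\<close> is smaller than \<open>K\<close>\<close>
  define K where "K = 4 * card E2 + 2"
  define E' where "E' = {p\<in>E - E1. p \<le> (K+1) * M}"
  have finE': "finite E'" by (rule finite_subset[of _ "{..(K+1)*M}"]) (auto simp: E'_def)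
  have cover: "{1..K} \<subseteq> (\<Union>p\<in>E'. {k\<in>{1..K}. p dvd n0 + k * M})"
  proof
    fix k assume k: "k \<in> {1..K}"
    have cq: "[n0 + k * M = b] (mod q)"
      using n0(1) mod_mult_self1[of n0 "k * Q" q] by (simp add: M_def cong_def mult_ac)
    have cQ: "[n0 + k * M = 1] (mod Q)"
      using n0(2) mod_mult_self1[of n0 "k * q" Q] by (simp add: M_def cong_def mult_ac)
    have "n0 + k * M > 0" using k Mpos by auto
    then obtain p where p: "p \<in> E" "p dvd n0 + k * M" using neg[OF \<open>n0 + k * M > 0\<close> cq] by blast
    have "p \<notin> E1"
    proof
      assume "p \<in> E1"
      then have "p dvd Q" unfolding Q_def using E1 by (intro dvd_prodI) auto
      then have "[n0 + k * M = 1] (mod p)" using cQ cong_dvd_modulus_nat by blast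
      then have "p dvd 1" using p(2) cong_dvd_iff by blast
      then show False using prime[OF p(1)] by simp
    qed
    moreover have "p \<le> n0 + k * M" using p(2) \<open>n0 + k * M > 0\<close> by (simp add: dvd_imp_le)
    moreover have "n0 + k * M \<le> (K+1) * M"
    proof -
      have "k * M \<le> K * M" using k by auto
      then show ?thesis unfolding add_mult_distrib using n0(3) by linarith
    qed
    ultimately show "k \<in> (\<Union>p\<in>E'. {k\<in>{1..K}. p dvd n0 + k * M})"
      using p k unfolding E'_def by auto
  qed
  have cardE': "real (card E') \<le> card E2 + (K+1)/4"
  proof -
    have "real (card (E' - E2)) = (\<Sum>p\<in>E' - E2. 1)" by simp
    also have "\<dots> \<le> (\<Sum>p\<in>E' - E2. ((K+1) * M) * (1 / real p))"
    proof (rule sum_mono)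
      fix p assume "p \<in> E' - E2"
      then have "p \<le> (K+1)*M" "p > 0" using prime by (auto simp: E'_def prime_gt_0_nat)
      then have "real p \<le> real ((K+1)*M)" "real p > 0" by (simp_all only: of_nat_le_iff of_nat_0_less_iff)
      then show "1 \<le> ((K+1) * M) * (1 / real p)" by (simp add: field_simps)
    qed
    also have "\<dots> = ((K+1) * M) * (\<Sum>p\<in>E' - E2. 1 / real p)" by (simp only: sum_distrib_left)
    also have "\<dots> \<le> ((K+1) * M) * (1/(4*M))"
      using finE' by (intro mult_left_mono tail2) (auto simp: E'_def)
    also have "\<dots> = (K+1)/4" using Mpos by (simp add: field_simps)
    finally have 1: "real (card (E' - E2)) \<le> (K+1)/4" .
    have "card E' \<le> card (E2 \<union> (E' - E2))" using E2 finE' by (intro card_mono) auto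
    also have "\<dots> \<le> card E2 + card (E' - E2)" by (rule card_Un_le)
    finally show ?thesis using 1 by linarith
  qed
  have "real K = card {1..K}" by simp
  also have "\<dots> \<le> (\<Sum>p\<in>E'. card {k\<in>{1..K}. p dvd n0 + k * M})"
  proof -
    have "card {1..K} \<le> card (\<Union>p\<in>E'. {k\<in>{1..K}. p dvd n0 + k * M})"
      using finE' by (intro card_mono cover) auto
    also have "\<dots> \<le> (\<Sum>p\<in>E'. card {k\<in>{1..K}. p dvd n0 + k * M})" by (rule card_UN_le[OF finE'])
    finally show ?thesis by (simp only: of_nat_le_iff)
  qed
  also have "\<dots> = (\<Sum>p\<in>E'. real (card {k\<in>{1..K}. p dvd n0 + k * M}))" by simp
  also have "\<dots> \<le> (\<Sum>p\<in>E'. K / p + 1)"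
  proof (rule sum_mono)
    fix p assume p: "p \<in> E'"
    have pp: "prime p" "coprime p q" "p \<notin> E1" using p prime cop by (auto simp: E'_def)
    have "coprime p Q" unfolding Q_def
    proof (rule prod_coprime_right)
      fix r assume "r \<in> E1"
      then show "coprime p r" using pp prime E1 by (metis primes_coprime subset_iff)
    qed
    then have "coprime p M" using pp by (simp add: M_def)
    then show "real (card {k\<in>{1..K}. p dvd n0 + k * M}) \<le> K / p + 1"
      using pp by (intro card_dvd_progression_le) (auto simp: prime_gt_0_nat)
  qed
  also have "\<dots> = K * (\<Sum>p\<in>E'. 1 / real p) + card E'"
    by (simp add: sum.distrib sum_distrib_left)
  also have "\<dots> \<le> K * (1/2) + (card E2 + (K+1)/4)"
    using finE' cardE' by (intro add_mono mult_left_mono tail1) (auto simp: E'_def)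
  finally have le: "real K \<le> K * (1/2) + (card E2 + (K+1)/4)" .
  have absurd: False if "x \<le> x * (1/2) + (y + z/4)" "x = 4 * y + 2" "z = x + 1" for x y z :: real
    using that by linarith
  show False by (rule absurd[OF le]) (simp_all add: K_def)
qed

text \<open>A density statement in a form that can be multiplied: a finite set \<open>V\<close> of numbers in the class of
  \<open>b\<close> already divides all but a proportion \<open>e\<close> of the integers. The set \<open>A\<close> of numbers to be
  avoided makes it possible to choose divisors for a second class coprime to those for the first,
  so that products of two divisors are again divisors.\<close>
definition divisor_generic :: "nat \<Rightarrow> nat \<Rightarrow> bool" where
  "divisor_generic q b \<longleftrightarrow> (\<forall>A e. finite A \<and> 0 \<notin> A \<and> e > 0 \<longrightarrow>
     (\<exists>V M. finite V \<and> M > 0 \<and>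
       (\<forall>x\<in>V. x > 0 \<and> [x = b] (mod q) \<and> (\<forall>a\<in>A. coprime x a)) \<and>
       (\<forall>j. real (card {N\<in>{..<j * M}. \<forall>x\<in>V. \<not> x dvd N}) \<le> e * real (j * M))))"

lemma coprime_add_multiple_iff: "coprime (N + j * M) M \<longleftrightarrow> coprime N (M::nat)"
proof -
  have "gcd M (N + j * M) = gcd M N" using gcd_add_mult[of M j N] by (simp only: add.commute)
  then show ?thesis by (simp only: coprime_iff_gcd_eq_1 gcd.commute[of _ M])
qed

lemma card_coprime_periodic:
  fixes M j :: nat assumes "M > 0"
  shows "card {N\<in>{..<j * M}. coprime N M} = j * totient M"
proof (induction j)
  case (Suc j)
  have sh: "{N\<in>{j*M..<Suc j * M}. coprime N M} = (\<lambda>N. N + j * M) ` {N\<in>{..<M}. coprime N M}"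
  proof (intro equalityI subsetI)
    fix N assume N: "N \<in> {N\<in>{j*M..<Suc j * M}. coprime N M}"
    have e: "N = (N - j * M) + j * M" using N by auto
    have "coprime ((N - j * M) + j * M) M" using N e by auto
    then have "coprime (N - j * M) M" by (simp only: coprime_add_multiple_iff)
    then show "N \<in> (\<lambda>N. N + j * M) ` {N\<in>{..<M}. coprime N M}"
      using N by (intro image_eqI[of _ _ "N - j * M"]) auto
  next
    fix N assume "N \<in> (\<lambda>N. N + j * M) ` {N\<in>{..<M}. coprime N M}"
    then obtain N' where "N = N' + j * M" "N' < M" "coprime N' M" by auto
    then show "N \<in> {N\<in>{j*M..<Suc j * M}. coprime N M}"
      by (auto simp: coprime_add_multiple_iff)
  qed
  have un: "{N\<in>{..<Suc j * M}. coprime N M} = {N\<in>{..<j * M}. coprime N M} \<union> {N\<in>{j*M..<Suc j * M}. coprime N M}"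
    by auto
  have fin: "finite {N\<in>{..<j * M}. coprime N M}" "finite {N\<in>{j*M..<Suc j * M}. coprime N M}"
    by (rule finite_subset[of _ "{..<Suc j * M}"]; auto)+
  have "card {N\<in>{..<Suc j * M}. coprime N M}
     = card {N\<in>{..<j * M}. coprime N M} + card {N\<in>{j*M..<Suc j * M}. coprime N M}"
    unfolding un by (rule card_Un_disjoint[OF fin]) auto
  also have "card {N\<in>{j*M..<Suc j * M}. coprime N M} = card {N\<in>{..<M}. coprime N M}"
    unfolding sh by (rule card_image) (auto intro: inj_onI)
  also have "card {N\<in>{..<M}. coprime N M} = totient M"
  proof (cases "M = 1")
    case True then have "{N\<in>{..<M}. coprime N M} = {0}" by auto
    then show ?thesis using True by simp
  next
    case False
    then have "{N\<in>{..<M}. coprime N M} = totatives M"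
      using assms by (auto simp: totatives_def le_less intro!: Nat.gr0I)
    then show ?thesis by (simp add: totient_def)
  qed
  finally show ?case using Suc by simp
qed auto

text \<open>Integers without a prime factor in \<open>F\<close> have density \<open>\<Prod> (1 - 1/p) \<le> exp (- \<Sum> 1/p)\<close>, which is
  arbitrarily small when the reciprocals of the primes in the class diverge.\<close>
lemma divisor_generic_prime_class:
  assumes "\<not> recip_summable {p. prime p \<and> [p = g] (mod q)}"
  shows "divisor_generic q g"
  unfolding divisor_generic_def
proof (intro allI impI)
  fix A :: "nat set" and e :: real assume A: "finite A \<and> 0 \<notin> A \<and> e > 0"
  let ?P = "{p. prime p \<and> [p = g] (mod q)}"
  define D where "D = (\<Union>a\<in>A. {d. d dvd a})"
  have "finite D" unfolding D_def using A by (intro finite_UN_I) (auto intro!: finite_divisors_nat Nat.gr0I)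
  then have "\<not> recip_summable (?P - D)"
    using assms recip_summable_Un[OF recip_summable_finite, of D "?P - D"]
      recip_summable_mono[of "D \<union> (?P - D)" ?P] by blast
  then obtain F where F: "finite F" "F \<subseteq> ?P - D" "(\<Sum>p\<in>F. 1 / real p) > - ln e"
    unfolding recip_summable_def not_le[symmetric] by blast
  have Fp: "prime p" if "p \<in> F" for p using F that by auto
  have zero: "0 \<notin> F" using Fp not_prime_0 by blast
  define M where "M = \<Prod>F"
  have Mpos: "M > 0" unfolding M_def using Fp by (intro prod_pos) (auto simp: prime_gt_0_nat)
  have pf: "prime_factors M = F"
  proof -
    have "prime_factors M = (\<Union>p\<in>F. prime_factors p)"
      unfolding M_def using F(1) zero by (subst prime_factors_prod) auto
    also have "\<dots> = F" using Fp by (auto simp: prime_factorization_prime)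
    finally show ?thesis .
  qed
  have tot: "real (totient M) \<le> e * M"
  proof -
    have "real (totient M) = M * (\<Prod>p\<in>F. 1 - 1 / real p)" using totient_formula2[of M] pf by simp
    also have "(\<Prod>p\<in>F. 1 - 1 / real p) \<le> (\<Prod>p\<in>F. exp (- (1 / real p)))"
    proof (rule prod_mono)
      fix p assume "p \<in> F"
      then have "real p \<ge> 1" using prime_ge_1_nat[OF Fp] by simp
      then show "0 \<le> 1 - 1 / real p \<and> 1 - 1 / real p \<le> exp (- (1 / real p))"
        using exp_ge_add_one_self[of "- (1 / real p)"] by auto
    qed
    also have "(\<Prod>p\<in>F. exp (- (1 / real p))) = exp (- (\<Sum>p\<in>F. 1 / real p))"
      using F(1) by (simp add: exp_sum sum_negf[symmetric] del: sum_negf)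
    also have "\<dots> \<le> exp (ln e)" using F(3) by simp
    also have "\<dots> = e" using A by simp
    finally show ?thesis using Mpos by (simp add: mult.commute)
  qed
  show "\<exists>V M. finite V \<and> M > 0 \<and>
       (\<forall>x\<in>V. x > 0 \<and> [x = g] (mod q) \<and> (\<forall>a\<in>A. coprime x a)) \<and>
       (\<forall>j. real (card {N\<in>{..<j * M}. \<forall>x\<in>V. \<not> x dvd N}) \<le> e * real (j * M))"
  proof (intro exI[of _ F] exI[of _ M] conjI ballI allI)
    fix x a assume "x \<in> F" "a \<in> A"
    then have "\<not> x dvd a" using F by (auto simp: D_def)
    then show "coprime x a" using Fp[OF \<open>x \<in> F\<close>] prime_imp_coprime by blast
  next
    fix j
    have "{N\<in>{..<j * M}. \<forall>x\<in>F. \<not> x dvd N} \<subseteq> {N\<in>{..<j * M}. coprime N M}"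
    proof -
      have "coprime N M" if "\<forall>x\<in>F. \<not> x dvd N" for N
        unfolding M_def using that Fp by (intro prod_coprime_right) (metis coprime_commute prime_imp_coprime)
      then show ?thesis by auto
    qed
    then have "card {N\<in>{..<j * M}. \<forall>x\<in>F. \<not> x dvd N} \<le> card {N\<in>{..<j * M}. coprime N M}"
      by (intro card_mono) auto
    also have "\<dots> = j * totient M" by (rule card_coprime_periodic[OF Mpos])
    finally have "real (card {N\<in>{..<j * M}. \<forall>x\<in>F. \<not> x dvd N}) \<le> j * real (totient M)"
      by (simp only: of_nat_mult[symmetric] of_nat_le_iff)
    also have "\<dots> \<le> j * (e * M)" by (intro mult_left_mono tot) auto
    finally show "real (card {N\<in>{..<j * M}. \<forall>x\<in>F. \<not> x dvd N}) \<le> e * real (j * M)"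
      by (simp add: mult_ac)
  next
    fix x assume "x \<in> F" then show "x > 0" using Fp prime_gt_0_nat by blast
  qed (use F Mpos in auto)
qed

lemma divisor_generic_1: "divisor_generic q 1"
  unfolding divisor_generic_def by (auto intro!: exI[of _ "{1}"] exI[of _ 1])

lemma divisor_generic_mult:
  assumes "divisor_generic q b" "divisor_generic q c"
  shows "divisor_generic q (b * c)"
  unfolding divisor_generic_def
proof (intro allI impI)
  fix A :: "nat set" and e :: real assume A: "finite A \<and> 0 \<notin> A \<and> e > 0"
  then have e2: "e/2 > 0" by simp
  have A1: "finite A \<and> 0 \<notin> A \<and> e/2 > 0" using A by simp
  obtain V M where V: "finite V" "M > 0" "\<forall>x\<in>V. x > 0 \<and> [x = b] (mod q) \<and> (\<forall>a\<in>A. coprime x a)"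
     "\<And>j. real (card {N\<in>{..<j * M}. \<forall>x\<in>V. \<not> x dvd N}) \<le> e/2 * real (j * M)"
    using assms(1)[unfolded divisor_generic_def, THEN spec, THEN spec, THEN mp, OF A1] by (elim exE conjE) (rule that, assumption+, erule spec)
  have A2: "finite (A \<union> V) \<and> 0 \<notin> A \<union> V \<and> e/2 > 0" using A V(1,3) by auto
  obtain Y L where Y: "finite Y" "L > 0" "\<forall>x\<in>Y. x > 0 \<and> [x = c] (mod q) \<and> (\<forall>a\<in>A \<union> V. coprime x a)"
     "\<And>j. real (card {N\<in>{..<j * L}. \<forall>x\<in>Y. \<not> x dvd N}) \<le> e/2 * real (j * L)"
    using assms(2)[unfolded divisor_generic_def, THEN spec, THEN spec, THEN mp, OF A2] by (elim exE conjE) (rule that, assumption+, erule spec)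
  define Z where "Z = (\<lambda>(x,y). x * y) ` (V \<times> Y)"
  show "\<exists>Z M. finite Z \<and> M > 0 \<and>
       (\<forall>x\<in>Z. x > 0 \<and> [x = b * c] (mod q) \<and> (\<forall>a\<in>A. coprime x a)) \<and>
       (\<forall>j. real (card {N\<in>{..<j * M}. \<forall>x\<in>Z. \<not> x dvd N}) \<le> e * real (j * M))"
  proof (intro exI[of _ Z] exI[of _ "M * L"] conjI allI)
    show "finite Z" "M * L > 0" using V Y by (auto simp: Z_def)
    show "\<forall>z\<in>Z. z > 0 \<and> [z = b * c] (mod q) \<and> (\<forall>a\<in>A. coprime z a)"
    proof
      fix z assume "z \<in> Z"
      then obtain x y where z: "z = x * y" "x \<in> V" "y \<in> Y" by (auto simp: Z_def)
      have x: "x > 0" "[x = b] (mod q)" "\<forall>a\<in>A. coprime x a" using V(3) z(2) by auto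
      have y: "y > 0" "[y = c] (mod q)" "\<forall>a\<in>A. coprime y a" using Y(3) z(3) by auto
      show "z > 0 \<and> [z = b * c] (mod q) \<and> (\<forall>a\<in>A. coprime z a)"
        using x y cong_mult[OF x(2) y(2)] by (simp add: z(1))
    qed
    fix j
    let ?N = "j * (M * L)"
    have "{N\<in>{..<?N}. \<forall>x\<in>Z. \<not> x dvd N} \<subseteq>
        {N\<in>{..<?N}. \<forall>x\<in>V. \<not> x dvd N} \<union> {N\<in>{..<?N}. \<forall>x\<in>Y. \<not> x dvd N}"
    proof
      fix N assume N: "N \<in> {N\<in>{..<?N}. \<forall>x\<in>Z. \<not> x dvd N}"
      have False if "x \<in> V" "x dvd N" "y \<in> Y" "y dvd N" for x y
      proof -
        have "coprime x y" using Y(3) that by (auto simp: coprime_commute)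
        then have "x * y dvd N" using that by (simp add: divides_mult)
        moreover have "x * y \<in> Z" using that unfolding Z_def by auto
        ultimately show False using N by auto
      qed
      then show "N \<in> {N\<in>{..<?N}. \<forall>x\<in>V. \<not> x dvd N} \<union> {N\<in>{..<?N}. \<forall>x\<in>Y. \<not> x dvd N}"
        using N by blast
    qed
    then have "card {N\<in>{..<?N}. \<forall>x\<in>Z. \<not> x dvd N} \<le>
        card ({N\<in>{..<?N}. \<forall>x\<in>V. \<not> x dvd N} \<union> {N\<in>{..<?N}. \<forall>x\<in>Y. \<not> x dvd N})"
      by (intro card_mono) auto
    also have "\<dots> \<le> card {N\<in>{..<?N}. \<forall>x\<in>V. \<not> x dvd N} + card {N\<in>{..<?N}. \<forall>x\<in>Y. \<not> x dvd N}"
      by (rule card_Un_le)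
    finally have "real (card {N\<in>{..<?N}. \<forall>x\<in>Z. \<not> x dvd N}) \<le>
        real (card {N\<in>{..<?N}. \<forall>x\<in>V. \<not> x dvd N}) + real (card {N\<in>{..<?N}. \<forall>x\<in>Y. \<not> x dvd N})"
      by (simp only: of_nat_add[symmetric] of_nat_le_iff)
    also have "\<dots> \<le> e/2 * ?N + e/2 * ?N"
      using V(4)[of "j * L"] Y(4)[of "j * M"] by (intro add_mono) (simp_all add: mult_ac)
    also have "\<dots> = e * real ?N" by simp
    finally show "real (card {N\<in>{..<?N}. \<forall>x\<in>Z. \<not> x dvd N}) \<le> e * real ?N" .
  qed
qed

lemma divisor_generic_cong:
  assumes "divisor_generic q b" "[b = c] (mod q)" shows "divisor_generic q c"
proof -
  have "[x = b] (mod q) \<longleftrightarrow> [x = c] (mod q)" for x using assms(2) by (simp add: cong_def)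
  then show ?thesis using assms(1) unfolding divisor_generic_def by simp
qed

text \<open>A substitute for Dirichlet's theorem: the primes in classes with
  convergent reciprocal sum form a sparse set, some \<open>n\<close> in the class of \<open>b\<close> has no prime factor
  there, and the prime factors of \<open>n\<close> lie in classes covered by
  \<open>divisor_generic_prime_class\<close>.\<close>
theorem divisor_generic_coprime:
  fixes q b :: nat
  assumes q: "q > 0" and b: "coprime b q"
  shows "divisor_generic q b"
proof -
  define P where "P g = {p. prime p \<and> [p = g] (mod q)}" for g :: nat
  define E where "E = {p. prime p \<and> coprime p q \<and> recip_summable (P p)}"
  have Pmod: "P (p mod q) = P p" for p by (simp add: P_def cong_def)
  have "E \<subseteq> (\<Union>g\<in>{g. g < q \<and> recip_summable (P g)}. P g)"
  proof
    fix p assume "p \<in> E"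
    then have "p \<in> P (p mod q)" "p mod q < q" "recip_summable (P (p mod q))"
      using q by (simp_all add: Pmod E_def) (simp add: P_def)
    then show "p \<in> (\<Union>g\<in>{g. g < q \<and> recip_summable (P g)}. P g)" by blast
  qed
  moreover have "recip_summable (\<Union>g\<in>{g. g < q \<and> recip_summable (P g)}. P g)"
    by (rule recip_summable_UN) auto
  ultimately have "recip_summable E" by (rule recip_summable_mono[rotated])
  then have "\<exists>n>0. [n = b] (mod q) \<and> (\<forall>p\<in>E. \<not> p dvd n)"
    by (intro exists_cong_avoiding_sparse_primes[OF q b]) (simp_all add: E_def)
  then obtain n where n: "n > 0" "[n = b] (mod q)" "\<forall>p\<in>E. \<not> p dvd n" by blast
  have "coprime n q" using cong_imp_coprime[OF cong_sym[OF n(2)] b] .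
  then have gen: "divisor_generic q p" if "prime p" "p dvd n" for p
  proof -
    have "coprime p q" using coprime_divisors[OF that(2) dvd_refl \<open>coprime n q\<close>] .
    then have "\<not> recip_summable (P p)" using n(3) that by (auto simp: E_def)
    then show ?thesis unfolding P_def by (rule divisor_generic_prime_class)
  qed
  have "divisor_generic q m" if "m > 0" "m dvd n" for m
    using that
  proof (induction m rule: prime_divisors_induct)
    case (unit x) then show ?case using divisor_generic_1 by simp
  next
    case (factor p x)
    then show ?case using gen by (intro divisor_generic_mult) (auto intro: dvd_mult_left dvd_mult_right)
  qed auto
  then have "divisor_generic q n" using n(1) by simp
  then show ?thesis using n(2) by (rule divisor_generic_cong)
qed

section \<open>Matrices acting on the hyperbolic plane\<close>

lemma det_2x2: "det (A::real^2^2) = A$1$1 * A$2$2 - A$1$2 * A$2$1" by (rule det_2)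

lemma mult_2x2: "((A::real^2^2) ** B)$i$j = A$i$1 * B$1$j + A$i$2 * B$2$j"
  by (simp add: matrix_matrix_mult_def sum_2)

lemma mat_1_2x2 [simp]: "(mat 1 :: real^2^2)$1$1 = 1" "(mat 1 :: real^2^2)$1$2 = 0"
  "(mat 1 :: real^2^2)$2$1 = 0" "(mat 1 :: real^2^2)$2$2 = 1"
  by (simp_all add: mat_def)

lemma eq_2x2_iff: "(A::real^2^2) = B \<longleftrightarrow> A$1$1 = B$1$1 \<and> A$1$2 = B$1$2 \<and> A$2$1 = B$2$1 \<and> A$2$2 = B$2$2"
  by (auto simp: vec_eq_iff forall_2)

text \<open>The adjugate, which is the inverse for determinant \<open>1\<close>; being polynomial in the entries it keeps
  integrality and rationality visible.\<close>
definition adj2 :: "real^2^2 \<Rightarrow> real^2^2" where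
  "adj2 A = vector [vector [A$2$2, - A$1$2], vector [- A$2$1, A$1$1]]"

lemma adj2_nth [simp]: "adj2 A$1$1 = A$2$2" "adj2 A$1$2 = - A$1$2" "adj2 A$2$1 = - A$2$1" "adj2 A$2$2 = A$1$1"
  by (simp_all add: adj2_def)

lemma det_adj2 [simp]: "det (adj2 A) = det A" by (simp add: det_2x2 mult.commute)

lemma adj2_mult: "det A = 1 \<Longrightarrow> adj2 A ** A = mat 1" "det A = 1 \<Longrightarrow> A ** adj2 A = mat 1"
  by (simp_all add: eq_2x2_iff mult_2x2 det_2x2 mult.commute)

text \<open>The automorphy factor of the action.\<close>
definition cocycle :: "real^2^2 \<Rightarrow> complex \<Rightarrow> complex" where
  "cocycle A z = of_real (A$2$1) * z + of_real (A$2$2)"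

lemma cocycle_nonzero:
  assumes "det A = 1" "Im z > 0" shows "cocycle A z \<noteq> 0"
proof
  assume "cocycle A z = 0"
  then have "A$2$1 * Im z = 0" "A$2$1 * Re z + A$2$2 = 0" by (auto simp: cocycle_def complex_eq_iff)
  then have "A$2$1 = 0" "A$2$2 = 0" using assms(2) by auto
  then show False using assms(1) by (simp add: det_2x2)
qed

lemma frac_lin_cocycle: "frac_lin A z = (of_real (A$1$1) * z + of_real (A$1$2)) / cocycle A z"
  by (simp add: frac_lin_def cocycle_def)

lemma Im_frac_lin:
  assumes "det A = 1" "Im z > 0" shows "Im (frac_lin A z) = Im z / (cmod (cocycle A z))\<^sup>2"
proof -
  have "Im (frac_lin A z) = Im ((of_real (A$1$1) * z + of_real (A$1$2)) * cnj (cocycle A z)) / (cmod (cocycle A z))\<^sup>2"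
    unfolding frac_lin_cocycle by (simp add: complex_div_cnj[of _ "cocycle A z"])
  also have "Im ((of_real (A$1$1) * z + of_real (A$1$2)) * cnj (cocycle A z)) = (A$1$1 * A$2$2 - A$1$2 * A$2$1) * Im z"
    by (simp add: cocycle_def algebra_simps)
  finally show ?thesis using assms(1) by (simp add: det_2x2)
qed

lemma Im_frac_lin_pos: "det A = 1 \<Longrightarrow> Im z > 0 \<Longrightarrow> Im (frac_lin A z) > 0"
  by (simp add: Im_frac_lin cocycle_nonzero)

lemma cocycle_mult:
  assumes "det B = 1" "Im z > 0"
  shows "cocycle (A ** B) z = cocycle A (frac_lin B z) * cocycle B z"
proof -
  have "frac_lin B z * cocycle B z = of_real (B$1$1) * z + of_real (B$1$2)"
    using cocycle_nonzero[OF assms] by (simp add: frac_lin_cocycle)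
  then have "of_real (A$2$1) * (frac_lin B z * cocycle B z) = of_real (A$2$1) * (of_real (B$1$1) * z + of_real (B$1$2))"
    by simp
  then show ?thesis unfolding cocycle_def[of "A ** B"] cocycle_def[of A] mult_2x2
    by (simp add: cocycle_def[of B] algebra_simps)
qed

lemma frac_lin_mult:
  assumes "det A = 1" "det B = 1" "Im z > 0"
  shows "frac_lin A (frac_lin B z) = frac_lin (A ** B) z"
proof -
  have nz: "cocycle B z \<noteq> 0" "cocycle A (frac_lin B z) \<noteq> 0"
    using cocycle_nonzero[OF assms(2,3)] cocycle_nonzero[OF assms(1) Im_frac_lin_pos[OF assms(2,3)]] by simp_all
  have num: "frac_lin B z * cocycle B z = of_real (B$1$1) * z + of_real (B$1$2)"
    using nz(1) by (simp add: frac_lin_cocycle)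
  have "frac_lin (A ** B) z = (of_real ((A ** B)$1$1) * z + of_real ((A ** B)$1$2)) / (cocycle A (frac_lin B z) * cocycle B z)"
    by (simp only: frac_lin_cocycle[of "A ** B"] cocycle_mult[OF assms(2,3)])
  also have "of_real ((A ** B)$1$1) * z + of_real ((A ** B)$1$2) =
      of_real (A$1$1) * (of_real (B$1$1) * z + of_real (B$1$2)) + of_real (A$1$2) * cocycle B z"
    unfolding mult_2x2 by (simp add: cocycle_def algebra_simps)
  also have "\<dots> = (of_real (A$1$1) * frac_lin B z + of_real (A$1$2)) * cocycle B z"
    unfolding num[symmetric] by (simp only: algebra_simps)
  also have "\<dots> / (cocycle A (frac_lin B z) * cocycle B z) = frac_lin A (frac_lin B z)"
    using nz by (simp add: frac_lin_cocycle[of A])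
  finally show ?thesis by simp
qed

lemma frac_lin_1 [simp]: "frac_lin (mat 1) z = z" by (simp add: frac_lin_def)

lemma frac_lin_adj2: "det A = 1 \<Longrightarrow> Im z > 0 \<Longrightarrow> frac_lin (adj2 A) (frac_lin A z) = z"
  "det A = 1 \<Longrightarrow> Im z > 0 \<Longrightarrow> frac_lin A (frac_lin (adj2 A) z) = z"
  by (simp_all add: frac_lin_mult adj2_mult)

lemma frac_lin_measurable [measurable]: "frac_lin A \<in> borel_measurable borel"
  unfolding frac_lin_def[abs_def] by measurable

lemma upper_half_plane_borel [measurable]: "upper_half_plane \<in> sets borel"
  unfolding upper_half_plane_def by measurable

lemma frac_lin_image_eq:
  assumes "det A = 1" "S \<subseteq> upper_half_plane"
  shows "frac_lin A ` S = {z \<in> upper_half_plane. frac_lin (adj2 A) z \<in> S}"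
proof (intro equalityI subsetI)
  fix w assume "w \<in> frac_lin A ` S"
  then obtain z where z: "z \<in> S" "w = frac_lin A z" "Im z > 0" using assms by (auto simp: upper_half_plane_def)
  then show "w \<in> {z \<in> upper_half_plane. frac_lin (adj2 A) z \<in> S}"
    using assms by (simp add: upper_half_plane_def frac_lin_adj2 Im_frac_lin_pos)
next
  fix w assume "w \<in> {z \<in> upper_half_plane. frac_lin (adj2 A) z \<in> S}"
  then show "w \<in> frac_lin A ` S" using assms
    by (intro image_eqI[of _ _ "frac_lin (adj2 A) w"]) (auto simp: upper_half_plane_def frac_lin_adj2)
qed

lemma frac_lin_image_borel:
  assumes "det A = 1" "S \<subseteq> upper_half_plane" "S \<in> sets borel"
  shows "frac_lin A ` S \<in> sets borel"
proof -
  have "frac_lin (adj2 A) -` S \<inter> space borel \<in> sets borel"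
    by (rule measurable_sets[OF frac_lin_measurable assms(3)])
  then have "upper_half_plane \<inter> (frac_lin (adj2 A) -` S) \<in> sets borel" by auto
  also have "upper_half_plane \<inter> (frac_lin (adj2 A) -` S) = frac_lin A ` S"
    unfolding frac_lin_image_eq[OF assms(1,2)] by auto
  finally show ?thesis .
qed

lemma frac_lin_deriv:
  assumes "det A = 1" "Im z > 0"
  shows "(frac_lin A has_field_derivative 1 / (cocycle A z)\<^sup>2) (at z within S)"
proof -
  have nz: "complex_of_real (A$2$1) * z + of_real (A$2$2) \<noteq> 0"
    using cocycle_nonzero[OF assms] by (simp add: cocycle_def)
  have d: "complex_of_real (A$1$1) * of_real (A$2$2) - of_real (A$1$2) * of_real (A$2$1) = 1"
    using assms(1) by (simp add: det_2x2 flip: of_real_mult of_real_diff)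
  have e: "complex_of_real (A$1$1) * (of_real (A$2$1) * z + of_real (A$2$2)) - (of_real (A$1$1) * z + of_real (A$1$2)) * of_real (A$2$1) = 1"
    using d by (simp add: algebra_simps)
  show ?thesis unfolding frac_lin_def[abs_def] cocycle_def
    by (rule derivative_eq_intros refl nz)+ (use e in \<open>simp add: power2_eq_square\<close>)
qed

definition vec_complex :: "real^2 \<Rightarrow> complex" where "vec_complex v = Complex (v$1) (v$2)"
definition complex_vec :: "complex \<Rightarrow> real^2" where "complex_vec z = vector [Re z, Im z]"

lemma vec_complex_inverse [simp]: "vec_complex (complex_vec z) = z" "complex_vec (vec_complex v) = v"
  by (simp_all add: vec_complex_def complex_vec_def vec_eq_iff forall_2)

lemma linear_vec_complex: "linear vec_complex" "linear complex_vec"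
  by (rule linearI; simp add: vec_complex_def complex_vec_def complex_eq_iff vec_eq_iff forall_2)+

lemma complex_vec_nth [simp]: "complex_vec z $ 1 = Re z" "complex_vec z $ 2 = Im z"
  by (simp_all add: complex_vec_def)

lemma vec_complex_measurable [measurable]: "vec_complex \<in> borel_measurable borel" "complex_vec \<in> borel_measurable borel"
  using linear_vec_complex by (auto intro!: borel_measurable_continuous_onI linear_continuous_on simp: linear_linear)

lemma distr_vec_complex: "distr lborel borel vec_complex = lborel"
proof (rule lborel_eqI[symmetric])
  fix l u :: complex assume lu: "\<And>b. b \<in> Basis \<Longrightarrow> l \<bullet> b \<le> u \<bullet> b"
  have B: "vec_complex -` box l u = box (complex_vec l) (complex_vec u)"
    by (auto simp: box_def Basis_complex_def vec_complex_def Basis_vec_def inner_axis forall_2)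
  have le: "Re l \<le> Re u" "Im l \<le> Im u" using lu[of 1] lu[of \<i>] by (auto simp: Basis_complex_def)
  have "emeasure (distr lborel borel vec_complex) (box l u) = emeasure lborel (box (complex_vec l) (complex_vec u))"
    by (subst emeasure_distr) (auto simp: B)
  also have "\<dots> = (\<Prod>b\<in>Basis. (complex_vec u - complex_vec l) \<bullet> b)"
  proof (rule emeasure_lborel_box)
    fix b :: "real^2" assume "b \<in> Basis"
    then show "complex_vec l \<bullet> b \<le> complex_vec u \<bullet> b"
      using le by (auto simp: Basis_vec_def inner_axis) (metis complex_vec_nth exhaust_2)
  qed
  also have "(\<Prod>b\<in>Basis. (complex_vec u - complex_vec l) \<bullet> b) = (Re u - Re l) * (Im u - Im l)"
  proof -
    have "(\<Prod>b\<in>Basis. (complex_vec u - complex_vec l) \<bullet> b) = (\<Prod>i\<in>UNIV. (complex_vec u - complex_vec l)$i)"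
      by (simp add: Basis_vec_def cart_eq_inner_axis axis_eq_axis prod.UNION_disjoint)
    then show ?thesis by (simp add: UNIV_2)
  qed
  also have "\<dots> = (\<Prod>b\<in>Basis. (u - l) \<bullet> b)"
    by (simp add: Basis_complex_def)
  finally show "emeasure (distr lborel borel vec_complex) (box l u) = (\<Prod>b\<in>Basis. (u - l) \<bullet> b)" .
qed auto

lemma hyperbolic_area_vec:
  assumes "S \<in> sets borel" "S \<subseteq> upper_half_plane"
  shows "emeasure hyperbolic_area S = (\<integral>\<^sup>+v\<in>complex_vec ` S. ennreal (1 / (v$2)\<^sup>2) \<partial>lborel)"
proof -
  have "emeasure hyperbolic_area S = (\<integral>\<^sup>+z. ennreal (indicator upper_half_plane z / (Im z)\<^sup>2) * indicator S z \<partial>lborel)"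
    unfolding hyperbolic_area_def using assms by (subst emeasure_density) auto
  also have "\<dots> = (\<integral>\<^sup>+z. ennreal (1 / (Im z)\<^sup>2) * indicator S z \<partial>lborel)"
    using assms(2) by (intro nn_integral_cong) (auto split: split_indicator)
  also have "\<dots> = (\<integral>\<^sup>+z. ennreal (1 / (Im z)\<^sup>2) * indicator S z \<partial>distr lborel borel vec_complex)"
    by (simp only: distr_vec_complex)
  also have "\<dots> = (\<integral>\<^sup>+v. ennreal (1 / (Im (vec_complex v))\<^sup>2) * indicator S (vec_complex v) \<partial>lborel)"
    using assms by (subst nn_integral_distr) auto
  also have "\<dots> = (\<integral>\<^sup>+v\<in>complex_vec ` S. ennreal (1 / (v$2)\<^sup>2) \<partial>lborel)"
  proof (intro nn_integral_cong)
    fix v :: "real^2"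
    have "vec_complex v \<in> S \<longleftrightarrow> v \<in> complex_vec ` S"
      by (metis imageE image_eqI vec_complex_inverse)
    then show "ennreal (1 / (Im (vec_complex v))\<^sup>2) * indicator S (vec_complex v) = ennreal (1 / (v$2)\<^sup>2) * indicator (complex_vec ` S) v"
      by (simp add: vec_complex_def indicator_def)
  qed
  finally show ?thesis .
qed

lemma complex_vec_image_borel: "S \<in> sets borel \<Longrightarrow> complex_vec ` S \<in> sets borel"
proof -
  assume S: "S \<in> sets borel"
  have "complex_vec ` S = vec_complex -` S \<inter> space borel" by (auto, metis image_eqI vec_complex_inverse)
  then show ?thesis using measurable_sets[OF vec_complex_measurable(1) S] by simp
qed

text \<open>The Jacobian of the map at \<open>z\<close> is \<open>\<bar>c z + d\<bar>\<^sup>-\<^sup>4\<close>, and the imaginary part is divided by \<open>\<bar>c z + d\<bar>\<^sup>2\<close>.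
  The change of variables theorem lives on \<open>real^2\<close>, whence the transport along
  \<open>complex_vec\<close>.\<close>
theorem hyperbolic_area_frac_lin:
  assumes A: "det A = 1" and S: "S \<in> sets borel" "S \<subseteq> upper_half_plane"
    and fin: "emeasure hyperbolic_area S < \<infinity>"
  shows "emeasure hyperbolic_area (frac_lin A ` S) = emeasure hyperbolic_area S"
proof -
  define S' where "S' = complex_vec ` S"
  define f where "f v = 1 / ((v::real^2)$2)\<^sup>2" for v
  define g where "g = complex_vec \<circ> frac_lin A \<circ> vec_complex"
  define g' where "g' v h = complex_vec (1 / (cocycle A (vec_complex v))\<^sup>2 * vec_complex h)" for v h
  have S'b: "S' \<in> sets borel" unfolding S'_def by (rule complex_vec_image_borel[OF S(1)])
  have pos: "Im (vec_complex v) > 0" if "v \<in> S'" for v using that S(2) by (auto simp: S'_def upper_half_plane_def)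
  have der: "(g has_derivative g' v) (at v within S')" if "v \<in> S'" for v
  proof -
    have 1: "(vec_complex has_derivative vec_complex) (at v within S')"
      using linear_vec_complex(1) by (intro linear_imp_has_derivative)
    have 2: "(frac_lin A has_derivative (\<lambda>h. 1 / (cocycle A (vec_complex v))\<^sup>2 * h)) (at (vec_complex v) within vec_complex ` S')"
      using frac_lin_deriv[OF A pos[OF that]] by (rule has_field_derivative_imp_has_derivative)
    have 3: "(complex_vec has_derivative complex_vec) (at (frac_lin A (vec_complex v)) within frac_lin A ` (vec_complex ` S'))"
      using linear_vec_complex(2) by (intro linear_imp_has_derivative)
    show ?thesis
      using diff_chain_within[OF diff_chain_within[OF 1 2], of complex_vec complex_vec] 3
      by (simp add: g_def g'_def[abs_def] o_def image_image)
  qed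
  have inj: "inj_on g S'"
  proof (rule inj_onI)
    fix v w assume vw: "v \<in> S'" "w \<in> S'" "g v = g w"
    have "frac_lin A (vec_complex v) = frac_lin A (vec_complex w)"
      using arg_cong[OF vw(3), of vec_complex] by (simp add: g_def)
    then have "frac_lin (adj2 A) (frac_lin A (vec_complex v)) = frac_lin (adj2 A) (frac_lin A (vec_complex w))"
      by (rule arg_cong)
    then have "vec_complex v = vec_complex w"
      by (simp only: frac_lin_adj2(1)[OF A pos[OF vw(1)]] frac_lin_adj2(1)[OF A pos[OF vw(2)]])
    then have "complex_vec (vec_complex v) = complex_vec (vec_complex w)" by simp
    then show "v = w" by simp
  qed
  have jac: "\<bar>det (matrix (g' v))\<bar> * f (g v) = f v" if "v \<in> S'" for v
  proof -
    let ?j = "cocycle A (vec_complex v)"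
    have nz: "?j \<noteq> 0" by (rule cocycle_nonzero[OF A pos[OF that]])
    have "det (matrix (\<lambda>h. complex_vec (w * vec_complex h))) = (Re w)\<^sup>2 + (Im w)\<^sup>2" for w
      by (simp add: det_2x2 matrix_def complex_vec_def vec_complex_def axis_def power2_eq_square)
    then have "det (matrix (g' v)) = (Re (1 / ?j\<^sup>2))\<^sup>2 + (Im (1 / ?j\<^sup>2))\<^sup>2"
      unfolding g'_def .
    also have "\<dots> = (cmod (1 / ?j\<^sup>2))\<^sup>2" by (simp only: cmod_power2)
    finally have d: "\<bar>det (matrix (g' v))\<bar> = 1 / (cmod ?j)^4"
      by (simp add: norm_divide norm_power power_divide power_mult[symmetric])
    have "f (g v) = 1 / (v$2 / (cmod ?j)\<^sup>2)\<^sup>2"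
      using Im_frac_lin[OF A pos[OF that]] by (simp add: f_def g_def vec_complex_def)
    also have "\<dots> = (cmod ?j)^4 / (v$2)\<^sup>2" by (simp add: power_divide power_mult[symmetric])
    finally show ?thesis using d nz by (simp add: f_def)
  qed
  have img: "g ` S' = complex_vec ` (frac_lin A ` S)" by (auto simp: g_def S'_def image_image)
  have fb: "f \<in> borel_measurable borel" unfolding f_def[abs_def] by measurable
  have fb': "set_borel_measurable borel S' f" unfolding set_borel_measurable_def using fb S'b by measurable
  have finS: "(\<integral>\<^sup>+v\<in>S'. ennreal (f v) \<partial>lborel) < \<infinity>"
    using fin hyperbolic_area_vec[OF S] by (simp add: S'_def f_def)
  have I1: "(\<integral>\<^sup>+v\<in>S'. ennreal (f v) \<partial>lborel) = ennreal (integral S' f)"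
    by (rule set_nn_integral_lborel_eq_integral[OF fb' _ finS]) (simp add: f_def)
  have int: "f integrable_on S'"
  proof -
    have "(\<lambda>v. indicator S' v * f v) integrable_on UNIV"
    proof (rule nn_integral_integrable_on)
      show "(\<integral>\<^sup>+v. ennreal (indicator S' v * f v) \<partial>lborel) < \<infinity>"
        using finS by (simp add: mult.commute ennreal_mult'' ennreal_indicator flip: ennreal_mult')
    qed (use fb S'b in \<open>auto simp: f_def\<close>)
    moreover have "(\<lambda>v. indicator S' v * f v) = (\<lambda>v. if v \<in> S' then f v else 0)" by (auto simp: fun_eq_iff)
    ultimately show ?thesis using integrable_restrict_UNIV[of S' f] by simp
  qed
  have abs: "f absolutely_integrable_on S'"
    using int by (simp add: absolutely_integrable_on_iff_nonneg f_def)
  have "(\<lambda>v. \<bar>det (matrix (g' v))\<bar> *\<^sub>R vec (f (g v)) :: real^1) absolutely_integrable_on S' \<and>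
      integral S' (\<lambda>v. \<bar>det (matrix (g' v))\<bar> *\<^sub>R vec (f (g v)) :: real^1) = vec (integral S' f) \<longleftrightarrow>
      (\<lambda>v. vec (f v) :: real^1) absolutely_integrable_on g ` S' \<and> integral (g ` S') (\<lambda>v. vec (f v) :: real^1) = vec (integral S' f)"
    by (rule has_absolute_integral_change_of_variables[OF _ der inj]) (use S'b in auto)
  moreover have "(\<lambda>v. \<bar>det (matrix (g' v))\<bar> *\<^sub>R vec (f (g v)) :: real^1) absolutely_integrable_on S' \<longleftrightarrow>
      (\<lambda>v. vec (f v) :: real^1) absolutely_integrable_on S'"
    by (intro set_integrable_cong refl) (simp add: vec_eq_iff jac)
  moreover have "integral S' (\<lambda>v. \<bar>det (matrix (g' v))\<bar> *\<^sub>R vec (f (g v)) :: real^1) = integral S' (\<lambda>v. vec (f v))"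
    by (intro integral_cong) (simp add: vec_eq_iff jac)
  ultimately have "f absolutely_integrable_on g ` S' \<and> integral (g ` S') f = integral S' f"
    using abs by (simp add: absolutely_integrable_on_1_iff integral_on_1_eq o_def vec_eq_iff)
  then have hi: "(f has_integral integral S' f) (g ` S')"
    by (metis absolutely_integrable_on_def has_integral_iff)
  have "(\<integral>\<^sup>+v\<in>g ` S'. ennreal (f v) \<partial>lborel) = ennreal (integral S' f)"
    by (rule nn_integral_has_integral_lebesgue'[OF _ hi]) (simp add: f_def)
  moreover have "frac_lin A ` S \<subseteq> upper_half_plane"
    using Im_frac_lin_pos[OF A] S(2) by (auto simp: upper_half_plane_def)
  then have "emeasure hyperbolic_area (frac_lin A ` S) = (\<integral>\<^sup>+v\<in>g ` S'. ennreal (f v) \<partial>lborel)"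
    unfolding img f_def by (rule hyperbolic_area_vec[OF frac_lin_image_borel[OF A S(2,1)]])
  moreover have "emeasure hyperbolic_area S = (\<integral>\<^sup>+v\<in>S'. ennreal (f v) \<partial>lborel)"
    unfolding S'_def f_def by (rule hyperbolic_area_vec[OF S])
  ultimately show ?thesis using I1 by simp
qed

section \<open>Real sets of linear growth\<close>

definition linear_growth :: "real set \<Rightarrow> real \<Rightarrow> bool" where
  "linear_growth T B \<longleftrightarrow>
     (\<forall>L::nat. finite (T \<inter> {- real L..real L}) \<and> real (card (T \<inter> {- real L..real L})) \<le> B * L + B)"

lemma linear_growth_card_le:
  assumes "linear_growth T B" "finite P" "P \<subseteq> T" "\<And>x. x \<in> P \<Longrightarrow> \<bar>x\<bar> \<le> real L"
  shows "real (card P) \<le> B * L + B"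
proof -
  have "finite (T \<inter> {- real L..real L})" "real (card (T \<inter> {- real L..real L})) \<le> B * L + B"
    using assms(1) unfolding linear_growth_def by auto
  moreover have "P \<subseteq> T \<inter> {- real L..real L}" using assms(3,4) by (force simp: abs_le_iff)
  ultimately show ?thesis by (meson card_mono of_nat_mono order_trans)
qed

lemma card_int_interval_ge:
  fixes lo hi :: real
  shows "real (card {k::int. lo \<le> k \<and> k \<le> hi}) \<ge> hi - lo - 1" "finite {k::int. lo \<le> k \<and> k \<le> hi}"
proof -
  have e: "{k::int. lo \<le> k \<and> k \<le> hi} = {\<lceil>lo\<rceil>..\<lfloor>hi\<rfloor>}" by (auto simp: le_floor_iff ceiling_le_iff)
  show "finite {k::int. lo \<le> k \<and> k \<le> hi}" unfolding e by simp
  show "real (card {k::int. lo \<le> k \<and> k \<le> hi}) \<ge> hi - lo - 1" unfolding e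
    by (simp add: of_nat_nat) linarith
qed

lemma card_progression_ge:
  fixes r m L :: real
  assumes "m \<noteq> 0"
  shows "real (card {k::int. \<bar>r + m * k\<bar> \<le> L}) \<ge> 2 * L / \<bar>m\<bar> - 1" "finite {k::int. \<bar>r + m * k\<bar> \<le> L}"
proof -
  have e: "{k::int. \<bar>r + m * k\<bar> \<le> L} =
     {k::int. min ((- L - r) / m) ((L - r) / m) \<le> k \<and> k \<le> max ((- L - r) / m) ((L - r) / m)} \<or> L < 0"
    if "m > 0 \<or> m < 0"
  proof (cases "L < 0")
    case False
    show ?thesis
    proof (cases "m > 0")
      case True
      have le: "(- L - r) / m \<le> (L - r) / m" using True False by (intro divide_right_mono) auto
      have "\<bar>r + m * k\<bar> \<le> L \<longleftrightarrow> (- L - r) / m \<le> k \<and> k \<le> (L - r) / m" for k :: int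
        using True by (auto simp: abs_le_iff divide_le_eq le_divide_eq mult.commute)
      then show ?thesis using le by auto
    next
      case neg: False
      then have m: "m < 0" using that by simp
      have le: "(L - r) / m \<le> (- L - r) / m" using m False by (intro divide_right_mono_neg) auto
      have "\<bar>r + m * k\<bar> \<le> L \<longleftrightarrow> (L - r) / m \<le> k \<and> k \<le> (- L - r) / m" for k :: int
        using m by (auto simp: abs_le_iff divide_le_eq le_divide_eq mult.commute)
      then show ?thesis using le by auto
    qed
  qed auto
  have L: "{k::int. \<bar>r + m * k\<bar> \<le> L} = {}" if "L < 0" using that by auto
  have d: "max ((- L - r) / m) ((L - r) / m) - min ((- L - r) / m) ((L - r) / m) = 2 * \<bar>L\<bar> / \<bar>m\<bar>"
  proof -
    have "max x y - min x y = \<bar>y - x\<bar>" for x y :: real by (simp add: max_def min_def)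
    moreover have "(L - r) / m - (- L - r) / m = 2 * L / m" by (simp add: diff_divide_distrib[symmetric])
    ultimately show ?thesis by (simp add: abs_mult)
  qed
  have pm: "m > 0 \<or> m < 0" using assms by linarith
  have eq: "{k::int. \<bar>r + m * k\<bar> \<le> L} =
     {k::int. min ((- L - r) / m) ((L - r) / m) \<le> k \<and> k \<le> max ((- L - r) / m) ((L - r) / m)}" if "\<not> L < 0"
    using e[OF pm] that by blast
  show "finite {k::int. \<bar>r + m * k\<bar> \<le> L}"
  proof (cases "L < 0")
    case False
    show ?thesis unfolding eq[OF False] by (rule card_int_interval_ge(2))
  qed (simp add: L)
  show "real (card {k::int. \<bar>r + m * k\<bar> \<le> L}) \<ge> 2 * L / \<bar>m\<bar> - 1"
  proof (cases "L < 0")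
    case True
    then have "2 * L / \<bar>m\<bar> \<le> 0" using assms by (simp add: divide_nonpos_pos)
    then show ?thesis unfolding L[OF True] card.empty of_nat_0 by linarith
  next
    case False
    then show ?thesis using card_int_interval_ge(1)[of "max ((- L - r) / m) ((L - r) / m)" "min ((- L - r) / m) ((L - r) / m)"] d False
      unfolding eq[OF False] by simp
  qed
qed

lemma linear_bound_slope:
  fixes a b c d :: real
  assumes "\<And>j::nat. a * j \<le> b * j + c" shows "a \<le> b"
proof (rule ccontr)
  assume "\<not> a \<le> b"
  then have "a - b > 0" by simp
  then obtain j :: nat where "j * (a - b) > c" using ex_less_of_nat_mult by blast
  then show False using assms[of j] by (simp add: algebra_simps)
qed

text \<open>In \<open>[-L, L]\<close> the \<open>i\<close>-th progression has about \<open>2 L / \<bar>m i\<bar>\<close> points. Two common points of two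
  progressions would make their differences commensurable, so only boundedly many
  points are counted twice. Comparing slopes in \<open>L\<close> gives the bound.\<close>
theorem incommensurable_progressions:
  fixes r m :: "'i \<Rightarrow> real"
  assumes T: "linear_growth T B" and I: "finite I"
    and prog: "\<And>i k. i \<in> I \<Longrightarrow> r i + m i * of_int k \<in> T"
    and nz: "\<And>i. i \<in> I \<Longrightarrow> m i \<noteq> 0"
    and inc: "\<And>i j. i \<in> I \<Longrightarrow> j \<in> I \<Longrightarrow> i \<noteq> j \<Longrightarrow> m i / m j \<notin> \<rat>"
  shows "(\<Sum>i\<in>I. 2 / \<bar>m i\<bar>) \<le> B"
proof (rule linear_bound_slope[where c = "B + real (card I) * (1 + real (card I))"])
  fix L :: nat
  define P where "P i = (\<lambda>k::int. r i + m i * k) ` {k. \<bar>r i + m i * k\<bar> \<le> L}" for i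
  have finP: "finite (P i)" if "i \<in> I" for i
    unfolding P_def using card_progression_ge(2)[OF nz[OF that]] by blast
  have cardP: "real (card (P i)) \<ge> 2 * L / \<bar>m i\<bar> - 1" if "i \<in> I" for i
  proof -
    have "inj_on (\<lambda>k::int. r i + m i * k) A" for A using nz[OF that] by (auto intro: inj_onI)
    then have "card (P i) = card {k::int. \<bar>r i + m i * k\<bar> \<le> L}" unfolding P_def by (rule card_image)
    then show ?thesis using card_progression_ge(1)[OF nz[OF that]] by simp
  qed
  have int: "card (P i \<inter> P j) \<le> 1" if ij: "i \<in> I" "j \<in> I" "i \<noteq> j" for i j
  proof -
    have "x = y" if x: "x \<in> P i \<inter> P j" and y: "y \<in> P i \<inter> P j" for x y
    proof (rule ccontr)
      assume ne: "x \<noteq> y"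
      have PD: "\<exists>k::int. z = r i + m i * of_int k" if "z \<in> P i" for z i using that by (auto simp: P_def)
      obtain k l :: int where k: "x = r i + m i * of_int k" and l: "x = r j + m j * of_int l" using x PD by blast
      obtain k' l' :: int where k': "y = r i + m i * of_int k'" and l': "y = r j + m j * of_int l'" using y PD by blast
      have 1: "m i * of_int (k - k') = x - y" unfolding k k' by (simp add: algebra_simps)
      have 2: "m j * of_int (l - l') = x - y" unfolding l l' by (simp add: algebra_simps)
      have "of_int (k - k') \<noteq> (0::real)" using 1 ne by auto
      then have "m i / m j = of_int (l - l') / of_int (k - k')"
        using 1 2 nz[OF ij(2)] by (simp add: divide_simps) (simp add: algebra_simps)
      then have "m i / m j \<in> \<rat>" by simp
      then show False using inc[OF ij] by blast
    qed
    then show ?thesis using finP[OF ij(1)] by (simp add: card_le_Suc0_iff_eq)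
  qed
  define Q where "Q i = P i - (\<Union>j\<in>I - {i}. P j)" for i
  have cardQ: "real (card (Q i)) \<ge> real (card (P i)) - card I" if "i \<in> I" for i
  proof -
    have "card (P i \<inter> (\<Union>j\<in>I - {i}. P j)) \<le> card (\<Union>j\<in>I - {i}. P i \<inter> P j)"
      using I finP that by (intro card_mono) auto
    also have "\<dots> \<le> (\<Sum>j\<in>I - {i}. card (P i \<inter> P j))" using I by (intro card_UN_le) auto
    also have "\<dots> \<le> (\<Sum>j\<in>I - {i}. 1)" using that by (intro sum_mono int) auto
    also have "\<dots> \<le> card I" using I by (simp add: card_Diff1_le)
    finally have 1: "card (P i \<inter> (\<Union>j\<in>I - {i}. P j)) \<le> card I" .
    have "card (P i) = card (P i \<inter> (\<Union>j\<in>I - {i}. P j)) + card (Q i)"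
      unfolding Q_def using finP[OF that] by (simp add: card_Int_Diff)
    then show ?thesis using 1 by linarith
  qed
  have "(\<Sum>i\<in>I. 2 / \<bar>m i\<bar>) * L - card I * (1 + real (card I)) = (\<Sum>i\<in>I. 2 * L / \<bar>m i\<bar> - 1 - card I)"
  proof -
    have "(\<Sum>i\<in>I. 2 / \<bar>m i\<bar>) * L = (\<Sum>i\<in>I. 2 * L / \<bar>m i\<bar>)" by (simp add: sum_distrib_right)
    then show ?thesis by (simp add: sum_subtractf algebra_simps)
  qed
  also have "\<dots> \<le> (\<Sum>i\<in>I. real (card (Q i)))"
  proof (rule sum_mono)
    fix i assume "i \<in> I"
    then show "2 * L / \<bar>m i\<bar> - 1 - card I \<le> real (card (Q i))" using cardP cardQ by (smt (verit))
  qed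
  also have "\<dots> = card (\<Union>i\<in>I. Q i)"
  proof -
    have "card (\<Union>i\<in>I. Q i) = (\<Sum>i\<in>I. card (Q i))"
      using I finP by (intro card_UN_disjoint) (auto simp: Q_def)
    then show ?thesis by simp
  qed
  also have "\<dots> \<le> B * L + B"
  proof (rule linear_growth_card_le[OF T])
    show "finite (\<Union>i\<in>I. Q i)" using I finP by (auto simp: Q_def)
    show "(\<Union>i\<in>I. Q i) \<subseteq> T" using prog by (auto simp: Q_def P_def)
  qed (auto simp: Q_def P_def)
  finally show "(\<Sum>i\<in>I. 2 / \<bar>m i\<bar>) * L \<le> B * L + (B + card I * (1 + real (card I)))" by simp
qed

lemma card_cong_class:
  fixes q r :: nat assumes "q > 0"
  shows "card {N\<in>{..<j * q}. [N = r] (mod q)} = j"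
proof -
  have "{N\<in>{..<j * q}. [N = r] (mod q)} = (\<lambda>i. i * q + r mod q) ` {..<j}"
  proof (intro equalityI subsetI)
    fix N assume N: "N \<in> {N\<in>{..<j * q}. [N = r] (mod q)}"
    then have "N = (N div q) * q + r mod q" by (metis (no_types, lifting) cong_def div_mult_mod_eq mem_Collect_eq)
    moreover have "N div q < j" using N assms by (simp add: div_less_iff_less_mult)
    ultimately show "N \<in> (\<lambda>i. i * q + r mod q) ` {..<j}" by blast
  next
    fix N assume "N \<in> (\<lambda>i. i * q + r mod q) ` {..<j}"
    then obtain i where i: "N = i * q + r mod q" "i < j" by auto
    have "i * q + r mod q < (i + 1) * q" using assms by simp
    also have "\<dots> \<le> j * q" using i by (intro mult_le_mono1) simp
    finally show "N \<in> {N\<in>{..<j * q}. [N = r] (mod q)}" using i by (simp add: cong_def)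
  qed
  moreover have "inj_on (\<lambda>i. i * q + r mod q) {..<j}" using assms by (auto intro: inj_onI)
  ultimately show ?thesis by (simp add: card_image)
qed

text \<open>Up to \<open>j M q\<close> there are \<open>j M\<close> integers \<open>N\<close> congruent to \<open>x0\<^sup>2\<close>, and at least half of them have a divisor
  \<open>x\<close> congruent to \<open>x0\<close>; the cofactor is then congruent to \<open>x0\<close> as well. So at least half of the numbers
  \<open>s N - \<kappa>\<close> belong to \<open>T\<close>.\<close>
theorem products_in_class_density:
  fixes q :: nat and x0 :: int and s \<kappa> :: real
  assumes T: "linear_growth T B" and q: "q > 0" and cop: "coprime x0 (int q)"
    and prod: "\<And>x y :: int. [x = x0] (mod int q) \<Longrightarrow> [y = x0] (mod int q) \<Longrightarrow> s * of_int (x * y) - \<kappa> \<in> T"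
    and s: "s \<noteq> 0"
  shows "1 \<le> 2 * B * \<bar>s\<bar> * q"
proof -
  define b where "b = nat (x0 mod int q)"
  have b: "int b = x0 mod int q" using q by (simp add: b_def)
  have bx: "[int b = x0] (mod int q)" unfolding b by (simp add: cong_def)
  have bq: "coprime b q" using cop q by (metis b coprime_int_iff coprime_mod_left_iff of_nat_0_less_iff less_irrefl)
  have "divisor_generic q b" by (rule divisor_generic_coprime[OF q bq])
  then obtain V M where V: "M > 0" "\<And>x. x \<in> V \<Longrightarrow> x > 0 \<and> [x = b] (mod q)"
    "\<And>j. real (card {N\<in>{..<j * M}. \<forall>x\<in>V. \<not> x dvd N}) \<le> 1 / (2 * q) * real (j * M)"
    using q unfolding divisor_generic_def
    by (elim allE[of _ "{}"] allE[of _ "1 / (2 * real q)"]) auto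
  have key: "M/2 * j \<le> (B * (\<bar>s\<bar> * q * M)) * j + (B * (\<bar>\<kappa>\<bar> + 1) + B)" for j :: nat
  proof -
    let ?R = "{..<(j * M) * q}"
    define S where "S = {N\<in>?R. [N = b * b] (mod q) \<and> (\<exists>x\<in>V. x dvd N)}"
    have finS: "finite S" unfolding S_def by simp
    have "{N\<in>?R. [N = b * b] (mod q)} \<subseteq> S \<union> {N\<in>?R. \<forall>x\<in>V. \<not> x dvd N}" by (auto simp: S_def)
    then have "card {N\<in>?R. [N = b * b] (mod q)} \<le> card (S \<union> {N\<in>?R. \<forall>x\<in>V. \<not> x dvd N})"
      using finS by (intro card_mono) auto
    also have "\<dots> \<le> card S + card {N\<in>?R. \<forall>x\<in>V. \<not> x dvd N}" by (rule card_Un_le)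
    finally have "real (j * M) \<le> card S + real (card {N\<in>?R. \<forall>x\<in>V. \<not> x dvd N})"
      unfolding card_cong_class[OF q] by (simp only: of_nat_add[symmetric] of_nat_le_iff)
    also have "real (card {N\<in>?R. \<forall>x\<in>V. \<not> x dvd N}) \<le> 1 / (2 * q) * real ((j * q) * M)"
      using V(3)[of "j * q"] by (simp add: mult_ac)
    also have "1 / (2 * q) * real ((j * q) * M) = j * M / 2" using q by simp
    finally have cS: "j * M / 2 \<le> real (card S)" by simp
    define h where "h N = s * real N - \<kappa>" for N
    have inT: "h N \<in> T" if "N \<in> S" for N
    proof -
      obtain x where x: "x \<in> V" "x dvd N" using \<open>N \<in> S\<close> by (auto simp: S_def)
      then obtain y where y: "N = x * y" by blast
      have xb: "[x = b] (mod q)" using V(2) x by auto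
      have "[x * y = b * b] (mod q)" using \<open>N \<in> S\<close> y by (simp add: S_def)
      moreover have "[x * y = b * y] (mod q)" using xb by (rule cong_scalar_right)
      ultimately have "[b * y = b * b] (mod q)" by (metis cong_sym cong_trans)
      then have "[y = b] (mod q)" using bq by (simp add: cong_mult_lcancel_nat)
      then have "[int y = x0] (mod int q)" using bx by (metis cong_int_iff cong_trans)
      moreover have "[int x = x0] (mod int q)" using xb bx by (metis cong_int_iff cong_trans)
      ultimately have "s * of_int (int x * int y) - \<kappa> \<in> T" by (intro prod)
      then show ?thesis by (simp add: h_def y)
    qed
    define L where "L = nat \<lceil>\<bar>s\<bar> * (j * M * q) + \<bar>\<kappa>\<bar>\<rceil>"
    have L: "\<bar>s\<bar> * (j * M * q) + \<bar>\<kappa>\<bar> \<le> L" "L \<le> \<bar>s\<bar> * (j * M * q) + \<bar>\<kappa>\<bar> + 1"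
    proof -
      have "0 \<le> \<bar>s\<bar> * (j * M * q) + \<bar>\<kappa>\<bar>" by (intro add_nonneg_nonneg mult_nonneg_nonneg) simp_all
      then have "real L = \<lceil>\<bar>s\<bar> * (j * M * q) + \<bar>\<kappa>\<bar>\<rceil>" unfolding L_def by simp
      then show "\<bar>s\<bar> * (j * M * q) + \<bar>\<kappa>\<bar> \<le> L" "L \<le> \<bar>s\<bar> * (j * M * q) + \<bar>\<kappa>\<bar> + 1" by linarith+
    qed
    have "real (card (h ` S)) \<le> B * L + B"
    proof (rule linear_growth_card_le[OF T])
      fix z assume "z \<in> h ` S"
      then obtain N where N: "N \<in> S" "z = s * real N - \<kappa>" by (auto simp: h_def)
      have "\<bar>z\<bar> \<le> \<bar>s\<bar> * real N + \<bar>\<kappa>\<bar>"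
        unfolding N(2) using abs_triangle_ineq4[of "s * real N" \<kappa>] by (simp add: abs_mult)
      also have "\<bar>s\<bar> * real N \<le> \<bar>s\<bar> * real (j * M * q)"
        using N(1) by (intro mult_left_mono) (auto simp: S_def simp del: of_nat_mult)
      finally show "\<bar>z\<bar> \<le> real L" using L(1) by linarith
    qed (use finS inT in auto)
    moreover have "card (h ` S) = card S" using s by (intro card_image inj_onI) (auto simp: h_def)
    moreover have "B \<ge> 0" using linear_growth_card_le[OF T, of "{}" 0] by simp
    ultimately have "j * M / 2 \<le> B * (\<bar>s\<bar> * (j * M * q) + \<bar>\<kappa>\<bar> + 1) + B"
      using cS L(2) mult_left_mono[OF L(2), of B] by linarith
    then show ?thesis by (simp add: algebra_simps)
  qed
  have "M / 2 \<le> B * (\<bar>s\<bar> * q * M)" by (rule linear_bound_slope[OF key])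
  then show ?thesis using V(1) by (simp add: field_simps)
qed

section \<open>Matrix groups whose trace set grows linearly\<close>

text \<open>Groups that contain \<open>-1\<close>, as preimages of subgroups of \<open>PSL(2,\<real>)\<close> do.\<close>
definition sl2_group :: "(real^2^2) set \<Rightarrow> bool" where
  "sl2_group G \<longleftrightarrow> (\<forall>A\<in>G. det A = 1) \<and> mat 1 \<in> G \<and> (\<forall>A\<in>G. \<forall>B\<in>G. A ** B \<in> G) \<and>
     (\<forall>A\<in>G. adj2 A \<in> G) \<and> (\<forall>A\<in>G. - A \<in> G)"

definition shear :: "real \<Rightarrow> real^2^2" where "shear x = vector [vector [1, x], vector [0, 1]]"

lemma shear_nth [simp]: "shear x$1$1 = 1" "shear x$1$2 = x" "shear x$2$1 = 0" "shear x$2$2 = 1"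
  by (simp_all add: shear_def)

lemma det_shear [simp]: "det (shear x) = 1" by (simp add: det_2x2)

lemma shear_add: "shear x ** shear y = shear (x + y)" by (simp add: eq_2x2_iff mult_2x2)

lemma shear_0: "shear 0 = mat 1" by (simp add: eq_2x2_iff)

lemma adj2_shear: "adj2 (shear x) = shear (- x)" by (simp add: eq_2x2_iff)

lemma trace_2x2: "trace (A::real^2^2) = A$1$1 + A$2$2" by (simp add: trace_def sum_2)

lemma det_1_iff: "det (A::real^2^2) = 1 \<longleftrightarrow> A$1$1 * A$2$2 = 1 + A$1$2 * A$2$1"
  by (auto simp: det_2x2)

primrec mpow :: "real^2^2 \<Rightarrow> nat \<Rightarrow> real^2^2" where
  "mpow A 0 = mat 1" | "mpow A (Suc n) = A ** mpow A n"

lemma mpow_commute: "A ** mpow A n = mpow A n ** A"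
  by (induction n) (simp_all, metis matrix_mul_assoc)

lemma det_mpow: "det A = 1 \<Longrightarrow> det (mpow A n) = 1" by (induction n) (simp_all add: det_mul)

lemma mpow_shear: "mpow (shear x) n = shear (n * x)"
  by (induction n) (simp_all add: shear_0 shear_add algebra_simps)

text \<open>The Cayley--Hamilton theorem, read off in the lower left entry.\<close>
lemma mpow_lower_left_rec:
  assumes "det A = 1"
  shows "mpow A (Suc (Suc n))$2$1 = trace A * mpow A (Suc n)$2$1 - mpow A n$2$1"
proof -
  have "c * (a * x + b * y) + d * (c * x + d * y) = (a + d) * (c * x + d * y) - y" if "a * d = 1 + b * c" for a b c d x y :: real
    using that by Groebner_Basis.algebra
  from this[OF assms[unfolded det_1_iff]] show ?thesis by (simp add: mult_2x2 trace_2x2)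
qed

context
  fixes G assumes G: "sl2_group G"
begin

lemma sl2_det: "A \<in> G \<Longrightarrow> det A = 1" and sl2_one: "mat 1 \<in> G"
  and sl2_mult: "A \<in> G \<Longrightarrow> B \<in> G \<Longrightarrow> A ** B \<in> G" and sl2_adj2: "A \<in> G \<Longrightarrow> adj2 A \<in> G"
  and sl2_minus: "A \<in> G \<Longrightarrow> - A \<in> G"
  using G unfolding sl2_group_def by auto

lemma sl2_mpow: "A \<in> G \<Longrightarrow> mpow A n \<in> G" by (induction n) (auto intro: sl2_one sl2_mult)

lemma sl2_shear:
  assumes "shear 1 \<in> G" shows "shear (of_int n) \<in> G"
proof (cases "n \<ge> 0")
  case True
  then show ?thesis using sl2_mpow[OF assms, of "nat n"] by (simp add: mpow_shear)
next
  case False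
  then show ?thesis using sl2_adj2[OF sl2_mpow[OF assms, of "nat (- n)"]] by (simp add: mpow_shear adj2_shear)
qed
end

text \<open>The trace as a function of \<open>n\<close> and \<open>k\<close> is a product of two linear factors up to a constant. This
  factorisation is what connects traces with divisors of integers.\<close>
lemma trace_shear_products:
  assumes "det V = 1" "det Y = 1"
  shows "V$2$1 * Y$2$1 * trace ((V ** shear n) ** (Y ** shear k)) =
    (V$2$1 * Y$2$1 * n + (V ** Y)$2$1) * (V$2$1 * Y$2$1 * k + (Y ** V)$2$1) - (V$2$1)\<^sup>2 - (Y$2$1)\<^sup>2"
proof -
  have "c * c' * (a * a' + (a * n + b) * c' + (c * (a' * k + b') + (c * n + d) * (c' * k + d'))) =
      (c * c' * n + (c * a' + d * c')) * (c * c' * k + (c' * a + d' * c)) - c\<^sup>2 - c'\<^sup>2"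
    if "a * d = 1 + b * c" "a' * d' = 1 + b' * c'" for a b c d a' b' c' d' :: real
    using that by Groebner_Basis.algebra
  from this[OF assms[unfolded det_1_iff]] show ?thesis by (simp add: mult_2x2 trace_2x2)
qed

lemma trace_shear_square:
  assumes "det A = 1"
  shows "trace ((A ** shear n) ** (A ** shear k)) = (trace A + n * A$2$1) * (trace A + k * A$2$1) - 2"
proof -
  have "a * a + (a * n + b) * c + (c * (a * k + b) + (c * n + d) * (c * k + d)) =
      (a + d + n * c) * (a + d + k * c) - 2"
    if "a * d = 1 + b * c" for a b c d :: real
    using that by Groebner_Basis.algebra
  from this[OF assms[unfolded det_1_iff]] show ?thesis by (simp add: mult_2x2 trace_2x2)
qed

text \<open>The situation in which all consequences of bounded clustering are drawn.\<close>
locale cusped_growth =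
  fixes G :: "(real^2^2) set" and B :: real
  assumes G: "sl2_group G" and U: "shear 1 \<in> G" and growth: "linear_growth (trace ` G) B"
begin

lemmas in_det = sl2_det[OF G] and in_one = sl2_one[OF G] and in_mult = sl2_mult[OF G]
  and in_adj2 = sl2_adj2[OF G] and in_minus = sl2_minus[OF G] and in_mpow = sl2_mpow[OF G] and in_shear = sl2_shear[OF G U]

lemma trace_progression:
  assumes "A \<in> G" shows "trace A + A$2$1 * of_int k \<in> trace ` G"
proof -
  have "trace (A ** shear (of_int k)) = trace A + A$2$1 * of_int k"
    by (simp add: trace_2x2 mult_2x2)
  then show ?thesis using in_mult[OF assms in_shear] by (metis image_eqI)
qed

text \<open>A single progression already bounds its difference from below; this is the Shimizu--Leutbecher
  phenomenon, derived from growth instead of discreteness.\<close>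
lemma lower_left_bound:
  assumes "A \<in> G" "A$2$1 \<noteq> 0" shows "2 \<le> B * \<bar>A$2$1\<bar>"
proof -
  have "(\<Sum>i\<in>{()}. 2 / \<bar>A$2$1\<bar>) \<le> B"
    using trace_progression[OF assms(1)] assms(2)
    by (intro incommensurable_progressions[OF growth, of _ "\<lambda>_. trace A"]) auto
  then show ?thesis using assms(2) by (simp add: divide_le_eq)
qed

text \<open>Otherwise the products \<open>A U\<^sup>n A U\<^sup>k\<close> give, for \<open>n = 1, 2, ...\<close>, progressions in \<open>k\<close> with pairwise
  incommensurable differences \<open>c (t + n c)\<close>, and the sum of their reciprocals diverges.\<close>
theorem trace_over_lower_left_rational:
  assumes A: "A \<in> G" and c: "A$2$1 \<noteq> 0"
  shows "trace A / A$2$1 \<in> \<rat>"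
proof (rule ccontr)
  define t c where "t = trace A" and "c = A$2$1"
  assume "trace A / A$2$1 \<notin> \<rat>"
  then have irr: "t / c \<notin> \<rat>" by (simp add: t_def c_def)
  have c0: "c \<noteq> 0" using assms by (simp add: c_def)
  have nz: "t + n * c \<noteq> 0" for n :: nat
  proof
    assume "t + n * c = 0"
    then have "t / c = - real n" using c0 by (simp add: field_simps)
    then show False using irr by simp
  qed
  define D where "D = \<bar>c\<bar> * (\<bar>t\<bar> + \<bar>c\<bar>)"
  have D: "D > 0" using c0 by (simp add: D_def add_nonneg_pos)
  \<comment> \<open>\<open>D * n\<close> bounds the \<open>n\<close>-th difference, so the sum dominates a multiple of the harmonic sum\<close>
  have bound: "2 / D * harm N \<le> B" for N
  proof -
    have "2 / D * harm N = (\<Sum>n\<in>{1..N}. 2 / D * (1 / real n))"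
      by (simp add: harm_def sum_distrib_left inverse_eq_divide)
    also have "\<dots> \<le> (\<Sum>n\<in>{1..N}. 2 / \<bar>c * (t + n * c)\<bar>)"
    proof (rule sum_mono)
      fix n assume n: "n \<in> {1..N}"
      have "\<bar>t + n * c\<bar> \<le> \<bar>t\<bar> * 1 + n * \<bar>c\<bar>" using abs_triangle_ineq[of t "n * c"] by (simp add: abs_mult)
      also have "\<dots> \<le> \<bar>t\<bar> * n + n * \<bar>c\<bar>" using n by (intro add_right_mono mult_left_mono) auto
      finally have "\<bar>c\<bar> * \<bar>t + n * c\<bar> \<le> \<bar>c\<bar> * (\<bar>t\<bar> * n + n * \<bar>c\<bar>)"
        by (rule mult_left_mono) simp
      also have "\<dots> = D * n" unfolding D_def by (simp only: distrib_left distrib_right mult_ac)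
      finally have "\<bar>c * (t + n * c)\<bar> \<le> D * n" by (simp only: abs_mult)
      then have "2 / (D * n) \<le> 2 / \<bar>c * (t + n * c)\<bar>"
        using c0 nz[of n] D n by (intro divide_left_mono mult_pos_pos) auto
      then show "2 / D * (1 / real n) \<le> 2 / \<bar>c * (t + n * c)\<bar>" by simp
    qed
    also have "\<dots> \<le> B"
    proof (rule incommensurable_progressions[OF growth, of _ "\<lambda>n. (t + real n * c) * t - 2"])
      fix n k assume "n \<in> {1..N}"
      have "trace ((A ** shear n) ** (A ** shear (of_int k))) = (t + n * c) * t - 2 + c * (t + n * c) * of_int k"
        unfolding trace_shear_square[OF in_det[OF A]] t_def c_def by (simp add: algebra_simps)
      moreover have "(A ** shear n) ** (A ** shear (of_int k)) \<in> G"
        using in_shear[of "int n"] by (intro in_mult in_shear A) simp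
      ultimately show "(t + n * c) * t - 2 + c * (t + n * c) * of_int k \<in> trace ` G" by (metis image_eqI)
    next
      fix n m assume nm: "n \<in> {1..N}" "m \<in> {1..N}" "n \<noteq> m"
      show "c * (t + n * c) / (c * (t + m * c)) \<notin> \<rat>"
      proof
        assume "c * (t + n * c) / (c * (t + m * c)) \<in> \<rat>"
        then have q: "(t + n * c) / (t + m * c) \<in> \<rat>" using c0 by simp
        define y where "y = (t + n * c) / (t + m * c)"
        have e: "t + n * c = y * (t + m * c)" using nz by (simp add: y_def)
        have "y \<noteq> 1" using e nm c0 by auto
        have "t * (1 - y) = c * (y * m - n)" using e by (simp add: algebra_simps)
        then have "t / c = (y * m - n) / (1 - y)" using c0 \<open>y \<noteq> 1\<close> by (simp add: frac_eq_eq mult.commute)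
        moreover have "(y * m - n) / (1 - y) \<in> \<rat>" using q unfolding y_def[symmetric] by (intro Rats_divide Rats_diff Rats_mult) auto
        ultimately show False using irr by simp
      qed
    qed (use c0 nz in auto)
    finally show ?thesis .
  qed
  have "filterlim (harm :: nat \<Rightarrow> real) at_top sequentially" by (rule harm_at_top)
  then obtain N where "harm N > B * D / 2 + (0::real)"
    unfolding filterlim_at_top_dense eventually_sequentially by (metis order_refl)
  then show False using bound[of N] D by (simp add: field_simps)
qed

text \<open>Compare the rational quotient of \<open>A\<close> with that of \<open>A U\<^sup>n A\<close>, which is a rational number minus
  \<open>2 / (c\<^sup>2 (t/c + n))\<close>.\<close>
lemma lower_left_square_rational:
  assumes A: "A \<in> G" and c: "A$2$1 \<noteq> 0"
  shows "(A$2$1)\<^sup>2 \<in> \<rat>"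
proof -
  define t c where "t = trace A" and "c = A$2$1"
  have c0: "c \<noteq> 0" using assms by (simp add: c_def)
  define al where "al = t / c"
  have al: "al \<in> \<rat>" unfolding al_def t_def c_def by (rule trace_over_lower_left_rational[OF assms])
  have tal: "t = al * c" using c0 by (simp add: al_def)
  obtain n :: nat where n: "t + n * c \<noteq> 0"
  proof (cases "t = 0")
    case True then show ?thesis using that[of 1] c0 by simp
  next
    case False then show ?thesis using that[of 0] by simp
  qed
  have n0: "al + n \<noteq> 0" using n by (simp add: tal flip: distrib_right)
  define A' where "A' = (A ** shear n) ** A"
  have A': "A' \<in> G" unfolding A'_def using in_shear[of "int n"] by (intro in_mult A) simp
  have t': "trace A' = (t + n * c) * t - 2"
    using trace_shear_square[OF in_det[OF A], of n 0] by (simp add: A'_def shear_0 t_def c_def)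
  have c': "A'$2$1 = c * (t + n * c)" by (simp add: A'_def mult_2x2 c_def t_def trace_2x2 algebra_simps)
  have "trace A' / A'$2$1 \<in> \<rat>"
    using c' c0 n by (intro trace_over_lower_left_rational[OF A']) simp
  also have "trace A' / A'$2$1 = al - 2 / (c\<^sup>2 * (al + n))"
  proof -
    have tn: "t + n * c = (al + n) * c" by (simp add: tal algebra_simps)
    have "(e * c * (al * c) - 2) / (c * (e * c)) = al - 2 / (c\<^sup>2 * e)" if "e \<noteq> 0" for e
      using that c0 by (simp add: diff_divide_distrib power2_eq_square)
    from this[OF n0] show ?thesis unfolding t' c' tn by (simp only: tal[symmetric])
  qed
  finally have r2: "2 / (c\<^sup>2 * (al + n)) \<in> \<rat>" using Rats_diff[OF al] by fastforce
  have r3: "2 / (2 / (c\<^sup>2 * (al + n))) \<in> \<rat>" by (rule Rats_divide[OF Rats_number_of r2])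
  have "al + n \<in> \<rat>" using al by simp
  with r3 have "2 / (2 / (c\<^sup>2 * (al + n))) / (al + n) \<in> \<rat>" by (rule Rats_divide)
  also have "2 / (2 / (c\<^sup>2 * (al + n))) / (al + n) = c\<^sup>2" using n0 c0 by simp
  finally show ?thesis by (simp add: c_def)
qed

text \<open>The lower left entry of \<open>V U\<^sup>n Y\<close> is \<open>V$2$1 * Y$2$1 * (e + n)\<close>, where \<open>e\<close> is the number in question. Its
  square is rational for all \<open>n\<close>, and so is the difference of two such squares.\<close>
lemma cusp_difference_rational:
  assumes V: "V \<in> G" "V$2$1 \<noteq> 0" and Y: "Y \<in> G" "Y$2$1 \<noteq> 0"
  shows "Y$1$1 / Y$2$1 + V$2$2 / V$2$1 \<in> \<rat>"
proof -
  define e where "e = Y$1$1 / Y$2$1 + V$2$2 / V$2$1"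
  have sq: "(e + of_nat n)\<^sup>2 \<in> \<rat>" for n
  proof -
    define Z where "Z = (V ** shear n) ** Y"
    have Z: "Z \<in> G" unfolding Z_def using in_shear[of "int n"] by (intro in_mult V Y) simp
    have z: "Z$2$1 = V$2$1 * Y$2$1 * (e + n)"
    proof -
      have "V$2$1 * Y$2$1 * e = V$2$1 * Y$1$1 + V$2$2 * Y$2$1" using V(2) Y(2) by (simp add: e_def distrib_left)
      then show ?thesis by (simp add: Z_def mult_2x2 distrib_left distrib_right mult_ac)
    qed
    have "(Z$2$1)\<^sup>2 \<in> \<rat>"
      using lower_left_square_rational[OF Z] by (cases "Z$2$1 = 0") auto
    then have "(Z$2$1)\<^sup>2 / ((V$2$1)\<^sup>2 * (Y$2$1)\<^sup>2) \<in> \<rat>"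
      using lower_left_square_rational[OF V] lower_left_square_rational[OF Y] by (intro Rats_divide Rats_mult)
    then show ?thesis using V(2) Y(2) by (simp add: z power_mult_distrib)
  qed
  have "((e + of_nat 1)\<^sup>2 - (e + of_nat 0)\<^sup>2 - 1) / 2 \<in> \<rat>"
    by (intro Rats_divide Rats_diff sq) auto
  also have "((e + of_nat 1)\<^sup>2 - (e + of_nat 0)\<^sup>2 - 1) / 2 = e" by (simp add: power2_eq_square algebra_simps)
  finally show ?thesis by (simp add: e_def)
qed
end

text \<open>The homogenised Lucas sequence: if \<open>trace A = u / v\<close>, then \<open>lucas u v n / v ^ (n - 1)\<close> is the factor
  between the lower left entries of \<open>A\<close> and of its \<open>n\<close>-th power.\<close>
fun lucas :: "int \<Rightarrow> int \<Rightarrow> nat \<Rightarrow> int" where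
  "lucas u v 0 = 0" | "lucas u v (Suc 0) = 1"
| "lucas u v (Suc (Suc n)) = u * lucas u v (Suc n) - v\<^sup>2 * lucas u v n"

lemma lucas_coprime:
  assumes "coprime u v"
  shows "coprime (lucas u v (Suc n)) v \<and> coprime (lucas u v (Suc n)) (lucas u v n)"
proof (induction n)
  case (Suc n)
  let ?a = "lucas u v (Suc n)" and ?b = "lucas u v n"
  have rec: "lucas u v (Suc (Suc n)) = u * ?a - v * (v * ?b)" by (simp add: power2_eq_square)
  have "gcd (u * ?a - v * (v * ?b)) v = gcd (u * ?a) v"
    by (metis diff_conv_add_uminus gcd.commute gcd_add_mult mult.commute mult_minus_right uminus_add_conv_diff)
  then have 1: "coprime (lucas u v (Suc (Suc n))) v" unfolding rec using Suc assms by (simp add: coprime_iff_gcd_eq_1[symmetric])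
  have "gcd (u * ?a - v * (v * ?b)) ?a = gcd (- (v * (v * ?b))) ?a"
    by (metis diff_conv_add_uminus gcd.commute gcd_add_mult)
  then have 2: "coprime (lucas u v (Suc (Suc n))) ?a"
    unfolding rec using Suc by (simp add: coprime_iff_gcd_eq_1[symmetric] coprime_commute)
  show ?case using 1 2 by simp
qed auto

lemma mpow_lower_left_lucas:
  assumes "det A = 1" "trace A = of_int u / of_int v" "v \<noteq> 0"
  shows "mpow A n$2$1 * of_int v ^ n = A$2$1 * of_int (lucas u v n) * of_int v"
proof -
  let ?P = "\<lambda>n. mpow A n$2$1 * of_int v ^ n = A$2$1 * of_int (lucas u v n) * of_int v"
  have "?P n \<and> ?P (Suc n)"
  proof (induction n)
    case 0
    show ?case by (simp add: mult_2x2)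
  next
    case (Suc n)
    have "mpow A (Suc (Suc n))$2$1 * of_int v ^ Suc (Suc n) =
        of_int u * (mpow A (Suc n)$2$1 * of_int v ^ Suc n) - of_int v ^ 2 * (mpow A n$2$1 * of_int v ^ n)"
      unfolding mpow_lower_left_rec[OF assms(1)] assms(2) using assms(3)
      by (simp add: field_simps power2_eq_square)
    also have "\<dots> = A$2$1 * of_int (lucas u v (Suc (Suc n))) * of_int v"
      using Suc.IH by (simp add: algebra_simps)
    finally show ?case using Suc.IH by blast
  qed
  then show ?thesis by blast
qed

context cusped_growth begin

text \<open>Apply \<open>products_in_class_density\<close> to the traces of \<open>A\<^sup>m U\<^sup>n A U\<^sup>k\<close>. The denominator \<open>q\<close> of the
  common shift \<open>al\<close> cannot exceed a multiple of the product of the two lower left entries. On the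
  other hand coprimality in the Lucas sequence forces \<open>v * lucas u v m\<close> to divide \<open>q\<close> up to the
  fixed factor \<open>E\<close>. Since \<open>lucas u v m\<close> cancels against the entry of \<open>A\<^sup>m\<close>, the
  powers of \<open>v\<close> remain bounded.\<close>
theorem rational_trace_integral:
  assumes A: "A \<in> G" and c: "A$2$1 \<noteq> 0" "A$2$1 \<in> \<rat>" and t: "trace A \<in> \<rat>"
  shows "trace A \<in> \<int>"
proof (rule ccontr)
  assume nonint: "trace A \<notin> \<int>"
  obtain u v :: int where uv: "v > 0" "coprime u v" "trace A = of_int u / of_int v"
    using t by (metis Rats_cases' )
  have v2: "v \<ge> 2" using uv nonint by (cases "v = 1") auto
  obtain K E :: int where KE: "E > 0" "A$2$1 = of_int K / of_int E" using c(2) by (metis Rats_cases')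
  have K0: "K \<noteq> 0" using c KE by auto
  let ?N = "lucas u v" and ?c = "A$2$1"
  have N0: "?N (Suc m) \<noteq> 0" for m
  proof
    assume "?N (Suc m) = 0"
    then have "coprime 0 v" using lucas_coprime[OF uv(2), of m] by metis
    then show False using v2 by simp
  qed
  have bound: "real_of_int v ^ Suc m' \<le> 2 * B * E * ?c\<^sup>2" for m'
  proof -
    define m where "m = Suc m'"
    note Suc = m_def
    define Nm where "Nm = ?N m"
    define Cm where "Cm = mpow A m$2$1"
    have Nm0: "Nm \<noteq> 0" using N0 Suc by (simp add: Nm_def)
    have Cm: "Cm * of_int v ^ m = ?c * of_int Nm * of_int v"
      unfolding Cm_def Nm_def using mpow_lower_left_lucas[OF in_det[OF A] uv(3)] uv(1) by simp
    have Cm1: "mpow A (Suc m)$2$1 * of_int v ^ Suc m = ?c * of_int (?N (Suc m)) * of_int v"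
      using mpow_lower_left_lucas[OF in_det[OF A] uv(3)] uv(1) by blast
    have Cm0: "Cm \<noteq> 0" using Cm Nm0 c(1) uv(1) by auto
    \<comment> \<open>the shift that turns both linear factors of \<open>trace_shear_products\<close> into \<open>al + n\<close> and \<open>al + k\<close>\<close>
    define al where "al = mpow A (Suc m)$2$1 / (?c * Cm)"
    have al: "al = of_int (E * ?N (Suc m)) / of_int (v * K * Nm)"
    proof -
      have "al = (mpow A (Suc m)$2$1 * of_int v ^ Suc m) / (?c * (Cm * of_int v ^ m) * of_int v)"
        unfolding al_def using uv(1) by simp
      also have "\<dots> = of_int (?N (Suc m)) / (?c * of_int v * of_int Nm)"
        unfolding Cm Cm1 using c(1) uv(1) Nm0 by (simp add: field_simps)
      also have "\<dots> = of_int (E * ?N (Suc m)) / of_int (v * K * Nm)"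
        unfolding KE(2) using KE(1) K0 uv(1) Nm0 by (simp add: field_simps)
      finally show ?thesis .
    qed
    then have "al \<in> \<rat>" by simp
    then obtain x0 q' :: int where q': "q' > 0" "coprime x0 q'" "al = of_int x0 / of_int q'" by (metis Rats_cases')
    define q where "q = nat q'"
    have q: "q > 0" "int q = q'" "coprime x0 (int q)" "al = of_int x0 / real q" using q' by (auto simp: q_def)
    \<comment> \<open>so that \<open>trace Z = s * x * y - const\<close> for \<open>x = x0 + q n\<close> and \<open>y = x0 + q k\<close>\<close>
    define s where "s = ?c * Cm / (real q)\<^sup>2"
    have s0: "s \<noteq> 0" using c(1) Cm0 q(1) by (simp add: s_def)
    have "1 \<le> 2 * B * \<bar>s\<bar> * q"
    proof (rule products_in_class_density[OF growth q(1,3) _ s0])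
      fix x y :: int assume x: "[x = x0] (mod int q)" and y: "[y = x0] (mod int q)"
      obtain n where n: "x = x0 + int q * n" using x by (metis cong_iff_lin cong_sym)
      obtain k where k: "y = x0 + int q * k" using y by (metis cong_iff_lin cong_sym)
      define Z where "Z = (mpow A m ** shear (of_int n)) ** (A ** shear (of_int k))"
      have "Z \<in> G" unfolding Z_def by (intro in_mult in_mpow in_shear A)
      have com: "(mpow A m ** A)$2$1 = ?c * Cm * al" "(A ** mpow A m)$2$1 = ?c * Cm * al"
        using c(1) Cm0 by (simp_all add: al_def mpow_commute[symmetric])
      have "Cm * ?c * trace Z = (Cm * ?c * n + ?c * Cm * al) * (Cm * ?c * k + ?c * Cm * al) - Cm\<^sup>2 - ?c\<^sup>2"
        using trace_shear_products[OF det_mpow[OF in_det[OF A]] in_det[OF A], of m "of_int n" "of_int k"]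
        unfolding Z_def[symmetric] com by (simp only: Cm_def)
      also have "\<dots> = (?c * Cm)\<^sup>2 * ((al + n) * (al + k)) - Cm\<^sup>2 - ?c\<^sup>2" by Groebner_Basis.algebra
      finally have eq: "Cm * ?c * trace Z = (?c * Cm)\<^sup>2 * ((al + n) * (al + k)) - Cm\<^sup>2 - ?c\<^sup>2" .
      have "z = x * y * Q - (y\<^sup>2 + x\<^sup>2) / (y * x)"
        if "y * x * z = (x * y)\<^sup>2 * Q - y\<^sup>2 - x\<^sup>2" "x \<noteq> 0" "y \<noteq> 0" for x y z Q :: real
      proof -
        have "y * x * (x * y * Q - (y\<^sup>2 + x\<^sup>2) / (y * x)) = y * x * z"
          unfolding that(1) using that(2,3) by (simp add: right_diff_distrib power2_eq_square)
        then show ?thesis using that(2,3) by simp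
      qed
      from this[OF eq c(1) Cm0] have tr: "trace Z = ?c * Cm * ((al + n) * (al + k)) - (Cm\<^sup>2 + ?c\<^sup>2) / (Cm * ?c)" .
      have an: "al + n = of_int x / real q" "al + k = of_int y / real q"
        using q(1) by (simp_all add: q(4) n k add_divide_distrib)
      have "s * of_int (x * y) - (Cm\<^sup>2 + ?c\<^sup>2) / (Cm * ?c) = trace Z"
      proof -
        have "s * of_int (x * y) = ?c * Cm * ((of_int x / real q) * (of_int y / real q))"
          unfolding s_def of_int_mult power2_eq_square times_divide_times_eq by simp
        then show ?thesis unfolding tr an by (simp only:)
      qed
      then show "s * of_int (x * y) - (Cm\<^sup>2 + ?c\<^sup>2) / (Cm * ?c) \<in> trace ` G" using \<open>Z \<in> G\<close> by (metis image_eqI)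
    qed
    also have "2 * B * \<bar>s\<bar> * q = 2 * B * \<bar>?c * Cm\<bar> / q"
      using q(1) by (simp add: s_def abs_mult power2_eq_square)
    finally have qle: "real q \<le> 2 * B * \<bar>?c * Cm\<bar>" using q(1) by (simp add: le_divide_eq)
    have "x0 * (v * K * Nm) = q' * (E * ?N (Suc m))"
    proof -
      have "of_int (x0 * (v * K * Nm)) = (of_int (q' * (E * ?N (Suc m))) :: real)"
        using al q'(1,3) uv(1) K0 Nm0 by (simp add: frac_eq_eq field_simps)
      then show ?thesis by (simp only: of_int_eq_iff)
    qed
    then have "v * Nm dvd (q' * E) * ?N (Suc m)" by (metis dvd_triv_right mult.assoc mult.commute mult.left_commute)
    moreover have "coprime (v * Nm) (?N (Suc m))"
      using lucas_coprime[OF uv(2), of m] by (simp add: Nm_def coprime_commute)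
    ultimately have "v * Nm dvd q' * E" by (simp add: coprime_dvd_mult_left_iff)
    then have "\<bar>v * Nm\<bar> dvd q' * E" by simp
    then have "\<bar>v * Nm\<bar> \<le> q' * E" using q'(1) KE(1) by (intro zdvd_imp_le) auto
    then have "v * \<bar>Nm\<bar> \<le> q' * E" using uv(1) by (simp add: abs_mult)
    then have "real_of_int (v * \<bar>Nm\<bar>) \<le> of_int (q' * E)" by (simp only: of_int_le_iff)
    also have "\<dots> = real q * E" using q(2) by (metis of_int_mult of_int_of_nat_eq)
    also have "\<dots> \<le> 2 * B * \<bar>?c * Cm\<bar> * E" using qle KE(1) by (intro mult_right_mono) auto
    finally have "real_of_int (v * \<bar>Nm\<bar>) * of_int v ^ m \<le> 2 * B * \<bar>?c\<bar> * (\<bar>Cm\<bar> * of_int v ^ m) * E"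
      using uv(1) by (simp add: abs_mult mult_right_mono algebra_simps)
    also have "\<bar>Cm\<bar> * of_int v ^ m = \<bar>?c\<bar> * \<bar>of_int Nm\<bar> * of_int v"
      using arg_cong[OF Cm, of abs] uv(1) by (simp add: abs_mult)
    finally have "of_int v ^ m * (of_int v * \<bar>real_of_int Nm\<bar>) \<le> (2 * B * E * ?c\<^sup>2) * (of_int v * \<bar>real_of_int Nm\<bar>)"
      by (simp add: algebra_simps power2_eq_square)
    then have "real_of_int v ^ m \<le> 2 * B * E * ?c\<^sup>2"
      by (rule mult_right_le_imp_le) (use uv(1) Nm0 in simp)
    then show ?thesis by (simp only: m_def)
  qed
  obtain m where "2 * B * E * ?c\<^sup>2 < real_of_int v ^ m"
    using real_arch_pow[of "real_of_int v"] v2 by auto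
  moreover have "real_of_int v ^ m \<le> real_of_int v ^ Suc m" using v2 by (intro power_increasing) auto
  ultimately show False using bound[of m] by linarith
qed

end

section \<open>Subgroups of finite coarea in the modular group\<close>

definition SL2Z :: "(real^2^2) set" where
  "SL2Z = {A. det A = 1 \<and> (\<forall>i j. A$i$j \<in> \<int>)}"

lemma SL2Z_group: "sl2_group SL2Z"
  by (auto simp: sl2_group_def SL2Z_def det_mul det_uminus_2 mult_2x2 forall_2)

text \<open>An open set of positive finite area whose translates under the modular group are pairwise disjoint.\<close>
definition cell :: "complex set" where
  "cell = {z. \<bar>Re z\<bar> < 1/2 \<and> 1 < Im z \<and> Im z < 2}"

text \<open>If \<open>c \<noteq> 0\<close>, the map sends imaginary parts above \<open>1\<close> below \<open>1\<close>; so the map is an integral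
  translation, and the width of the cell is \<open>1\<close>.\<close>
lemma cell_wandering:
  assumes A: "A \<in> SL2Z" and z: "z \<in> cell" "frac_lin A z \<in> cell"
  shows "A = mat 1 \<or> A = - mat 1"
proof -
  have d: "det A = 1" and int: "A$1$1 \<in> \<int>" "A$1$2 \<in> \<int>" "A$2$1 \<in> \<int>" "A$2$2 \<in> \<int>"
    using A by (auto simp: SL2Z_def)
  have pos: "Im z > 0" "Im z > 1" using z(1) by (auto simp: cell_def)
  have c0: "A$2$1 = 0"
  proof (rule ccontr)
    assume "A$2$1 \<noteq> 0"
    then have "\<bar>A$2$1\<bar> \<ge> 1" using int(3) Ints_nonzero_abs_ge1 by blast
    have "Im z * 1 \<le> \<bar>A$2$1\<bar> * Im z" using \<open>\<bar>A$2$1\<bar> \<ge> 1\<close> pos by simp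
    also have "\<bar>A$2$1\<bar> * Im z = \<bar>Im (cocycle A z)\<bar>" using pos by (simp add: cocycle_def abs_mult)
    also have "\<dots> \<le> cmod (cocycle A z)" by (rule abs_Im_le_cmod)
    finally have "(Im z)\<^sup>2 \<le> (cmod (cocycle A z))\<^sup>2" using pos by (intro power_mono) auto
    then have "Im (frac_lin A z) \<le> Im z / (Im z)\<^sup>2"
      unfolding Im_frac_lin[OF d pos(1)] using pos by (intro divide_left_mono mult_pos_pos) auto
    also have "\<dots> = 1 / Im z" by (simp add: power2_eq_square)
    also have "\<dots> < 1" using pos by simp
    finally show False using z(2) by (simp add: cell_def)
  qed
  then have ad: "A$1$1 * A$2$2 = 1" using d by (simp add: det_2x2)
  obtain m n :: int where mn: "A$1$1 = of_int m" "A$2$2 = of_int n" using int by (auto elim!: Ints_cases)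
  have "m * n = 1" using ad mn by (metis of_int_1 of_int_eq_iff of_int_mult)
  then have "(m = 1 \<and> n = 1) \<or> (m = -1 \<and> n = -1)" by (rule zmult_eq_1_iff[THEN iffD1])
  then have s: "A$1$1 = A$2$2" "A$1$1 = 1 \<or> A$1$1 = -1" using mn by auto
  have "frac_lin A z = z + of_real (A$1$2 * A$1$1)"
    using s c0 by (auto simp: frac_lin_def)
  then have "\<bar>Re z + A$1$2 * A$1$1\<bar> < 1/2" using z(2) by (simp add: cell_def)
  moreover have "\<bar>Re z\<bar> < 1/2" using z(1) by (simp add: cell_def)
  ultimately have "\<bar>A$1$2 * A$1$1\<bar> < 1"
    using abs_triangle_ineq4[of "Re z + A$1$2 * A$1$1" "Re z"] by linarith
  then have "\<bar>A$1$2\<bar> < 1" using s(2) by auto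
  then have "A$1$2 = 0" using int(2) Ints_nonzero_abs_less1 by blast
  then show ?thesis using s c0 by (auto simp: eq_2x2_iff)
qed

lemma frac_lin_uminus: "frac_lin (- A) z = frac_lin A z"
proof -
  have "of_real ((- A)$i$1) * z + of_real ((- A)$i$2) = - (of_real (A$i$1) * z + of_real (A$i$2))" for i
    by simp
  then show ?thesis by (simp only: frac_lin_def minus_divide_divide)
qed

lemma cell_translates:
  assumes A: "A \<in> SL2Z" and B: "B \<in> SL2Z" and z: "z \<in> cell" "w \<in> cell" "frac_lin A z = frac_lin B w"
  shows "A = B \<or> A = - B"
proof -
  have det: "det A = 1" "det B = 1" and pos: "Im z > 0" "Im w > 0" using A B z by (auto simp: SL2Z_def cell_def)
  have "frac_lin (adj2 B ** A) z = frac_lin (adj2 B) (frac_lin B w)"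
    using det pos by (simp add: frac_lin_mult[symmetric] z(3))
  also have "\<dots> = w" using det pos by (simp add: frac_lin_adj2)
  finally have "adj2 B ** A = mat 1 \<or> adj2 B ** A = - mat 1"
    using A B z(1,2) SL2Z_group by (intro cell_wandering) (auto simp: sl2_group_def)
  then have "B ** (adj2 B ** A) = B ** mat 1 \<or> B ** (adj2 B ** A) = B ** (- mat 1)" by auto
  moreover have "B ** (- mat 1) = - B" by (simp add: eq_2x2_iff mult_2x2)
  ultimately show ?thesis using det by (simp add: matrix_mul_assoc adj2_mult)
qed

lemma cell_facts: "cell \<in> sets borel" "cell \<subseteq> upper_half_plane" "emeasure hyperbolic_area cell < \<infinity>"
  "emeasure hyperbolic_area cell > 0"
proof -
  have box: "cell = box (Complex (-1/2) 1) (Complex (1/2) 2)"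
    by (auto simp: cell_def box_def Basis_complex_def abs_less_iff)
  show b: "cell \<in> sets borel" unfolding box by simp
  show sub: "cell \<subseteq> upper_half_plane" by (auto simp: cell_def upper_half_plane_def)
  have lb: "emeasure lborel cell = 1" unfolding box by (subst emeasure_lborel_box) (auto simp: Basis_complex_def)
  have em: "emeasure hyperbolic_area cell = (\<integral>\<^sup>+z. ennreal (indicator upper_half_plane z / (Im z)\<^sup>2) * indicator cell z \<partial>lborel)"
    unfolding hyperbolic_area_def using b by (subst emeasure_density) auto
  also have "\<dots> \<le> (\<integral>\<^sup>+z. indicator cell z \<partial>lborel)"
  proof (intro nn_integral_mono)
    fix z
    show "ennreal (indicator upper_half_plane z / (Im z)\<^sup>2) * indicator cell z \<le> indicator cell z"
    proof (cases "z \<in> cell")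
      case True
      then have "1 \<le> (Im z)\<^sup>2" by (simp add: cell_def one_le_power)
      then have "ennreal (indicator upper_half_plane z / (Im z)\<^sup>2) \<le> ennreal 1"
        by (intro ennreal_leI) (simp add: divide_le_eq_1 indicator_def)
      then show ?thesis using True by simp
    qed simp
  qed
  also have "\<dots> < \<infinity>" using b lb by simp
  finally show "emeasure hyperbolic_area cell < \<infinity>" .
  have "ennreal (1/4) = (\<integral>\<^sup>+z. ennreal (1/4) * indicator cell z \<partial>lborel)"
    using b lb by (simp add: nn_integral_cmult_indicator)
  also have "\<dots> \<le> emeasure hyperbolic_area cell" unfolding em
  proof (intro nn_integral_mono)
    fix z
    show "ennreal (1/4) * indicator cell z \<le> ennreal (indicator upper_half_plane z / (Im z)\<^sup>2) * indicator cell z"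
    proof (cases "z \<in> cell")
      case True
      then have i: "1 < Im z" "Im z < 2" by (auto simp: cell_def)
      have "(Im z)\<^sup>2 \<le> 2\<^sup>2" using i by (intro power_mono) auto
      then have "1/4 \<le> 1 / (Im z)\<^sup>2" using i by (intro divide_left_mono) auto
      then have "ennreal (1/4) \<le> ennreal (indicator upper_half_plane z / (Im z)\<^sup>2)"
        using True sub by (intro ennreal_leI) auto
      then show ?thesis using True by simp
    qed simp
  qed
  finally show "emeasure hyperbolic_area cell > 0"
    by (rule less_le_trans[rotated]) simp
qed

text \<open>Weaker than a fundamental set: orbits may be met several times. This form passes to subgroups of
  finite index and to conjugates without choosing representatives.\<close>
definition covers :: "(real^2^2) set \<Rightarrow> complex set \<Rightarrow> bool" where
  "covers G D \<longleftrightarrow> D \<in> sets borel \<and> D \<subseteq> upper_half_plane \<and> emeasure hyperbolic_area D < \<infinity> \<and>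
     (\<forall>z\<in>upper_half_plane. \<exists>A\<in>G. \<exists>w\<in>D. z = frac_lin A w)"

lemma sets_hyperbolic_area [simp]: "sets hyperbolic_area = sets borel" by (simp add: hyperbolic_area_def)

lemma countable_SL2Z: "countable SL2Z"
proof -
  have "SL2Z \<subseteq> (\<lambda>(a,b,c,d). vector [vector [of_int a, of_int b], vector [of_int c, of_int d]]) ` (UNIV :: (int \<times> int \<times> int \<times> int) set)"
  proof
    fix A :: "real^2^2" assume "A \<in> SL2Z"
    then have "A$1$1 \<in> \<int>" "A$1$2 \<in> \<int>" "A$2$1 \<in> \<int>" "A$2$2 \<in> \<int>" by (auto simp: SL2Z_def)
    then obtain a b c d :: int where "A$1$1 = of_int a" "A$1$2 = of_int b" "A$2$1 = of_int c" "A$2$2 = of_int d"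
      by (metis Ints_cases)
    then have "A = (\<lambda>(a,b,c,d). vector [vector [of_int a, of_int b], vector [of_int c, of_int d]]) (a,b,c,d)"
      by (simp add: eq_2x2_iff)
    then show "A \<in> (\<lambda>(a,b,c,d). vector [vector [of_int a, of_int b], vector [of_int c, of_int d]]) ` (UNIV :: (int \<times> int \<times> int \<times> int) set)"
      by blast
  qed
  then show ?thesis by (rule countable_subset) simp
qed

text \<open>The cell translated by \<open>x\<close> is cut into countably many pieces, each of which an element of \<open>H\<close> moves
  into \<open>D\<close>. The pieces arrive in the part of \<open>D\<close> belonging to the coset of \<open>x\<close>.\<close>
lemma cell_area_le_coset_part:
  assumes "H \<subseteq> SL2Z" "sl2_group H" "covers H D" "x \<in> SL2Z"
  shows "emeasure hyperbolic_area cell \<le> emeasure hyperbolic_area (D \<inter> (\<Union>h\<in>H. frac_lin (h ** x) ` cell))"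
proof -
  note H = sl2_det[OF assms(2)] sl2_one[OF assms(2)] sl2_mult[OF assms(2)] sl2_adj2[OF assms(2)] sl2_minus[OF assms(2)]
  have D: "D \<in> sets borel" "D \<subseteq> upper_half_plane" "emeasure hyperbolic_area D < \<infinity>"
    "\<And>z. z \<in> upper_half_plane \<Longrightarrow> \<exists>A\<in>H. \<exists>w\<in>D. z = frac_lin A w"
    using assms(3) by (auto simp: covers_def)
  have dx: "det x = 1" using assms(4) by (simp add: SL2Z_def)
  have cH: "countable H" using assms(1) countable_SL2Z countable_subset by blast
  define h where "h = from_nat_into H"
  have hH: "h n \<in> H" for n using H(2) unfolding h_def by (intro from_nat_into) auto
  have hsurj: "\<exists>n. h n = y" if "y \<in> H" for y
    using cH that unfolding h_def by (metis from_nat_into_surj)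
  have dh: "det (h n) = 1" for n using hH H(1) by blast
  have hSL: "h n ** x \<in> SL2Z" for n using hH assms(1,4) sl2_mult[OF SL2Z_group] by blast
  define C where "C n = frac_lin (h n ** x) ` cell" for n
  have Cb: "C n \<in> sets borel" "C n \<subseteq> upper_half_plane" for n
    unfolding C_def using cell_facts(1,2) dh[of n] dx
    by (auto intro!: frac_lin_image_borel Im_frac_lin_pos simp: det_mul upper_half_plane_def)
  \<comment> \<open>disjoint pieces of the part of \<open>D\<close> covered by the coset\<close>
  define A where "A n = (C n - (\<Union>m<n. C m)) \<inter> D" for n
  have Ab: "A n \<in> sets borel" "A n \<subseteq> upper_half_plane" "A n \<subseteq> D" "A n \<subseteq> C n" for n
    unfolding A_def using Cb D(1,2) by auto
  have Afin: "emeasure hyperbolic_area (A n) < \<infinity>" for n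
    using emeasure_mono[OF Ab(3), of hyperbolic_area n] D by (auto intro: le_less_trans)
  have disj: "disjoint_family A"
    unfolding disjoint_family_on_def A_def by (auto, metis lessThan_iff linorder_neqE_nat)
  have xcell: "frac_lin x ` cell \<in> sets borel" by (intro frac_lin_image_borel dx cell_facts)
  have hAb: "frac_lin (adj2 (h n)) ` A n \<in> sets borel" for n
    using Ab dh by (intro frac_lin_image_borel) auto
  have sub: "frac_lin x ` cell \<subseteq> (\<Union>n. frac_lin (adj2 (h n)) ` A n)"
  proof
    fix z assume "z \<in> frac_lin x ` cell"
    then obtain y where y: "y \<in> cell" "z = frac_lin x y" by blast
    have iy: "Im y > 0" using y by (simp add: cell_def)
    have iz: "Im z > 0" using y iy dx by (simp add: Im_frac_lin_pos)
    obtain g w where g: "g \<in> H" "w \<in> D" "z = frac_lin g w" using D(4)[of z] iz by (auto simp: upper_half_plane_def)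
    have iw: "Im w > 0" using g D(2) by (auto simp: upper_half_plane_def)
    have w: "w = frac_lin (adj2 g) z" using frac_lin_adj2(1)[OF H(1)[OF g(1)] iw] g(3) by simp
    obtain n0 where n0: "h n0 = adj2 g" using hsurj[OF H(4)[OF g(1)]] by blast
    have wy: "w = frac_lin (adj2 g ** x) y"
      unfolding w y(2) using H(1)[OF g(1)] dx iy by (simp add: frac_lin_mult)
    have "w \<in> C n0" unfolding C_def n0 using y(1) wy by blast
    define n where "n = (LEAST n. w \<in> C n)"
    have n: "w \<in> C n" "\<And>m. m < n \<Longrightarrow> w \<notin> C m"
      unfolding n_def using \<open>w \<in> C n0\<close> by (auto intro: LeastI dest: not_less_Least)
    have "w \<in> A n" using n g(2) by (auto simp: A_def)
    obtain y' where y': "y' \<in> cell" "w = frac_lin (h n ** x) y'" using n(1) by (auto simp: C_def)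
    have "h n ** x = h n0 ** x \<or> h n ** x = - (h n0 ** x)"
      using wy y' y(1) n0 by (intro cell_translates[OF hSL hSL, of y' y]) auto
    then have same: "frac_lin (h n ** x) u = frac_lin (h n0 ** x) u" for u by (metis frac_lin_uminus)
    have "frac_lin (h n) z = w"
      using same[of y] wy n0 dh[of n] dx iy by (simp add: y(2) frac_lin_mult)
    then have "frac_lin (adj2 (h n)) w = z" using frac_lin_adj2(1)[OF dh iz, of n] by simp
    then show "z \<in> (\<Union>n. frac_lin (adj2 (h n)) ` A n)" using \<open>w \<in> A n\<close> by blast
  qed
  have "emeasure hyperbolic_area cell = emeasure hyperbolic_area (frac_lin x ` cell)"
    by (intro hyperbolic_area_frac_lin[symmetric] dx cell_facts)
  also have "\<dots> \<le> emeasure hyperbolic_area (\<Union>n. frac_lin (adj2 (h n)) ` A n)"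
    by (intro emeasure_mono sub) (auto intro: hAb)
  also have "\<dots> \<le> (\<Sum>n. emeasure hyperbolic_area (frac_lin (adj2 (h n)) ` A n))"
    by (intro emeasure_subadditive_countably) (auto intro: hAb)
  also have "\<dots> = (\<Sum>n. emeasure hyperbolic_area (A n))"
    using Ab dh Afin by (simp add: hyperbolic_area_frac_lin)
  also have "\<dots> = emeasure hyperbolic_area (\<Union>n. A n)"
    using Ab disj by (intro suminf_emeasure) auto
  also have "\<dots> \<le> emeasure hyperbolic_area (D \<inter> (\<Union>h\<in>H. frac_lin (h ** x) ` cell))"
  proof (rule emeasure_mono)
    have U: "(\<Union>h\<in>H. frac_lin (h ** x) ` cell) = (\<Union>n. C n)"
    proof (intro equalityI subsetI)
      fix z assume "z \<in> (\<Union>h\<in>H. frac_lin (h ** x) ` cell)"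
      then obtain y where "y \<in> H" "z \<in> frac_lin (y ** x) ` cell" by blast
      moreover obtain n where "h n = y" using hsurj[OF \<open>y \<in> H\<close>] by blast
      ultimately show "z \<in> (\<Union>n. C n)" unfolding C_def by blast
    next
      fix z assume "z \<in> (\<Union>n. C n)"
      then obtain n where "z \<in> C n" by blast
      then show "z \<in> (\<Union>h\<in>H. frac_lin (h ** x) ` cell)" using hH[of n] unfolding C_def by blast
    qed
    show "(\<Union>n. A n) \<subseteq> D \<inter> (\<Union>h\<in>H. frac_lin (h ** x) ` cell)"
      unfolding U by (intro UN_least Int_greatest Ab(3) subset_trans[OF Ab(4)]) auto
    from U show "D \<inter> (\<Union>h\<in>H. frac_lin (h ** x) ` cell) \<in> sets hyperbolic_area" using D(1) Cb by auto
  qed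
  finally show ?thesis .
qed

text \<open>Different cosets of \<open>H\<close> use disjoint parts of \<open>D\<close>, each of area at least that of the cell. So
  their number is bounded by the quotient of the areas.\<close>
theorem finite_coarea_finite_index:
  assumes H: "H \<subseteq> SL2Z" "sl2_group H" and D: "covers H D"
  shows "\<exists>R. finite R \<and> R \<subseteq> SL2Z \<and> (\<forall>x\<in>SL2Z. \<exists>r\<in>R. x ** adj2 r \<in> H)"
proof (rule ccontr)
  assume neg: "\<not> ?thesis"
  note SL = sl2_det[OF SL2Z_group] sl2_mult[OF SL2Z_group] sl2_adj2[OF SL2Z_group]
  have "\<exists>J. finite J \<and> card J = n \<and> J \<subseteq> SL2Z \<and> (\<forall>x\<in>J. \<forall>y\<in>J. x \<noteq> y \<longrightarrow> x ** adj2 y \<notin> H)" for n :: nat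
  proof (induction n)
    case 0 show ?case by (intro exI[of _ "{}"]) auto
  next
    case (Suc n)
    then obtain J where J: "finite J" "card J = n" "J \<subseteq> SL2Z" "\<forall>x\<in>J. \<forall>y\<in>J. x \<noteq> y \<longrightarrow> x ** adj2 y \<notin> H" by blast
    have "\<not> (\<forall>x\<in>SL2Z. \<exists>r\<in>J. x ** adj2 r \<in> H)"
      by (rule notI, rule neg[THEN notE], rule exI[of _ J]) (use J(1,3) in simp)
    then obtain x where x: "x \<in> SL2Z" "\<forall>r\<in>J. x ** adj2 r \<notin> H" by auto
    have sym: "r ** adj2 x \<notin> H" if "r \<in> J" for r
    proof
      assume "r ** adj2 x \<in> H"
      then have "adj2 (r ** adj2 x) \<in> H" by (rule sl2_adj2[OF H(2)])
      moreover have "adj2 (r ** adj2 x) = x ** adj2 r" by (simp add: eq_2x2_iff mult_2x2 algebra_simps)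
      ultimately show False using x that by simp
    qed
    have "x \<notin> J"
    proof
      assume "x \<in> J"
      then have "x ** adj2 x \<notin> H" using x(2) by blast
      then show False using adj2_mult(2)[OF SL(1)[OF x(1)]] sl2_one[OF H(2)] by simp
    qed
    then show ?case using J x sym by (intro exI[of _ "insert x J"]) auto
  qed
  note fam = this
  have bound: "of_nat n * emeasure hyperbolic_area cell \<le> emeasure hyperbolic_area D" for n :: nat
  proof -
    obtain J where J: "finite J" "card J = n" "J \<subseteq> SL2Z" "\<forall>x\<in>J. \<forall>y\<in>J. x \<noteq> y \<longrightarrow> x ** adj2 y \<notin> H" using fam by blast
    define W where "W x = D \<inter> (\<Union>h\<in>H. frac_lin (h ** x) ` cell)" for x
    have Db: "D \<in> sets borel" using D by (simp add: covers_def)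
    have cH: "countable H" using H(1) countable_SL2Z countable_subset by blast
    have hx: "frac_lin (h ** x) ` cell \<in> sets borel" if "h \<in> H" "x \<in> J" for h x
    proof (rule frac_lin_image_borel[OF _ cell_facts(2,1)])
      show "det (h ** x) = 1" using that J(3) H(1) by (intro SL(1) SL(2)) auto
    qed
    have Wb: "W x \<in> sets borel" if "x \<in> J" for x
      unfolding W_def using Db by (intro sets.Int sets.countable_UN' cH) (auto intro: hx that)
    have disj: "disjoint_family_on W J"
      unfolding disjoint_family_on_def
    proof (intro ballI impI)
      fix x y assume xy: "x \<in> J" "y \<in> J" "x \<noteq> y"
      show "W x \<inter> W y = {}"
      proof (rule ccontr)
        assume "W x \<inter> W y \<noteq> {}"
        then obtain h k z w where hk: "h \<in> H" "k \<in> H" "z \<in> cell" "w \<in> cell" "frac_lin (h ** x) z = frac_lin (k ** y) w"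
          unfolding W_def by blast
        have "h ** x = k ** y \<or> h ** x = - (k ** y)"
          using hk xy J(3) H(1) SL(2) by (intro cell_translates[of "h ** x" "k ** y" z w]) auto
        then have e: "h ** x = k ** y \<or> h ** x = (- k) ** y" by (simp add: uminus_matrix_mult)
        have dy: "det y = 1" using xy J(3) SL(1) by blast
        have lk: "x ** adj2 y = adj2 h ** l" if l: "h ** x = l ** y" for l
        proof -
          have "x ** adj2 y = adj2 h ** h ** x ** adj2 y"
            using adj2_mult(1)[OF sl2_det[OF H(2) hk(1)]] by simp
          also have "\<dots> = adj2 h ** ((h ** x) ** adj2 y)" by (simp only: matrix_mul_assoc)
          also have "\<dots> = adj2 h ** (l ** (y ** adj2 y))" by (simp only: l matrix_mul_assoc)
          also have "\<dots> = adj2 h ** l" using adj2_mult(2)[OF dy] by simp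
          finally show ?thesis .
        qed
        have "x ** adj2 y = adj2 h ** k \<or> x ** adj2 y = adj2 h ** (- k)"
        proof (rule disjE[OF e])
          assume "h ** x = k ** y" from lk[OF this] show ?thesis by (rule disjI1)
        next
          assume "h ** x = (- k) ** y" from lk[OF this] show ?thesis by (rule disjI2)
        qed
        moreover have "adj2 h ** k \<in> H" "adj2 h ** (- k) \<in> H"
          by (rule sl2_mult[OF H(2) sl2_adj2[OF H(2) hk(1)]], rule hk(2) sl2_minus[OF H(2) hk(2)])+
        ultimately have "x ** adj2 y \<in> H" by (elim disjE) (simp_all only:)
        then show False using J(4) xy by blast
      qed
    qed
    have "of_nat n * emeasure hyperbolic_area cell = (\<Sum>x\<in>J. emeasure hyperbolic_area cell)" using J(2) by simp
    also have "\<dots> \<le> (\<Sum>x\<in>J. emeasure hyperbolic_area (W x))"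
      unfolding W_def using J(3) by (intro sum_mono cell_area_le_coset_part H D) auto
    also have "\<dots> = emeasure hyperbolic_area (\<Union>x\<in>J. W x)"
      using Wb disj J(1) by (intro sum_emeasure) auto
    also have "\<dots> \<le> emeasure hyperbolic_area D"
      using Db by (intro emeasure_mono) (auto simp: W_def)
    finally show ?thesis .
  qed
  have fin: "emeasure hyperbolic_area D < \<infinity>" using D by (simp add: covers_def)
  define a b where "a = enn2real (emeasure hyperbolic_area cell)" and "b = enn2real (emeasure hyperbolic_area D)"
  have a: "emeasure hyperbolic_area cell = ennreal a" and b: "emeasure hyperbolic_area D = ennreal b"
    using cell_facts(3) fin by (simp_all add: a_def b_def)
  have apos: "a > 0" and b0: "b \<ge> 0" using cell_facts(4) a by (simp_all add: b_def)
  have "n * a \<le> b" for n :: nat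
    using bound[of n] apos b0 unfolding a b by (simp add: ennreal_of_nat_eq_real_of_nat ennreal_mult'[symmetric])
  moreover obtain n :: nat where "b < n * a" using ex_less_of_nat_mult[OF apos] by blast
  ultimately show False by (meson not_le)
qed

lemma covers_finite_index:
  assumes G: "sl2_group G" and D: "covers G D" and R: "finite R" "R \<subseteq> G"
    and cos: "\<And>A. A \<in> G \<Longrightarrow> \<exists>r\<in>R. A ** adj2 r \<in> H" and H: "H \<subseteq> G"
  shows "covers H (\<Union>r\<in>R. frac_lin r ` D)"
proof -
  have D': "D \<in> sets borel" "D \<subseteq> upper_half_plane" "emeasure hyperbolic_area D < \<infinity>"
    "\<And>z. z \<in> upper_half_plane \<Longrightarrow> \<exists>A\<in>G. \<exists>w\<in>D. z = frac_lin A w"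
    using D by (auto simp: covers_def)
  have dr: "det r = 1" if "r \<in> R" for r using that R sl2_det[OF G] by blast
  have rb: "frac_lin r ` D \<in> sets borel" if "r \<in> R" for r by (intro frac_lin_image_borel dr that D')
  have "emeasure hyperbolic_area (\<Union>r\<in>R. frac_lin r ` D) \<le> (\<Sum>r\<in>R. emeasure hyperbolic_area (frac_lin r ` D))"
    using R rb by (intro emeasure_subadditive_finite) auto
  also have "\<dots> = (\<Sum>r\<in>R. emeasure hyperbolic_area D)"
    by (intro sum.cong refl hyperbolic_area_frac_lin dr D')
  also have "\<dots> < \<infinity>" using D'(3) by (simp add: ennreal_mult_less_top of_nat_less_top)
  finally have fin: "emeasure hyperbolic_area (\<Union>r\<in>R. frac_lin r ` D) < \<infinity>" .
  have "\<exists>A\<in>H. \<exists>w\<in>(\<Union>r\<in>R. frac_lin r ` D). z = frac_lin A w" if z: "z \<in> upper_half_plane" for z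
  proof -
    obtain A w where A: "A \<in> G" "w \<in> D" "z = frac_lin A w" using D'(4)[OF z] by blast
    obtain r where r: "r \<in> R" "A ** adj2 r \<in> H" using cos[OF A(1)] by blast
    have iw: "Im w > 0" using A D'(2) by (auto simp: upper_half_plane_def)
    have "frac_lin (A ** adj2 r) (frac_lin r w) = frac_lin (A ** adj2 r ** r) w"
      using dr[OF r(1)] sl2_det[OF G A(1)] iw by (intro frac_lin_mult) (auto simp: det_mul)
    also have "A ** adj2 r ** r = A" using adj2_mult(1)[OF dr[OF r(1)]] by (simp add: matrix_mul_assoc[symmetric])
    finally have "z = frac_lin (A ** adj2 r) (frac_lin r w)" using A(3) by simp
    moreover have "frac_lin r w \<in> (\<Union>r\<in>R. frac_lin r ` D)" using r(1) A(2) by auto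
    ultimately show ?thesis using r(2) by (intro bexI[of _ "A ** adj2 r"] bexI[of _ "frac_lin r w"])
  qed
  moreover have "(\<Union>r\<in>R. frac_lin r ` D) \<subseteq> upper_half_plane"
    using Im_frac_lin_pos[OF dr] D'(2) by (auto simp: upper_half_plane_def)
  ultimately show ?thesis unfolding covers_def using R rb fin by auto
qed

text \<open>If the whole group fixed the cusp, then discreteness would exclude dilations and the group would
  consist of shears up to sign. The integral shears would have finite index in it, hence finite
  coarea, hence finite index in the modular group. But the lower left entries of the
  modular group are unbounded, and multiplication by shears does not change them.\<close>
theorem exists_lower_left_nonzero:
  assumes G: "sl2_group G" and U: "shear 1 \<in> G" and D: "covers G D"
    and disc: "\<exists>e>0. \<forall>x. shear x \<in> G \<and> \<bar>x\<bar> < e \<longrightarrow> x = 0"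
  shows "\<exists>A\<in>G. A$2$1 \<noteq> 0"
proof (rule ccontr)
  assume "\<not> ?thesis"
  then have low: "A$2$1 = 0" if "A \<in> G" for A using that by blast
  obtain e where e: "e > 0" "\<And>x. shear x \<in> G \<Longrightarrow> \<bar>x\<bar> < e \<Longrightarrow> x = 0" using disc by blast
  have contr: "\<bar>A$1$1\<bar> \<ge> 1" if A: "A \<in> G" for A
  proof (rule ccontr)
    assume lt: "\<not> \<bar>A$1$1\<bar> \<ge> 1"
    have ad: "A$1$1 * A$2$2 = 1" using sl2_det[OF G A] low[OF A] by (simp add: det_2x2)
    have conj: "shear ((A$1$1)\<^sup>2 ^ n) \<in> G" for n
    proof (induction n)
      case (Suc n)
      have "A ** shear ((A$1$1)\<^sup>2 ^ n) ** adj2 A \<in> G"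
        by (intro sl2_mult[OF G] sl2_adj2[OF G] A Suc)
      also have "A ** shear ((A$1$1)\<^sup>2 ^ n) ** adj2 A = shear ((A$1$1)\<^sup>2 ^ Suc n)"
        using ad low[OF A] by (simp add: eq_2x2_iff mult_2x2 power2_eq_square algebra_simps)
      finally show ?case .
    qed (use U in simp)
    have "(A$1$1)\<^sup>2 < 1" using lt by (simp add: abs_square_less_1)
    then obtain n where "(A$1$1)\<^sup>2 ^ n < e" using real_arch_pow_inv[OF e(1)] by blast
    then have "(A$1$1)\<^sup>2 ^ n = 0" using e(2)[OF conj] by simp
    then show False using ad by simp
  qed
  have form: "\<exists>x. A = shear x \<or> A = - shear x" if A: "A \<in> G" for A
  proof -
    have ad: "A$1$1 * A$2$2 = 1" using sl2_det[OF G A] low[OF A] by (simp add: det_2x2)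
    have "\<bar>A$1$1\<bar> \<ge> 1" "\<bar>A$2$2\<bar> \<ge> 1" using contr[OF A] contr[OF sl2_adj2[OF G A]] by auto
    moreover have "\<bar>A$1$1\<bar> * \<bar>A$2$2\<bar> = 1" using ad by (metis abs_mult abs_one)
    ultimately have "\<bar>A$1$1\<bar> = 1" by (smt (verit) mult_le_cancel_left1)
    then have "A$1$1 = 1 \<and> A$2$2 = 1 \<or> A$1$1 = -1 \<and> A$2$2 = -1" using ad by (auto simp: abs_if split: if_splits)
    then show ?thesis
    proof
      assume "A$1$1 = 1 \<and> A$2$2 = 1"
      then have "A = shear (A$1$2)" using low[OF A] by (simp add: eq_2x2_iff)
      then show ?thesis by blast
    next
      assume "A$1$1 = -1 \<and> A$2$2 = -1"
      then have "A = - shear (- (A$1$2))" using low[OF A] by (simp add: eq_2x2_iff)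
      then show ?thesis by blast
    qed
  qed
  define H where "H = {A. \<exists>n::int. A = shear (of_int n) \<or> A = - shear (of_int n)}"
  have HG: "H \<subseteq> G" using sl2_shear[OF G U] sl2_minus[OF G] by (auto simp: H_def)
  have HZ: "H \<subseteq> SL2Z" by (auto simp: H_def SL2Z_def forall_2 det_uminus_2)
  have Hg: "sl2_group H"
    unfolding sl2_group_def
  proof (intro conjI ballI)
    show "mat 1 \<in> H" unfolding H_def using shear_0 by (intro CollectI exI[of _ 0]) simp
    fix A assume "A \<in> H"
    then obtain n :: int where n: "A = shear (of_int n) \<or> A = - shear (of_int n)" by (auto simp: H_def)
    show "det A = 1" using n by (auto simp: det_uminus_2)
    show "- A \<in> H" using n unfolding H_def by (intro CollectI exI[of _ n]) auto
    have "adj2 (- shear (of_int n)) = - shear (of_int (- n))" by (simp add: eq_2x2_iff)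
    then show "adj2 A \<in> H" using n unfolding H_def by (intro CollectI exI[of _ "- n"]) (auto simp: adj2_shear)
    fix B assume "B \<in> H"
    then obtain m :: int where m: "B = shear (of_int m) \<or> B = - shear (of_int m)" by (auto simp: H_def)
    have mm: "A ** (- B) = - (A ** B)" for A B :: "real^2^2" by (simp add: eq_2x2_iff mult_2x2)
    show "A ** B \<in> H" using n m unfolding H_def
      by (intro CollectI exI[of _ "n + m"]) (auto simp: uminus_matrix_mult mm shear_add)
  qed
  define P where "P = {x. shear x \<in> G \<and> 0 \<le> x \<and> x < 1}"
  have "finite P"
  proof (rule ccontr)
    assume inf: "infinite P"
    define k where "k x = \<lfloor>x / e\<rfloor>" for x
    have "k ` P \<subseteq> {0..\<lfloor>1/e\<rfloor>}"
    proof
      fix i assume "i \<in> k ` P"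
      then obtain x where x: "x \<in> P" "i = \<lfloor>x / e\<rfloor>" by (auto simp: k_def)
      have "0 \<le> x / e" "x / e \<le> 1 / e" using x e(1) by (auto simp: P_def intro!: divide_right_mono)
      then show "i \<in> {0..\<lfloor>1/e\<rfloor>}" unfolding x(2) by (auto intro: floor_mono)
    qed
    then have "finite (k ` P)" by (rule finite_subset) simp
    then have "\<not> inj_on k P" using inf finite_imageD by blast
    then obtain x y where xy: "x \<in> P" "y \<in> P" "k x = k y" "x \<noteq> y" by (auto simp: inj_on_def)
    have "\<bar>x / e - y / e\<bar> < 1" using xy(3) unfolding k_def by linarith
    then have "\<bar>x - y\<bar> < e" using e(1) by (simp add: diff_divide_distrib[symmetric] abs_divide divide_less_eq)
    moreover have "shear (x - y) \<in> G"
      using sl2_mult[OF G, of "shear x" "adj2 (shear y)"] sl2_adj2[OF G, of "shear y"] xy(1,2)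
      by (simp add: P_def adj2_shear shear_add)
    ultimately show False using e(2) xy(4) by force
  qed
  then have "covers H (\<Union>r\<in>shear ` P. frac_lin r ` D)"
  proof (intro covers_finite_index[OF G D _ _ _ HG])
    show "shear ` P \<subseteq> G" by (auto simp: P_def)
    fix A assume A: "A \<in> G"
    obtain x where x: "A = shear x \<or> A = - shear x" using form[OF A] by blast
    have sx: "shear x \<in> G" using x A sl2_minus[OF G A] by auto
    have "shear (x - of_int \<lfloor>x\<rfloor>) \<in> G"
      using sl2_mult[OF G sx sl2_shear[OF G U, of "- \<lfloor>x\<rfloor>"]] by (simp add: shear_add)
    then have "x - of_int \<lfloor>x\<rfloor> \<in> P" unfolding P_def by (auto simp: ) linarith
    moreover have "A ** adj2 (shear (x - of_int \<lfloor>x\<rfloor>)) \<in> H"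
      using x unfolding H_def by (intro CollectI exI[of _ "\<lfloor>x\<rfloor>"]) (auto simp: adj2_shear shear_add uminus_matrix_mult)
    ultimately show "\<exists>r\<in>shear ` P. A ** adj2 r \<in> H" by blast
  qed auto
  from finite_coarea_finite_index[OF HZ Hg this]
  obtain R where R: "finite R" "R \<subseteq> SL2Z" "\<forall>x\<in>SL2Z. \<exists>r\<in>R. x ** adj2 r \<in> H" by (elim exE conjE)
  \<comment> \<open>lower triangular matrices represent infinitely many cosets of \<open>H\<close>\<close>
  define L :: "int \<Rightarrow> real^2^2" where "L j = vector [vector [1, 0], vector [of_int j, 1]]" for j
  have Ln: "L j$1$1 = 1" "L j$1$2 = 0" "L j$2$1 = of_int j" "L j$2$2 = 1" for j by (simp_all add: L_def)
  have "\<exists>r\<in>R. of_int j = r$2$1 \<or> of_int j = - (r$2$1)" for j :: int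
  proof -
    have "L j \<in> SL2Z" by (simp add: SL2Z_def forall_2 Ln det_2x2)
    then obtain r where r: "r \<in> R" "L j ** adj2 r \<in> H" using R(3) by blast
    then obtain n :: int where n: "L j ** adj2 r = shear (of_int n) \<or> L j ** adj2 r = - shear (of_int n)" by (auto simp: H_def)
    have dr: "det r = 1" using r R(2) by (auto simp: SL2Z_def)
    have "L j = L j ** adj2 r ** r" using adj2_mult(1)[OF dr] by (simp add: matrix_mul_assoc[symmetric])
    then have "L j = shear (of_int n) ** r \<or> L j = - (shear (of_int n) ** r)"
      using n by (auto simp: uminus_matrix_mult)
    then have "L j$2$1 = (shear (of_int n) ** r)$2$1 \<or> L j$2$1 = (- (shear (of_int n) ** r))$2$1" by metis
    then show ?thesis using r(1) by (auto simp: Ln mult_2x2)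
  qed
  then have "range real_of_int \<subseteq> (\<lambda>r. r$2$1) ` R \<union> (\<lambda>r. - (r$2$1)) ` R" by blast
  then have "finite (range real_of_int)" using R(1) by (meson finite_UnI finite_imageI finite_subset)
  then show False using infinite_UNIV_int finite_imageD[of real_of_int UNIV] by (simp add: inj_def)
qed

section \<open>From integral traces to integral matrices\<close>

lemma Ints_of_square_times_squarefree:
  fixes e :: nat and y :: real
  assumes e: "squarefree e" and y: "y \<in> \<rat>" and ey: "of_nat e * y\<^sup>2 \<in> \<int>"
  shows "y \<in> \<int>"
proof -
  obtain p q :: int where pq: "q > 0" "coprime p q" "y = of_int p / of_int q" using y by (metis Rats_cases')
  obtain k :: int where k: "of_nat e * y\<^sup>2 = of_int k" using ey by (auto elim: Ints_cases)
  have "of_int (int e * p\<^sup>2) = (of_int (k * q\<^sup>2) :: real)"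
    using k pq(1) by (simp add: pq(3) power_divide field_simps)
  then have "int e * p\<^sup>2 = k * q\<^sup>2" by (simp only: of_int_eq_iff)
  then have "q\<^sup>2 dvd int e * p\<^sup>2" by simp
  moreover have "coprime (q\<^sup>2) (p\<^sup>2)" using pq(2) by (simp add: coprime_commute)
  ultimately have "q\<^sup>2 dvd int e" by (simp add: coprime_dvd_mult_left_iff)
  then have "(nat q)\<^sup>2 dvd e" using pq(1) by (metis int_dvd_int_iff nat_0_le of_nat_power order_less_imp_le)
  then have "nat q dvd 1" using e unfolding squarefree_def by blast
  then have "q = 1" using pq(1) by simp
  then show ?thesis using pq by simp
qed

text \<open>The squarefree part of the integer \<open>m n\<close>, where \<open>c\<^sup>2 = m / n\<close>.\<close>
lemma Rats_square_decompose:
  fixes c :: real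
  assumes c: "c \<noteq> 0" "c\<^sup>2 \<in> \<rat>"
  obtains e :: nat where "squarefree e" "e > 0" "c / sqrt e \<in> \<rat>"
proof -
  obtain m n :: int where mn: "n > 0" "c\<^sup>2 = of_int m / of_int n" using c(2) by (metis Rats_cases')
  have m: "m > 0"
  proof -
    have "of_int m / real_of_int n > 0" using c mn by (metis zero_less_power2)
    then show ?thesis using mn(1) by (simp add: zero_less_divide_iff)
  qed
  define N where "N = nat (m * n)"
  have N: "N > 0" "real N = of_int m * of_int n" using m mn(1) by (simp_all add: N_def)
  define e k where "e = squarefree_part N" and "k = square_part N"
  have dec: "N = e * k\<^sup>2" unfolding e_def k_def by (rule squarefree_decompose)
  have "squarefree e" unfolding e_def using N(1) by (intro squarefree_squarefree_part)
  moreover have "e > 0" using N(1) dec by (cases "e = 0") auto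
  ultimately have e: "squarefree e" "e > 0" by blast+
  have "(c * of_int n)\<^sup>2 = real N"
    unfolding power_mult_distrib mn(2) N(2) using mn(1) by (simp add: power2_eq_square)
  also have "\<dots> = (sqrt e * k)\<^sup>2" by (simp add: dec power_mult_distrib)
  finally have "c * of_int n = sqrt e * k \<or> c * of_int n = - (sqrt e * k)" by (simp only: power2_eq_iff)
  then have "c / sqrt e = k / of_int n \<or> c / sqrt e = - (k / of_int n)"
    using e(2) mn(1) by (auto simp: field_simps)
  then have "c / sqrt e \<in> \<rat>" by auto
  then show ?thesis using that e by blast
qed

lemma rational_common_denominator:
  assumes "finite S" "S \<subseteq> (\<rat>::real set)"
  shows "\<exists>M::nat. M > 0 \<and> (\<forall>x\<in>S. of_nat M * x \<in> \<int>)"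
  using assms
proof (induction S)
  case empty then show ?case by (intro exI[of _ 1]) auto
next
  case (insert x S)
  then obtain M :: nat where M: "M > 0" "\<forall>x\<in>S. of_nat M * x \<in> \<int>" by auto
  obtain p q :: int where pq: "q > 0" "x = of_int p / of_int q" using insert.prems by (metis Rats_cases' insert_subset)
  have qx: "of_nat (nat q) * x = of_int p" using pq by simp
  have "of_nat (M * nat q) * y \<in> \<int>" if y: "y \<in> insert x S" for y
  proof (cases "y = x")
    case True
    have eq: "of_nat (M * nat q) * y = of_nat M * (of_nat (nat q) * x)" using True by (simp add: mult.assoc)
    show ?thesis unfolding eq qx by (intro Ints_mult) simp_all
  next
    case False
    then have "of_nat M * y \<in> \<int>" using y M(2) by simp
    from Ints_mult[OF Ints_of_nat this, of "nat q"] show ?thesis by (simp only: of_nat_mult mult_ac)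
  qed
  then show ?case using M(1) pq(1) by (intro exI[of _ "M * nat q"]) auto
qed

context cusped_growth begin

text \<open>For \<open>c \<noteq> 0\<close> the square \<open>A\<^sup>2\<close> has rational trace and rational lower left entry. For \<open>c = 0\<close> a diagonal
  entry of absolute value below \<open>1\<close> would contract lower left entries of \<open>A\<^sup>n g\<close> to \<open>0\<close>, against
  \<open>lower_left_bound\<close>; so the trace is \<open>2\<close> or \<open>-2\<close>.\<close>
lemma rational_trace_square_integral:
  assumes A: "A \<in> G" and g: "g \<in> G" "g$2$1 \<noteq> 0"
  shows "(trace A)\<^sup>2 \<in> \<int>"
proof (cases "A$2$1 = 0")
  case False
  show ?thesis
  proof (cases "trace A = 0")
    case t0: False
    define t c where "t = trace A" and "c = A$2$1"
    have tc: "t / c \<in> \<rat>" "c\<^sup>2 \<in> \<rat>" "c \<noteq> 0" "t \<noteq> 0"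
      using trace_over_lower_left_rational[OF A False] lower_left_square_rational[OF A False] False t0
      by (simp_all add: t_def c_def)
    have tr: "trace (A ** A) = t\<^sup>2 - 2"
      using trace_shear_square[OF in_det[OF A], of 0 0] by (simp add: shear_0 t_def power2_eq_square)
    have low: "(A ** A)$2$1 = c * t" by (simp add: mult_2x2 t_def c_def trace_2x2 algebra_simps)
    have eq: "c\<^sup>2 * (t / c) = c * t" "c\<^sup>2 * (t / c)\<^sup>2 = t\<^sup>2" using tc(3) by (simp_all add: power2_eq_square)
    have "c * t \<in> \<rat>" "t\<^sup>2 \<in> \<rat>"
      using Rats_mult[OF tc(2,1)] Rats_mult[OF tc(2) Rats_power[OF tc(1), of 2]] unfolding eq by (simp_all only:)
    then have "trace (A ** A) \<in> \<int>"
      using tr low tc by (intro rational_trace_integral in_mult A) auto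
    then have "t\<^sup>2 - 2 + 2 \<in> \<int>" unfolding tr by (rule Ints_add) simp
    then show ?thesis by (simp add: t_def)
  qed simp
next
  case True
  have ge: "\<bar>C$2$2\<bar> \<ge> 1" if C: "C \<in> G" "C$2$1 = 0" for C
  proof (rule ccontr)
    assume lt: "\<not> \<bar>C$2$2\<bar> \<ge> 1"
    have ad: "C$1$1 * C$2$2 = 1" using in_det[OF C(1)] C(2) by (simp add: det_2x2)
    have low: "mpow C n$2$1 = 0 \<and> mpow C n$2$2 = C$2$2 ^ n" for n
      using C(2) by (induction n) (simp_all add: mult_2x2)
    have "2 \<le> B * \<bar>g$2$1\<bar> * \<bar>C$2$2\<bar> ^ n" for n
    proof -
      have "(mpow C n ** g)$2$1 = C$2$2 ^ n * g$2$1" using low by (simp add: mult_2x2)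
      moreover have "C$2$2 ^ n * g$2$1 \<noteq> 0" using g(2) ad by auto
      ultimately have "2 \<le> B * \<bar>C$2$2 ^ n * g$2$1\<bar>"
        using lower_left_bound[OF in_mult[OF in_mpow[OF C(1)] g(1)], of n] by simp
      then show ?thesis by (simp add: abs_mult power_abs mult_ac)
    qed
    note b = this
    have pos: "B * \<bar>g$2$1\<bar> > 0" using b[of 0] by simp
    obtain n where "\<bar>C$2$2\<bar> ^ n < 1 / (B * \<bar>g$2$1\<bar>)"
      using real_arch_pow_inv[of "1 / (B * \<bar>g$2$1\<bar>)" "\<bar>C$2$2\<bar>"] pos lt by auto
    then have "B * \<bar>g$2$1\<bar> * \<bar>C$2$2\<bar> ^ n < 1" using pos by (simp add: field_simps)
    then show False using b[of n] by linarith
  qed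
  have ad: "A$1$1 * A$2$2 = 1" using in_det[OF A] True by (simp add: det_2x2)
  have g1: "\<bar>A$2$2\<bar> \<ge> 1" "\<bar>A$1$1\<bar> \<ge> 1" using ge[OF A True] ge[OF in_adj2[OF A]] True by simp_all
  have "\<bar>A$1$1\<bar> * \<bar>A$2$2\<bar> = 1" using ad by (metis abs_mult abs_one)
  then have "\<bar>A$1$1\<bar> = 1" using g1 by (smt (verit) mult_le_cancel_left1)
  then have "A$1$1 = 1 \<and> A$2$2 = 1 \<or> A$1$1 = -1 \<and> A$2$2 = -1" using ad by (auto simp: abs_if split: if_splits)
  then show ?thesis by (auto simp: trace_2x2)
qed

text \<open>Each matrix is \<open>sqrt e\<close> times a rational matrix with \<open>e\<close> squarefree, and the traces of \<open>A\<close>, \<open>A U\<close>,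
  \<open>A \<gamma>\<close>, \<open>A \<gamma> U\<close> divided by \<open>sqrt e\<close> are integers. These four linear forms are independent, so the rational
  matrix has a denominator \<open>M\<close> independent of \<open>A\<close>; the determinant shows that \<open>e\<close> divides \<open>M\<^sup>2\<close>.
  The key \<open>f\<close> records \<open>e\<close> and the numerators modulo \<open>M\<^sup>2\<close>. Two matrices with equal key differ by \<open>M sqrt e\<close>
  times an integral matrix, which makes the quotient integral.\<close>
theorem commensurable_with_integral_matrices:
  assumes cusps: "\<And>A. A \<in> G \<Longrightarrow> A$2$1 \<noteq> 0 \<Longrightarrow> A$1$1 / A$2$1 \<in> \<rat> \<and> A$2$2 / A$2$1 \<in> \<rat>"
    and g0: "g0 \<in> G" "g0$2$1 \<noteq> 0"
  shows "\<exists>f :: real^2^2 \<Rightarrow> nat \<times> int \<times> int \<times> int \<times> int. finite (f ` G) \<and>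
    (\<forall>x\<in>G. \<forall>y\<in>G. f x = f y \<longrightarrow> y ** adj2 x \<in> SL2Z)"
proof -
  have scaled: "A$1$1 / s \<in> \<rat> \<and> A$1$2 / s \<in> \<rat> \<and> A$2$1 / s \<in> \<rat> \<and> A$2$2 / s \<in> \<rat>"
    if A: "A \<in> G" "A$2$1 \<noteq> 0" and s: "A$2$1 / s \<in> \<rat>" "s\<^sup>2 \<in> \<rat>" "s \<noteq> 0" for A s
  proof -
    define p q c where "p = A$1$1 / A$2$1" and "q = A$2$2 / A$2$1" and "c = A$2$1 / s"
    have pq: "p \<in> \<rat>" "q \<in> \<rat>" "c \<in> \<rat>" using cusps[OF A] s by (simp_all add: p_def q_def c_def)
    have c0: "c \<noteq> 0" using A s by (simp add: c_def)
    have e: "A$2$1 = c * s" "A$1$1 = p * c * s" "A$2$2 = q * c * s" using A s(3) by (simp_all add: p_def q_def c_def)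
    have "p * c * s * (q * c * s) = 1 + A$1$2 * (c * s)" using in_det[OF A(1)] by (simp add: det_2x2 e)
    then have "A$1$2 = (p * q * c\<^sup>2 * s\<^sup>2 - 1) / (c * s)" using c0 s(3) by (simp add: eq_divide_eq power2_eq_square mult_ac)
    then have "A$1$2 / s = (p * q * c\<^sup>2 * s\<^sup>2 - 1) / (c * s\<^sup>2)" by (simp add: power2_eq_square)
    then show ?thesis using pq s(2,3) by (simp add: e)
  qed
  obtain \<gamma> where g: "\<gamma> \<in> G" "\<gamma>$2$1 \<noteq> 0" "\<gamma>$1$1 \<in> \<rat>" "\<gamma>$1$2 \<in> \<rat>" "\<gamma>$2$1 \<in> \<rat>" "\<gamma>$2$2 \<in> \<rat>"
  proof -
    obtain h where h: "h \<in> G" "h$2$1 \<noteq> 0" "trace h \<noteq> 0"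
    proof (cases "trace g0 = 0")
      case True
      show ?thesis
      proof (rule that[of "g0 ** shear 1"])
        show "g0 ** shear 1 \<in> G" by (intro in_mult g0 U)
      qed (use g0 True in \<open>simp_all add: mult_2x2 trace_2x2\<close>)
    qed (use g0 that in blast)
    have low: "(h ** h)$2$1 = (h$2$1)\<^sup>2 * (trace h / h$2$1)" using h(2) by (simp add: mult_2x2 trace_2x2 power2_eq_square algebra_simps)
    have r: "(h ** h)$2$1 \<in> \<rat>" unfolding low
      using trace_over_lower_left_rational[OF h(1,2)] lower_left_square_rational[OF h(1,2)] by (rule Rats_mult[rotated])
    have nz: "(h ** h)$2$1 \<noteq> 0" unfolding low using h by simp
    have "h ** h \<in> G" by (intro in_mult h)
    then show ?thesis using scaled[of "h ** h" 1] r nz by (intro that[of "h ** h"]) auto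
  qed
  have ex_e: "\<exists>e::nat. squarefree (e::nat) \<and> (e::nat) > 0 \<and> A$1$1 / sqrt e \<in> \<rat> \<and> A$1$2 / sqrt e \<in> \<rat> \<and> A$2$1 / sqrt e \<in> \<rat> \<and> A$2$2 / sqrt e \<in> \<rat>"
    if A: "A \<in> G" for A
  proof -
    have main: "\<exists>e::nat. squarefree (e::nat) \<and> (e::nat) > 0 \<and> A$1$1 / sqrt e \<in> \<rat> \<and> A$1$2 / sqrt e \<in> \<rat> \<and> A$2$1 / sqrt e \<in> \<rat> \<and> A$2$2 / sqrt e \<in> \<rat>"
      if A: "A \<in> G" "A$2$1 \<noteq> 0" for A
    proof -
      obtain e :: nat where e: "squarefree e" "e > 0" "A$2$1 / sqrt e \<in> \<rat>"
        using Rats_square_decompose[OF A(2) lower_left_square_rational[OF A]] .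
      then show ?thesis using scaled[OF A e(3)] by (intro exI[of _ e]) auto
    qed
    show ?thesis
    proof (cases "A$2$1 = 0")
      case True
      define C where "C = \<gamma> ** A"
      have C: "C \<in> G" unfolding C_def by (intro in_mult g A)
      have "A$1$1 * A$2$2 = 1" using in_det[OF A] True by (simp add: det_2x2)
      then have "C$2$1 \<noteq> 0" using g(2) True by (auto simp: C_def mult_2x2)
      from main[OF C this] obtain e :: nat where e: "squarefree e" "e > 0"
        "C$1$1 / sqrt e \<in> \<rat>" "C$1$2 / sqrt e \<in> \<rat>" "C$2$1 / sqrt e \<in> \<rat>" "C$2$2 / sqrt e \<in> \<rat>" by blast
      have "A = adj2 \<gamma> ** C" using adj2_mult(1)[OF in_det[OF g(1)]] by (simp add: C_def matrix_mul_assoc)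
      then have eq: "A$i$j / sqrt e = adj2 \<gamma>$i$1 * (C$1$j / sqrt e) + adj2 \<gamma>$i$2 * (C$2$j / sqrt e)" for i j
        by (simp add: mult_2x2 add_divide_distrib)
      have Cr: "\<forall>i j. C$i$j / sqrt e \<in> \<rat>" and gr: "\<forall>i j. adj2 \<gamma>$i$j \<in> \<rat>"
        using e g by (simp_all add: forall_2)
      have "A$i$j / sqrt e \<in> \<rat>" for i j
        unfolding eq by (intro Rats_add Rats_mult Cr[rule_format] gr[rule_format])
      then show ?thesis using e(1,2) by blast
    qed (use main A in blast)
  qed
  obtain E :: nat where E: "E > 0" "of_nat E * \<gamma>$1$1 \<in> \<int>" "of_nat E * \<gamma>$1$2 \<in> \<int>" "of_nat E * \<gamma>$2$1 \<in> \<int>" "of_nat E * \<gamma>$2$2 \<in> \<int>"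
    using rational_common_denominator[of "{\<gamma>$1$1, \<gamma>$1$2, \<gamma>$2$1, \<gamma>$2$2}"] g by auto
  define a b c d where "a = of_nat E * \<gamma>$1$1" and "b = of_nat E * \<gamma>$1$2" and "c = of_nat E * \<gamma>$2$1" and "d = of_nat E * \<gamma>$2$2"
  have abcd: "a \<in> \<int>" "b \<in> \<int>" "c \<in> \<int>" "d \<in> \<int>" "c \<noteq> 0" using E g(2) by (simp_all add: a_def b_def c_def d_def)
  \<comment> \<open>\<open>c\<close> is the lower left entry of the integral matrix \<open>E \<gamma>\<close>; its square clears all denominators\<close>
  define M where "M = nat \<lfloor>c\<^sup>2\<rfloor>"
  have c2: "c\<^sup>2 \<in> \<int>" "c\<^sup>2 > 0" using abcd by simp_all
  have M: "real M = c\<^sup>2" using c2 by (auto simp: M_def elim!: Ints_cases)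
  have Mpos: "M > 0" using c2(2) M by (metis of_nat_0_less_iff)
  define good where "good A e V \<longleftrightarrow> e > 0 \<and> e \<le> M\<^sup>2 \<and>
     (\<forall>i j. A$i$j = sqrt (of_nat e) * of_int (V i j) / of_nat M)" for A :: "real^2^2" and e :: nat and V :: "2 \<Rightarrow> 2 \<Rightarrow> int"
  have ex: "\<exists>e V. good A e V" if A: "A \<in> G" for A
  proof -
    obtain e :: nat where e: "squarefree e" "e > 0" "A$1$1 / sqrt e \<in> \<rat>" "A$1$2 / sqrt e \<in> \<rat>" "A$2$1 / sqrt e \<in> \<rat>" "A$2$2 / sqrt e \<in> \<rat>"
      using ex_e[OF A] by blast
    define y where "y i j = A$i$j / sqrt e" for i j
    have Ay: "A$i$j = sqrt e * y i j" for i j using e(2) by (simp add: y_def)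
    have yr: "y 1 1 \<in> \<rat>" "y 1 2 \<in> \<rat>" "y 2 1 \<in> \<rat>" "y 2 2 \<in> \<rat>" using e by (simp_all add: y_def)
    have trI: "t \<in> \<int>" if C: "C \<in> G" "trace C = sqrt e * t" "t \<in> \<rat>" for C t
    proof -
      have "of_nat e * t\<^sup>2 = (trace C)\<^sup>2" by (simp add: C(2) power_mult_distrib)
      then have "of_nat e * t\<^sup>2 \<in> \<int>" using rational_trace_square_integral[OF C(1) g(1,2)] by simp
      then show ?thesis using Ints_of_square_times_squarefree[OF e(1) C(3)] by blast
    qed
    have i1: "y 1 1 + y 2 2 \<in> \<int>"
      using yr by (intro trI[OF A]) (simp_all add: trace_2x2 Ay algebra_simps)
    have i2: "y 1 1 + y 2 1 + y 2 2 \<in> \<int>"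
      using yr by (intro trI[OF in_mult[OF A U]]) (simp_all add: trace_2x2 mult_2x2 Ay algebra_simps)
    have "y 2 1 = (y 1 1 + y 2 1 + y 2 2) - (y 1 1 + y 2 2)" by simp
    then have y21: "y 2 1 \<in> \<int>" using i1 i2 by (metis Ints_diff)
    define t3 where "t3 = y 1 1 * \<gamma>$1$1 + y 1 2 * \<gamma>$2$1 + y 2 1 * \<gamma>$1$2 + y 2 2 * \<gamma>$2$2"
    define t4 where "t4 = y 2 1 * \<gamma>$1$1 + y 2 2 * \<gamma>$2$1"
    have i3: "t3 \<in> \<int>"
      using yr g by (intro trI[OF in_mult[OF A g(1)]]) (simp_all add: trace_2x2 mult_2x2 Ay algebra_simps t3_def)
    have "t3 + t4 \<in> \<int>"
      using yr g by (intro trI[OF in_mult[OF in_mult[OF A g(1)] U]]) (simp_all add: trace_2x2 mult_2x2 Ay algebra_simps t3_def t4_def)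
    then have i4: "t4 \<in> \<int>" using i3 Ints_diff by fastforce
    have "c * y 2 2 = of_nat E * t4 - y 2 1 * a" by (simp add: t4_def a_def c_def algebra_simps)
    then have c22: "c * y 2 2 \<in> \<int>" using i4 y21 abcd by simp
    have "c * y 1 1 = c * (y 1 1 + y 2 2) - c * y 2 2" by (simp add: algebra_simps)
    then have c11: "c * y 1 1 \<in> \<int>" using i1 c22 abcd by simp
    have "c\<^sup>2 * y 1 2 = c * (of_nat E * t3) - (c * y 1 1) * a - c * y 2 1 * b - (c * y 2 2) * d"
      by (simp add: t3_def a_def b_def c_def d_def algebra_simps power2_eq_square)
    then have c12: "c\<^sup>2 * y 1 2 \<in> \<int>" using i3 c11 c22 y21 abcd by simp
    have "of_nat M * y i j \<in> \<int>" for i j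
    proof -
      have "c * (c * y 1 1) \<in> \<int>" "c\<^sup>2 * y 2 1 \<in> \<int>" "c * (c * y 2 2) \<in> \<int>" using c11 c22 y21 abcd by simp_all
      then have "\<forall>i j. of_nat M * y i j \<in> \<int>" using c12 unfolding forall_2 M by (simp add: power2_eq_square mult.assoc)
      then show ?thesis by blast
    qed
    then have "\<exists>k::int. of_nat M * y i j = of_int k" for i j by (metis Ints_cases)
    then obtain V :: "2 \<Rightarrow> 2 \<Rightarrow> int" where V: "\<And>i j. of_nat M * y i j = of_int (V i j)" by metis
    have AV: "A$i$j = sqrt e * of_int (V i j) / of_nat M" for i j
      using V[of i j, symmetric] Mpos by (simp add: Ay)
    have "real e * of_int (V 1 1 * V 2 2 - V 1 2 * V 2 1) = (real M)\<^sup>2"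
    proof -
      have gen: "(real M)\<^sup>2 * (r * p / M * (r * q / M) - r * s / M * (r * t / M)) = r\<^sup>2 * (p * q - s * t)"
        for r p q s t :: real
        using Mpos by (simp add: field_simps power2_eq_square)
      have "(real M)\<^sup>2 = (real M)\<^sup>2 * det A" using in_det[OF A] by simp
      also have "\<dots> = (sqrt e)\<^sup>2 * of_int (V 1 1 * V 2 2 - V 1 2 * V 2 1)"
        unfolding det_2x2 AV gen by simp
      finally show ?thesis by simp
    qed
    then have "of_int (int e * (V 1 1 * V 2 2 - V 1 2 * V 2 1)) = (of_int (int (M\<^sup>2)) :: real)" by simp
    then have "int e * (V 1 1 * V 2 2 - V 1 2 * V 2 1) = int (M\<^sup>2)" by (simp only: of_int_eq_iff)
    then have "int e dvd int (M\<^sup>2)" by (metis dvd_triv_left)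
    then have "e dvd M\<^sup>2" by (simp only: int_dvd_int_iff)
    then have "e \<le> M\<^sup>2" using Mpos by (simp add: dvd_imp_le)
    then show ?thesis using AV e(2) by (intro exI[of _ e] exI[of _ V]) (simp add: good_def)
  qed
  then obtain e V where EV: "\<And>A. A \<in> G \<Longrightarrow> good A (e A) (V A)" by metis
  define m where "m = int (M\<^sup>2)"
  have mpos: "m > 0" using Mpos by (simp add: m_def)
  define f where "f A = (e A, V A 1 1 mod m, V A 1 2 mod m, V A 2 1 mod m, V A 2 2 mod m)" for A
  have "f ` G \<subseteq> {..M\<^sup>2} \<times> {0..<m} \<times> {0..<m} \<times> {0..<m} \<times> {0..<m}"
    using EV mpos by (auto simp: f_def good_def)
  then have fin: "finite (f ` G)" by (rule finite_subset) auto
  have "y ** adj2 x \<in> SL2Z" if xy: "x \<in> G" "y \<in> G" "f x = f y" for x y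
  proof -
    have ee: "e y = e x" using xy(3) by (simp add: f_def)
    have "\<exists>k. V y i j = V x i j + m * k" for i j
    proof -
      have "\<forall>i j. V x i j mod m = V y i j mod m" using xy(3) unfolding forall_2 by (simp add: f_def)
      then show ?thesis by (metis cong_def cong_iff_lin)
    qed
    then obtain K where K: "\<And>i j. V y i j = V x i j + m * K i j" by metis
    have xV: "x$i$j = sqrt (e x) * of_int (V x i j) / M" for i j using EV[OF xy(1)] by (simp add: good_def)
    have yV: "y$i$j = x$i$j + sqrt (e x) * M * of_int (K i j)" for i j
    proof -
      have "y$i$j = sqrt (e x) * of_int (V y i j) / M" using EV[OF xy(2)] ee by (simp add: good_def)
      also have "\<dots> = x$i$j + sqrt (e x) * M * of_int (K i j)"
      proof -
        have "r * (p + (real M)\<^sup>2 * k) / M = r * p / M + r * M * k" for r p k :: real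
          using Mpos by (simp add: add_divide_distrib distrib_left power2_eq_square)
        then show ?thesis unfolding K xV m_def by simp
      qed
      finally show ?thesis .
    qed
    have prod: "sqrt (e x) * M * of_int k * x$i$j \<in> \<int>" for k i j
    proof -
      have "r * M * l * (r * v / M) = r\<^sup>2 * l * v" for r l v :: real
        using Mpos by (simp add: power2_eq_square)
      then have eq: "sqrt (e x) * M * of_int k * x$i$j = of_nat (e x) * of_int k * of_int (V x i j)"
        unfolding xV by (simp only: real_sqrt_pow2 of_nat_0_le_iff)
      show ?thesis unfolding eq by simp
    qed
    define L where "L = sqrt (e x) * M"
    have yL: "y$i$j = x$i$j + L * of_int (K i j)" for i j unfolding L_def by (rule yV)
    have pL: "L * of_int k * x$i$j \<in> \<int>" for k i j unfolding L_def by (rule prod)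
    have dx: "x$1$1 * x$2$2 = 1 + x$1$2 * x$2$1" using in_det[OF xy(1)] by (simp add: det_1_iff)
    have "(y ** adj2 x)$1$1 = 1 + L * of_int (K 1 1) * x$2$2 - L * of_int (K 1 2) * x$2$1"
      "(y ** adj2 x)$1$2 = L * of_int (K 1 2) * x$1$1 - L * of_int (K 1 1) * x$1$2"
      "(y ** adj2 x)$2$1 = L * of_int (K 2 1) * x$2$2 - L * of_int (K 2 2) * x$2$1"
      "(y ** adj2 x)$2$2 = 1 + L * of_int (K 2 2) * x$1$1 - L * of_int (K 2 1) * x$1$2"
      unfolding mult_2x2 yL adj2_nth using dx by (simp_all add: algebra_simps)
    then have "\<forall>i j. (y ** adj2 x)$i$j \<in> \<int>"
      unfolding forall_2 by (simp only:) (intro conjI Ints_add Ints_diff pL Ints_1)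
    moreover have "det (y ** adj2 x) = 1" using in_det xy by (simp add: det_mul)
    ultimately show ?thesis by (simp add: SL2Z_def)
  qed
  then show ?thesis using fin by blast
qed

end

section \<open>Fuchsian groups as groups of matrices\<close>

definition lift :: "(real^2^2) set set \<Rightarrow> (real^2^2) set" where
  "lift \<Gamma> = {A. det A = 1 \<and> proj A \<in> \<Gamma>}"

text \<open>Conjugation by a matrix of determinant \<open>1\<close>, for which \<open>adj2\<close> is the inverse.\<close>
definition conj_set :: "real^2^2 \<Rightarrow> (real^2^2) set \<Rightarrow> (real^2^2) set" where
  "conj_set g G = (\<lambda>A. g ** A ** adj2 g) ` G"

lemma carrier_SL2R: "A \<in> carrier SL2R \<longleftrightarrow> det A = 1" by (simp add: SL2R_def)

lemma proj_mult:
  assumes "det A = 1" "det B = 1"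
  shows "proj A \<otimes>\<^bsub>PSL2R\<^esub> proj B = proj (A ** B)"
proof -
  interpret normal pm_one SL2R by (rule pm_one_normal)
  have "proj A \<otimes>\<^bsub>PSL2R\<^esub> proj B = (pm_one #>\<^bsub>SL2R\<^esub> A) <#>\<^bsub>SL2R\<^esub> (pm_one #>\<^bsub>SL2R\<^esub> B)"
    by (simp add: PSL2R_def FactGroup_def proj_def)
  also have "\<dots> = pm_one #>\<^bsub>SL2R\<^esub> (A \<otimes>\<^bsub>SL2R\<^esub> B)"
    using assms by (intro rcos_sum) (simp_all add: carrier_SL2R)
  finally show ?thesis by (simp add: proj_def SL2R_def)
qed

lemma one_PSL2R: "\<one>\<^bsub>PSL2R\<^esub> = proj (mat 1)"
  by (simp add: PSL2R_def FactGroup_def proj_eq pm_one_def)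

lemma proj_carrier: "det A = 1 \<Longrightarrow> proj A \<in> carrier PSL2R"
  by (auto simp: carrier_PSL2R carrier_SL2R)

lemma proj_eq_iff: "proj A = proj B \<longleftrightarrow> A = B \<or> A = - B"
  by (auto simp: proj_eq doubleton_eq_iff)

lemma proj_uminus: "proj (- A) = proj A" by (auto simp: proj_eq)

lemma inv_proj:
  assumes "det A = 1" shows "inv\<^bsub>PSL2R\<^esub> (proj A) = proj (adj2 A)"
proof -
  interpret group PSL2R by (rule group_PSL2R)
  show ?thesis
    using assms by (intro inv_equality) (simp_all add: proj_mult adj2_mult one_PSL2R proj_carrier)
qed

lemma lift_group:
  assumes "subgroup \<Gamma> PSL2R" shows "sl2_group (lift \<Gamma>)"
proof -
  interpret subgroup \<Gamma> PSL2R by (rule assms)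
  have m: "proj (A ** B) \<in> \<Gamma>" if "det A = 1" "det B = 1" "proj A \<in> \<Gamma>" "proj B \<in> \<Gamma>" for A B
    using m_closed[OF that(3,4)] that by (simp add: proj_mult)
  have i: "proj (adj2 A) \<in> \<Gamma>" if "det A = 1" "proj A \<in> \<Gamma>" for A
    using m_inv_closed[OF that(2)] that by (simp add: inv_proj)
  have o: "proj (mat 1) \<in> \<Gamma>" using one_closed by (simp add: one_PSL2R)
  show ?thesis using m i o by (auto simp: sl2_group_def lift_def det_mul det_uminus_2 proj_uminus)
qed

lemma proj_lift:
  assumes "subgroup \<Gamma> PSL2R" shows "\<Gamma> = proj ` lift \<Gamma>"
proof -
  have "T \<in> proj ` lift \<Gamma>" if T: "T \<in> \<Gamma>" for T
  proof -
    have "T \<in> carrier PSL2R" using assms T subgroup.subset by blast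
    then obtain A where "det A = 1" "T = proj A" by (auto simp: carrier_PSL2R carrier_SL2R)
    then show ?thesis using T by (auto simp: lift_def)
  qed
  then show ?thesis by (auto simp: lift_def)
qed

lemma proj_subgroup:
  assumes "sl2_group G" shows "subgroup (proj ` G) PSL2R"
proof -
  interpret group PSL2R by (rule group_PSL2R)
  note G = sl2_det[OF assms] sl2_one[OF assms] sl2_mult[OF assms] sl2_adj2[OF assms]
  show ?thesis
  proof (rule subgroupI)
    show "proj ` G \<subseteq> carrier PSL2R" using G(1) by (auto intro: proj_carrier)
    show "proj ` G \<noteq> {}" using G(2) by blast
  qed (use G in \<open>auto simp: inv_proj proj_mult\<close>)
qed

lemma Tr_lift:
  assumes "subgroup \<Gamma> PSL2R" shows "Tr \<Gamma> = (\<lambda>A. \<bar>trace A\<bar>) ` lift \<Gamma>"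
  unfolding Tr_def by (subst proj_lift[OF assms]) (simp add: image_image tr_proj trace_2x2)

lemma conj_set_trace:
  assumes "det g = 1" shows "trace (g ** A ** adj2 g) = trace A"
proof -
  have "trace (g ** A ** adj2 g) = trace (adj2 g ** (g ** A))" by (rule trace_mul_sym)
  also have "adj2 g ** (g ** A) = A" using adj2_mult(1)[OF assms] by (simp add: matrix_mul_assoc)
  finally show ?thesis .
qed

lemma adj2_mult_distrib: "adj2 (A ** B) = adj2 B ** adj2 A"
  by (simp add: eq_2x2_iff mult_2x2 algebra_simps)

lemma adj2_adj2 [simp]: "adj2 (adj2 A) = A" by (simp add: eq_2x2_iff)

lemma conj_mult:
  assumes "det g = 1" shows "(g ** A ** adj2 g) ** (g ** B ** adj2 g) = g ** (A ** B) ** adj2 g"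
proof -
  have "(g ** A ** adj2 g) ** (g ** B ** adj2 g) = g ** A ** (adj2 g ** g) ** B ** adj2 g"
    by (simp only: matrix_mul_assoc)
  then show ?thesis using adj2_mult(1)[OF assms] by (simp add: matrix_mul_assoc)
qed

lemma conj_inverse:
  assumes "det g = 1"
  shows "adj2 g ** (g ** A ** adj2 g) ** g = A" "g ** (adj2 g ** A ** g) ** adj2 g = A"
proof -
  have "adj2 g ** (g ** A ** adj2 g) ** g = (adj2 g ** g) ** A ** (adj2 g ** g)" by (simp only: matrix_mul_assoc)
  then show "adj2 g ** (g ** A ** adj2 g) ** g = A" using adj2_mult(1)[OF assms] by simp
  have "g ** (adj2 g ** A ** g) ** adj2 g = (g ** adj2 g) ** A ** (g ** adj2 g)" by (simp only: matrix_mul_assoc)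
  then show "g ** (adj2 g ** A ** g) ** adj2 g = A" using adj2_mult(2)[OF assms] by simp
qed

lemma conj_set_comp:
  "conj_set (g ** h) G = conj_set g (conj_set h G)"
  by (simp add: conj_set_def image_image adj2_mult_distrib matrix_mul_assoc)

lemma conj_set_mem_iff:
  assumes "det g = 1" shows "A \<in> conj_set g G \<longleftrightarrow> adj2 g ** A ** g \<in> G"
proof
  assume "A \<in> conj_set g G"
  then obtain C where "C \<in> G" "A = g ** C ** adj2 g" by (auto simp: conj_set_def)
  then show "adj2 g ** A ** g \<in> G" by (simp add: conj_inverse(1)[OF assms])
next
  assume "adj2 g ** A ** g \<in> G"
  then show "A \<in> conj_set g G" unfolding conj_set_def
    by (rule image_eqI[rotated]) (simp add: conj_inverse(2)[OF assms])
qed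

lemma conj_set_trace_image:
  assumes "det g = 1" shows "trace ` conj_set g G = trace ` G"
  by (simp add: conj_set_def image_image conj_set_trace[OF assms])

lemma conj_set_group:
  assumes g: "det g = 1" and G: "sl2_group G" shows "sl2_group (conj_set g G)"
  unfolding sl2_group_def
proof (intro conjI ballI)
  show "mat 1 \<in> conj_set g G" using adj2_mult[OF g] sl2_one[OF G] by (simp add: conj_set_mem_iff[OF g])
  fix A assume "A \<in> conj_set g G"
  then obtain A' where A: "A' \<in> G" "A = g ** A' ** adj2 g" by (auto simp: conj_set_def)
  show "det A = 1" using A g sl2_det[OF G] by (simp add: det_mul)
  show "adj2 A \<in> conj_set g G"
    unfolding A(2) conj_set_def using sl2_adj2[OF G A(1)]
    by (intro image_eqI[of _ _ "adj2 A'"]) (simp_all add: adj2_mult_distrib matrix_mul_assoc)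
  show "- A \<in> conj_set g G"
    unfolding A(2) conj_set_def using sl2_minus[OF G A(1)]
    by (intro image_eqI[of _ _ "- A'"]) (simp_all add: uminus_matrix_mult)
  fix B assume "B \<in> conj_set g G"
  then obtain B' where B: "B' \<in> G" "B = g ** B' ** adj2 g" by (auto simp: conj_set_def)
  show "A ** B \<in> conj_set g G"
    unfolding A(2) B(2) conj_mult[OF g] conj_set_def using sl2_mult[OF G A(1) B(1)] by blast
qed

lemma conj_mpow:
  assumes "det g = 1" shows "mpow (g ** A ** adj2 g) n = g ** mpow A n ** adj2 g"
proof (induction n)
  case 0 show ?case using adj2_mult(2)[OF assms] by simp
next
  case (Suc n) then show ?case using conj_mult[OF assms] by simp
qed

text \<open>Move the fixed point to infinity and rescale. Only the sign of the translation is invariant under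
  conjugation in \<open>SL(2,\<real>)\<close>.\<close>
lemma conj_to_shear:
  assumes A: "det A = 1" "trace A = 2" "A \<noteq> mat 1"
  shows "\<exists>g. det g = 1 \<and> (g ** A ** adj2 g = shear 1 \<or> g ** A ** adj2 g = shear (-1))"
proof -
  have scale: "\<exists>g. det g = 1 \<and> (g ** shear b ** adj2 g = shear 1 \<or> g ** shear b ** adj2 g = shear (-1))" if b: "b \<noteq> 0" for b
  proof -
    define s where "s = 1 / sqrt \<bar>b\<bar>"
    have s: "s \<noteq> 0" "s * s * \<bar>b\<bar> = 1" using b by (simp_all add: s_def)
    define g :: "real^2^2" where "g = vector [vector [s, 0], vector [0, 1/s]]"
    have g: "g$1$1 = s" "g$1$2 = 0" "g$2$1 = 0" "g$2$2 = 1/s" by (simp_all add: g_def)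
    have "g ** shear b ** adj2 g = shear (s * s * b)" using s by (simp add: eq_2x2_iff mult_2x2 g)
    moreover have "s * s * b = 1 \<or> s * s * b = -1" using s(2) by (auto simp: abs_if split: if_splits)
    moreover have "det g = 1" using s by (simp add: det_2x2 g)
    ultimately show ?thesis by auto
  qed
  have tr: "A$2$2 = 2 - A$1$1" using A(2) by (simp add: trace_2x2)
  have sq: "(A$1$1 - 1) * (A$1$1 - 1) = - (A$1$2 * A$2$1)"
    using A(1) by (simp add: det_2x2 tr algebra_simps)
  show ?thesis
  proof (cases "A$2$1 = 0")
    case True
    then have "A$1$1 = 1" using sq by simp
    then have "A = shear (A$1$2)" using True tr by (simp add: eq_2x2_iff)
    moreover have "A$1$2 \<noteq> 0" using calculation A(3) shear_0 by metis
    ultimately show ?thesis using scale by metis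
  next
    case False
    define x where "x = (A$1$1 - 1) / A$2$1"
    define k :: "real^2^2" where "k = vector [vector [0, -1], vector [1, -x]]"
    have k: "k$1$1 = 0" "k$1$2 = -1" "k$2$1 = 1" "k$2$2 = -x" by (simp_all add: k_def)
    have dk: "det k = 1" by (simp add: det_2x2 k)
    have a: "A$1$1 = 1 + x * A$2$1" using False by (simp add: x_def)
    have "A$2$1 * (A$1$2 + x * x * A$2$1) = 0" using sq unfolding a by (simp add: algebra_simps)
    then have b: "A$1$2 = - x * x * A$2$1" using False by (simp add: add_eq_0_iff)
    have kA: "k ** A ** adj2 k = shear (- (A$2$1))"
      unfolding eq_2x2_iff mult_2x2 adj2_nth shear_nth k tr b a by (simp add: algebra_simps)
    obtain g where g: "det g = 1" "g ** shear (- (A$2$1)) ** adj2 g = shear 1 \<or> g ** shear (- (A$2$1)) ** adj2 g = shear (-1)"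
      using scale[of "- (A$2$1)"] False by auto
    have "(g ** k) ** A ** adj2 (g ** k) = g ** shear (- (A$2$1)) ** adj2 g"
      unfolding kA[symmetric] by (simp add: adj2_mult_distrib matrix_mul_assoc)
    then show ?thesis using g dk by (intro exI[of _ "g ** k"]) (simp add: det_mul)
  qed
qed

lemma conj_contains_shear:
  assumes G: "sl2_group G" and A: "A \<in> G" "trace A = 2" "A \<noteq> mat 1"
  shows "\<exists>g. det g = 1 \<and> shear 1 \<in> conj_set g G"
proof -
  obtain g where g: "det g = 1" "g ** A ** adj2 g = shear 1 \<or> g ** A ** adj2 g = shear (-1)"
    using conj_to_shear[OF sl2_det[OF G A(1)] A(2,3)] by blast
  have "g ** A ** adj2 g \<in> conj_set g G" using A(1) by (simp add: conj_set_def)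
  then have "shear 1 \<in> conj_set g G \<or> shear (-1) \<in> conj_set g G" using g(2) by auto
  then have "shear 1 \<in> conj_set g G" using sl2_adj2[OF conj_set_group[OF g(1) G], of "shear (-1)"] by (auto simp: adj2_shear)
  then show ?thesis using g by blast
qed

lemma parabolic_lift:
  assumes \<Gamma>: "subgroup \<Gamma> PSL2R" and T: "T \<in> \<Gamma>" "parabolic T"
  shows "\<exists>A\<in>lift \<Gamma>. trace A = 2 \<and> A \<noteq> mat 1"
proof -
  obtain A where A: "A \<in> lift \<Gamma>" "T = proj A" using T(1) proj_lift[OF \<Gamma>] by blast
  have "\<bar>trace A\<bar> = 2" using T(2) by (simp add: parabolic_def A(2) tr_proj trace_2x2)
  have "A \<noteq> mat 1" "A \<noteq> - mat 1" using T(2) by (auto simp: parabolic_def A(2) one_PSL2R proj_eq_iff)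
  then have ne: "A \<noteq> mat 1" "- A \<noteq> mat 1" by (auto simp: minus_equation_iff[of A])
  have tm: "trace (- A) = - trace A" by (simp add: trace_2x2)
  show ?thesis
  proof (cases "trace A = 2")
    case False
    then have "trace (- A) = 2" using \<open>\<bar>trace A\<bar> = 2\<close> tm by linarith
    then show ?thesis using ne sl2_minus[OF lift_group[OF \<Gamma>] A(1)] by blast
  qed (use A ne in blast)
qed

lemma lift_covers:
  assumes \<Gamma>: "subgroup \<Gamma> PSL2R" and co: "cofinite_area \<Gamma>"
  shows "\<exists>D. covers (lift \<Gamma>) D"
proof -
  obtain D where D: "fundamental_set \<Gamma> D" "emeasure hyperbolic_area D < \<infinity>" using co by (auto simp: cofinite_area_def)
  have "\<exists>A\<in>lift \<Gamma>. \<exists>w\<in>D. z = frac_lin A w" if z: "z \<in> upper_half_plane" for z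
  proof -
    obtain w T where w: "w \<in> D" "T \<in> \<Gamma>" "w = act T z" using D(1) z unfolding fundamental_set_def by blast
    obtain A where A: "A \<in> lift \<Gamma>" "T = proj A" using w(2) proj_lift[OF \<Gamma>] by blast
    have "w = frac_lin A z" using w(3) A(2) by (simp add: act_proj)
    then have "z = frac_lin (adj2 A) w"
      using A(1) z by (simp add: lift_def upper_half_plane_def frac_lin_adj2)
    then show ?thesis using sl2_adj2[OF lift_group[OF \<Gamma>] A(1)] w(1) by blast
  qed
  then show ?thesis using D unfolding covers_def fundamental_set_def by blast
qed

lemma conj_covers:
  assumes g: "det g = 1" and G: "sl2_group G" and D: "covers G D"
  shows "covers (conj_set g G) (frac_lin g ` D)"
proof -
  have D': "D \<in> sets borel" "D \<subseteq> upper_half_plane" "emeasure hyperbolic_area D < \<infinity>"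
    "\<And>z. z \<in> upper_half_plane \<Longrightarrow> \<exists>A\<in>G. \<exists>w\<in>D. z = frac_lin A w"
    using D by (auto simp: covers_def)
  have "\<exists>A\<in>conj_set g G. \<exists>w\<in>frac_lin g ` D. z = frac_lin A w" if z: "z \<in> upper_half_plane" for z
  proof -
    have iz: "Im z > 0" using z by (simp add: upper_half_plane_def)
    have "frac_lin (adj2 g) z \<in> upper_half_plane" using g iz by (simp add: upper_half_plane_def Im_frac_lin_pos)
    then obtain A w where A: "A \<in> G" "w \<in> D" "frac_lin (adj2 g) z = frac_lin A w" using D'(4) by blast
    have iw: "Im w > 0" using A D'(2) by (auto simp: upper_half_plane_def)
    have dA: "det A = 1" using sl2_det[OF G A(1)] .
    have "z = frac_lin g (frac_lin A w)" using frac_lin_adj2(2)[OF g iz] A(3) by simp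
    also have "\<dots> = frac_lin (g ** A) w" using g dA iw by (rule frac_lin_mult)
    also have "g ** A = g ** A ** adj2 g ** g" using adj2_mult(1)[OF g] by (simp add: matrix_mul_assoc[symmetric])
    also have "frac_lin (g ** A ** adj2 g ** g) w = frac_lin (g ** A ** adj2 g) (frac_lin g w)"
      using g dA iw by (intro frac_lin_mult[symmetric]) (simp_all add: det_mul)
    finally show ?thesis using A unfolding conj_set_def by blast
  qed
  moreover have "frac_lin g ` D \<subseteq> upper_half_plane" using D'(2) Im_frac_lin_pos[OF g] by (auto simp: upper_half_plane_def)
  ultimately show ?thesis
    unfolding covers_def using frac_lin_image_borel[OF g D'(2,1)] hyperbolic_area_frac_lin[OF g D'(1-3)] D'(3) by simp
qed

lemma fuchsian_discrete:
  assumes "fuchsian \<Gamma>"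
  shows "\<exists>e>0. \<forall>A\<in>lift \<Gamma>. dist A (mat 1) < e \<longrightarrow> A = mat 1 \<or> A = - mat 1"
proof -
  have sub: "subgroup \<Gamma> PSL2R" and disc: "subtopology PSL2R_topology \<Gamma> = discrete_topology \<Gamma>"
    using assms by (auto simp: fuchsian_def)
  have "\<one>\<^bsub>PSL2R\<^esub> \<in> \<Gamma>" by (rule subgroup.one_closed[OF sub])
  then have "openin (subtopology PSL2R_topology \<Gamma>) {\<one>\<^bsub>PSL2R\<^esub>}" unfolding disc by simp
  then obtain V where V: "openin PSL2R_topology V" "{\<one>\<^bsub>PSL2R\<^esub>} = V \<inter> \<Gamma>" unfolding openin_subtopology by blast
  then have op: "openin (top_of_set (carrier SL2R)) {A \<in> carrier SL2R. proj A \<in> V}" by (simp add: openin_PSL2R_topology)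
  have "mat 1 \<in> {A \<in> carrier SL2R. proj A \<in> V}" using V(2) by (auto simp: carrier_SL2R one_PSL2R)
  then obtain e where e: "e > 0" "ball (mat 1) e \<inter> carrier SL2R \<subseteq> {A \<in> carrier SL2R. proj A \<in> V}"
    using op unfolding openin_contains_ball by blast
  have "A = mat 1 \<or> A = - mat 1" if A: "A \<in> lift \<Gamma>" "dist A (mat 1) < e" for A
  proof -
    have "A \<in> ball (mat 1) e \<inter> carrier SL2R" using A by (auto simp: lift_def carrier_SL2R dist_commute)
    then have "proj A \<in> V \<inter> \<Gamma>" using e(2) A(1) by (auto simp: lift_def)
    then have "proj A = proj (mat 1)" using V(2) by (auto simp: one_PSL2R)
    then show ?thesis by (simp add: proj_eq_iff)
  qed
  then show ?thesis using e(1) by blast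
qed

text \<open>Close to the identity the preimage contains at most \<open>1\<close> and \<open>-1\<close>, and conjugation changes
  distances of shears from the identity by a bounded factor.\<close>
lemma conj_shear_discrete:
  assumes \<Gamma>: "fuchsian \<Gamma>" and g: "det g = 1"
  shows "\<exists>e>0. \<forall>x. shear x \<in> conj_set g (lift \<Gamma>) \<and> \<bar>x\<bar> < e \<longrightarrow> x = 0"
proof -
  obtain e where e: "e > 0" "\<And>A. A \<in> lift \<Gamma> \<Longrightarrow> dist A (mat 1) < e \<Longrightarrow> A = mat 1 \<or> A = - mat 1"
    using fuchsian_discrete[OF \<Gamma>] by blast
  define N where "N = adj2 g ** (shear 1 - mat 1) ** g"
  have lin: "adj2 g ** shear x ** g = mat 1 + x *\<^sub>R N" for x
    using adj2_mult(1)[OF g] unfolding N_def by (simp add: eq_2x2_iff mult_2x2 algebra_simps)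
  have "x = 0" if x: "shear x \<in> conj_set g (lift \<Gamma>)" "\<bar>x\<bar> < e / (norm N + 1)" for x
  proof -
    have pos: "norm N + 1 > 0" by (simp add: add_nonneg_pos)
    have "adj2 g ** shear x ** g \<in> lift \<Gamma>" using x(1) by (simp add: conj_set_mem_iff[OF g])
    moreover have "dist (adj2 g ** shear x ** g) (mat 1) < e"
    proof -
      have "dist (adj2 g ** shear x ** g) (mat 1) = \<bar>x\<bar> * norm N" unfolding lin by (simp add: dist_norm)
      also have "\<dots> \<le> \<bar>x\<bar> * (norm N + 1)" by (intro mult_left_mono) auto
      also have "\<dots> < e" using x(2) pos by (simp add: less_divide_eq)
      finally show ?thesis .
    qed
    ultimately have "adj2 g ** shear x ** g = mat 1 \<or> adj2 g ** shear x ** g = - mat 1" by (rule e(2))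
    then have "g ** (adj2 g ** shear x ** g) ** adj2 g = mat 1 \<or> g ** (adj2 g ** shear x ** g) ** adj2 g = - mat 1"
      using adj2_mult(2)[OF g] by (auto simp: uminus_matrix_mult)
    then have "shear x = mat 1 \<or> shear x = - mat 1" by (simp only: conj_inverse[OF g])
    then show "x = 0" by (auto simp: eq_2x2_iff)
  qed
  then show ?thesis using e(1) by (intro exI[of _ "e / (norm N + 1)"]) (auto intro!: divide_pos_pos add_nonneg_pos)
qed

lemma finite_image_coarser:
  assumes "finite (f ` L)" "\<And>x y. x \<in> L \<Longrightarrow> y \<in> L \<Longrightarrow> f x = f y \<Longrightarrow> h x = h y"
  shows "finite (h ` L)"
proof -
  have "h ` L \<subseteq> (\<lambda>k. h (SOME x. x \<in> L \<and> f x = k)) ` (f ` L)"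
  proof
    fix z assume "z \<in> h ` L"
    then obtain x where x: "x \<in> L" "z = h x" by blast
    have "(SOME y. y \<in> L \<and> f y = f x) \<in> L \<and> f (SOME y. y \<in> L \<and> f y = f x) = f x"
      by (rule someI[of _ x]) (simp add: x)
    then have "h (SOME y. y \<in> L \<and> f y = f x) = z" unfolding x(2) using assms(2) x(1) by blast
    then show "z \<in> (\<lambda>k. h (SOME x. x \<in> L \<and> f x = k)) ` (f ` L)" using x(1) by blast
  qed
  then show ?thesis using assms(1) finite_surj by blast
qed

text \<open>Finite index is exhibited by a key with finitely many values that separates cosets.\<close>
lemma finite_rcosets:
  assumes I: "subgroup I PSL2R" and L: "\<And>A. A \<in> L \<Longrightarrow> det A = 1"
    and f: "finite (f ` L)" "\<And>x y. x \<in> L \<Longrightarrow> y \<in> L \<Longrightarrow> f x = f y \<Longrightarrow> proj (y ** adj2 x) \<in> I"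
  shows "finite (rcosets\<^bsub>PSL2R\<lparr>carrier := proj ` L\<rparr>\<^esub> I)"
proof -
  interpret group PSL2R by (rule group_PSL2R)
  have "finite ((\<lambda>x. I #>\<^bsub>PSL2R\<^esub> proj x) ` L)"
  proof (rule finite_image_coarser[OF f(1)])
    fix x y assume xy: "x \<in> L" "y \<in> L" "f x = f y"
    have d: "det x = 1" "det y = 1" using xy L by auto
    have "proj y = proj (y ** adj2 x) \<otimes>\<^bsub>PSL2R\<^esub> proj x"
      using d adj2_mult(1)[OF d(1)] by (simp add: proj_mult det_mul matrix_mul_assoc[symmetric])
    then have "proj y \<in> I #>\<^bsub>PSL2R\<^esub> proj x" using f(2)[OF xy] unfolding r_coset_def by blast
    then show "I #>\<^bsub>PSL2R\<^esub> proj x = I #>\<^bsub>PSL2R\<^esub> proj y"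
      using d I by (intro repr_independence proj_carrier)
  qed
  moreover have "rcosets\<^bsub>PSL2R\<lparr>carrier := proj ` L\<rparr>\<^esub> I = (\<lambda>x. I #>\<^bsub>PSL2R\<^esub> proj x) ` L"
    by (auto simp: RCOSETS_def r_coset_def)
  ultimately show ?thesis by simp
qed

lemma bounded_clustering_growth:
  assumes "bounded_clustering ((\<lambda>x. \<bar>x\<bar>) ` T)"
  shows "\<exists>B. linear_growth T B"
proof -
  let ?S = "(\<lambda>x. \<bar>x\<bar>) ` T"
  obtain B :: nat where B: "\<And>n::int. finite (?S \<inter> {of_int n..of_int n + 1})" "\<And>n::int. card (?S \<inter> {of_int n..of_int n + 1}) < B"
    using assms unfolding bounded_clustering_def by blast
  define W where "W n = ?S \<inter> {of_int (int n)..of_int (int n) + 1}" for n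
  have W: "finite (W n)" "card (W n) \<le> B" for n using B[of "int n"] unfolding W_def by auto
  have "finite (T \<inter> {- real L..real L}) \<and> real (card (T \<inter> {- real L..real L})) \<le> (2 * B) * L + 2 * B" for L :: nat
  proof -
    have sub: "T \<inter> {- real L..real L} \<subseteq> (\<Union>n\<in>{..L}. W n \<union> uminus ` W n)"
    proof
      fix x assume x: "x \<in> T \<inter> {- real L..real L}"
      define n where "n = nat \<lfloor>\<bar>x\<bar>\<rfloor>"
      have n: "real n \<le> \<bar>x\<bar>" "\<bar>x\<bar> \<le> real n + 1" unfolding n_def by linarith+
      have "\<bar>x\<bar> \<le> real L" using x by (simp add: abs_le_iff)
      then have "n \<le> L" using n(1) by (metis of_nat_le_iff order_trans)
      moreover have "\<bar>x\<bar> \<in> W n" using x n unfolding W_def by auto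
      then have "x \<in> W n \<union> uminus ` W n" by (cases "x \<ge> 0") (auto simp: abs_if image_iff intro!: bexI[of _ "- x"])
      ultimately show "x \<in> (\<Union>n\<in>{..L}. W n \<union> uminus ` W n)" by blast
    qed
    have fin: "finite (\<Union>n\<in>{..L}. W n \<union> uminus ` W n)" using W by auto
    have "card (T \<inter> {- real L..real L}) \<le> card (\<Union>n\<in>{..L}. W n \<union> uminus ` W n)" by (rule card_mono[OF fin sub])
    also have "\<dots> \<le> (\<Sum>n\<in>{..L}. card (W n \<union> uminus ` W n))" by (rule card_UN_le) simp
    also have "\<dots> \<le> (\<Sum>n\<in>{..L}. 2 * B)"
    proof (rule sum_mono)
      fix n
      have "card (W n \<union> uminus ` W n) \<le> card (W n) + card (uminus ` W n)" by (rule card_Un_le)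
      also have "\<dots> \<le> 2 * B" using W(2)[of n] card_image_le[OF W(1), of uminus n] by linarith
      finally show "card (W n \<union> uminus ` W n) \<le> 2 * B" .
    qed
    also have "\<dots> = 2 * B * L + 2 * B" by (simp add: algebra_simps)
    finally have "real (card (T \<inter> {- real L..real L})) \<le> real (2 * B * L + 2 * B)" by (simp only: of_nat_le_iff)
    then show ?thesis using finite_subset[OF sub fin] by simp
  qed
  then have "linear_growth T (2 * B)" unfolding linear_growth_def by simp
  then show ?thesis by blast
qed

text \<open>Both finite index statements behind commensurability with a conjugate of the modular group,
  in terms of matrices: \<open>f\<close> separates the cosets in \<open>\<Gamma>\<close>, and \<open>R\<close> represents those in the modular group.\<close>
theorem bounded_clustering_integral_cosets:
  assumes \<Gamma>: "fuchsian \<Gamma>" and co: "cofinite_area \<Gamma>" and par: "\<exists>T\<in>\<Gamma>. parabolic T"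
    and bc: "bounded_clustering (Tr \<Gamma>)"
  shows "\<exists>k f (R :: (real^2^2) set). det k = 1 \<and>
     finite ((f :: real^2^2 \<Rightarrow> nat \<times> int \<times> int \<times> int \<times> int) ` lift \<Gamma>) \<and>
     (\<forall>x\<in>lift \<Gamma>. \<forall>y\<in>lift \<Gamma>. f x = f y \<longrightarrow> y ** adj2 x \<in> conj_set (adj2 k) SL2Z) \<and>
     finite R \<and> (\<forall>x\<in>SL2Z. \<exists>r\<in>R. det r = 1 \<and> x ** adj2 r \<in> conj_set k (lift \<Gamma>))"
proof -
  have sub: "subgroup \<Gamma> PSL2R" using \<Gamma> by (simp add: fuchsian_def)
  have LG: "sl2_group (lift \<Gamma>)" by (rule lift_group[OF sub])
  obtain A where A: "A \<in> lift \<Gamma>" "trace A = 2" "A \<noteq> mat 1" using par parabolic_lift[OF sub] by blast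
  obtain g where g: "det g = 1" "shear 1 \<in> conj_set g (lift \<Gamma>)" using conj_contains_shear[OF LG A] by blast
  obtain D where D: "covers (lift \<Gamma>) D" using lift_covers[OF sub co] by blast
  obtain B where B: "linear_growth (trace ` lift \<Gamma>) B"
    using bounded_clustering_growth[of "trace ` lift \<Gamma>"] bc by (auto simp: Tr_lift[OF sub] image_image)
  interpret C: cusped_growth "conj_set g (lift \<Gamma>)" B
    by unfold_locales (use conj_set_group[OF g(1) LG] g B in \<open>simp_all add: conj_set_trace_image\<close>)
  obtain g0 where g0: "g0 \<in> conj_set g (lift \<Gamma>)" "g0$2$1 \<noteq> 0"
    using exists_lower_left_nonzero[OF C.G g(2) conj_covers[OF g(1) LG D] conj_shear_discrete[OF \<Gamma> g(1)]] by blast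
  \<comment> \<open>translate the cusp of \<open>g0\<close> to the origin, so that differences of cusps become cusps\<close>
  define x where "x = - (g0$1$1) / g0$2$1"
  define k where "k = shear x ** g"
  have k: "det k = 1" by (simp add: k_def det_mul g)
  have kset: "conj_set k (lift \<Gamma>) = conj_set (shear x) (conj_set g (lift \<Gamma>))" unfolding k_def by (rule conj_set_comp)
  have entries: "(shear x ** M ** adj2 (shear x))$1$1 = M$1$1 + x * M$2$1" "(shear x ** M ** adj2 (shear x))$2$1 = M$2$1"
    "(shear x ** M ** adj2 (shear x))$2$2 = M$2$2 - x * M$2$1" for M by (simp_all add: mult_2x2)
  have shk: "shear 1 \<in> conj_set k (lift \<Gamma>)"
  proof -
    have "shear x ** shear 1 ** adj2 (shear x) = shear 1" by (simp add: adj2_shear shear_add)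
    then show ?thesis unfolding kset using g(2) unfolding conj_set_def[of "shear x"] by (metis image_eqI)
  qed
  interpret K: cusped_growth "conj_set k (lift \<Gamma>)" B
    by unfold_locales (use conj_set_group[OF k LG] shk B in \<open>simp_all add: conj_set_trace_image k\<close>)
  have cusps: "A$1$1 / A$2$1 \<in> \<rat> \<and> A$2$2 / A$2$1 \<in> \<rat>" if A: "A \<in> conj_set k (lift \<Gamma>)" "A$2$1 \<noteq> 0" for A
  proof -
    obtain M where M: "M \<in> conj_set g (lift \<Gamma>)" "A = shear x ** M ** adj2 (shear x)" using A(1) unfolding kset conj_set_def[of "shear x"] by blast
    have M0: "M$2$1 \<noteq> 0" using A(2) by (simp add: M(2) entries)
    have 1: "A$1$1 / A$2$1 = M$1$1 / M$2$1 + x" "A$2$2 / A$2$1 = M$2$2 / M$2$1 - x"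
      using M0 by (simp_all add: M(2) entries add_divide_distrib diff_divide_distrib)
    have r1: "g0$1$1 / g0$2$1 + M$2$2 / M$2$1 \<in> \<rat>" by (rule C.cusp_difference_rational[OF M(1) M0 g0])
    have r2: "M$1$1 / M$2$1 + g0$2$2 / g0$2$1 \<in> \<rat>" by (rule C.cusp_difference_rational[OF g0 M(1) M0])
    have r3: "g0$1$1 / g0$2$1 + g0$2$2 / g0$2$1 \<in> \<rat>" by (rule C.cusp_difference_rational[OF g0 g0])
    have "M$1$1 / M$2$1 + x = (M$1$1 / M$2$1 + g0$2$2 / g0$2$1) - (g0$1$1 / g0$2$1 + g0$2$2 / g0$2$1)"
      "M$2$2 / M$2$1 - x = g0$1$1 / g0$2$1 + M$2$2 / M$2$1" by (simp_all add: x_def)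
    then show ?thesis unfolding 1 using r1 r2 r3 by (simp only: Rats_diff)
  qed
  define h0 where "h0 = shear x ** g0 ** adj2 (shear x)"
  have h0: "h0 \<in> conj_set k (lift \<Gamma>)" "h0$2$1 \<noteq> 0"
    unfolding kset conj_set_def[of "shear x"] h0_def entries using g0 by blast+
  obtain f :: "real^2^2 \<Rightarrow> nat \<times> int \<times> int \<times> int \<times> int" where f: "finite (f ` conj_set k (lift \<Gamma>))"
    "\<And>x y. x \<in> conj_set k (lift \<Gamma>) \<Longrightarrow> y \<in> conj_set k (lift \<Gamma>) \<Longrightarrow> f x = f y \<Longrightarrow> y ** adj2 x \<in> SL2Z"
    using K.commensurable_with_integral_matrices[OF cusps h0] by blast
  define H where "H = conj_set k (lift \<Gamma>) \<inter> SL2Z"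
  have HG: "sl2_group H" unfolding H_def sl2_group_def
    using K.in_det K.in_one K.in_mult K.in_adj2 K.in_minus sl2_one[OF SL2Z_group] sl2_mult[OF SL2Z_group]
      sl2_adj2[OF SL2Z_group] sl2_minus[OF SL2Z_group] by auto
  define s where "s v = (SOME y. y \<in> conj_set k (lift \<Gamma>) \<and> f y = v)" for v
  have s: "s (f y) \<in> conj_set k (lift \<Gamma>) \<and> f (s (f y)) = f y" if "y \<in> conj_set k (lift \<Gamma>)" for y
    unfolding s_def by (rule someI[of _ y]) (simp add: that)
  have "covers H (\<Union>r\<in>s ` f ` conj_set k (lift \<Gamma>). frac_lin r ` frac_lin k ` D)"
  proof (rule covers_finite_index[OF K.G conj_covers[OF k LG D]])
    show "finite (s ` f ` conj_set k (lift \<Gamma>))" using f(1) by simp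
    show "s ` f ` conj_set k (lift \<Gamma>) \<subseteq> conj_set k (lift \<Gamma>)" using s by blast
    fix A assume A: "A \<in> conj_set k (lift \<Gamma>)"
    have "A ** adj2 (s (f A)) \<in> H"
      unfolding H_def using s[OF A] A f(2)[of "s (f A)" A] by (auto intro: K.in_mult K.in_adj2)
    then show "\<exists>r\<in>s ` f ` conj_set k (lift \<Gamma>). A ** adj2 r \<in> H" using A by blast
  qed (simp add: H_def)
  from finite_coarea_finite_index[OF _ HG this]
  obtain R where R: "finite R" "R \<subseteq> SL2Z" "\<forall>x\<in>SL2Z. \<exists>r\<in>R. x ** adj2 r \<in> H" by (auto simp: H_def)
  define f' where "f' y = f (k ** y ** adj2 k)" for y
  have "f' ` lift \<Gamma> = f ` conj_set k (lift \<Gamma>)" by (simp add: f'_def conj_set_def image_image)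
  then have f'1: "finite (f' ` lift \<Gamma>)" using f(1) by simp
  have f'2: "y ** adj2 x \<in> conj_set (adj2 k) SL2Z" if xy: "x \<in> lift \<Gamma>" "y \<in> lift \<Gamma>" "f' x = f' y" for x y
  proof -
    have "(k ** y ** adj2 k) ** adj2 (k ** x ** adj2 k) \<in> SL2Z"
      using xy by (intro f(2)) (auto simp: conj_set_def f'_def)
    also have "(k ** y ** adj2 k) ** adj2 (k ** x ** adj2 k) = k ** (y ** adj2 x) ** adj2 k"
      using conj_mult[OF k, of y "adj2 x"] by (simp add: adj2_mult_distrib matrix_mul_assoc)
    finally show ?thesis using conj_set_mem_iff[of "adj2 k" "y ** adj2 x" SL2Z] k by simp
  qed
  have R': "\<exists>r\<in>R. det r = 1 \<and> x ** adj2 r \<in> conj_set k (lift \<Gamma>)" if "x \<in> SL2Z" for x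
    using R(2,3) that sl2_det[OF SL2Z_group] unfolding H_def by blast
  show ?thesis using k f'1 f'2 R(1) R' by blast
qed

section \<open>Embeddings of real number fields\<close>

text \<open>Subfields of \<open>\<real>\<close> in terms of the type class operations.\<close>
definition field_set :: "real set \<Rightarrow> bool" where
  "field_set K \<longleftrightarrow> 1 \<in> K \<and> (\<forall>x\<in>K. \<forall>y\<in>K. x + y \<in> K \<and> x * y \<in> K) \<and> (\<forall>x\<in>K. - x \<in> K \<and> inverse x \<in> K)"

definition embeds :: "real set \<Rightarrow> (real \<Rightarrow> complex) \<Rightarrow> bool" where
  "embeds K \<phi> \<longleftrightarrow> \<phi> 1 = 1 \<and> (\<forall>x\<in>K. \<forall>y\<in>K. \<phi> (x + y) = \<phi> x + \<phi> y \<and> \<phi> (x * y) = \<phi> x * \<phi> y)"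

definition poly_over :: "real set \<Rightarrow> real poly \<Rightarrow> bool" where
  "poly_over K p \<longleftrightarrow> (\<forall>i. Polynomial.coeff p i \<in> K)"

lemma field_setD:
  assumes "field_set K"
  shows "1 \<in> K" "0 \<in> K" "\<And>x y. x \<in> K \<Longrightarrow> y \<in> K \<Longrightarrow> x + y \<in> K" "\<And>x y. x \<in> K \<Longrightarrow> y \<in> K \<Longrightarrow> x * y \<in> K"
    "\<And>x. x \<in> K \<Longrightarrow> - x \<in> K" "\<And>x y. x \<in> K \<Longrightarrow> y \<in> K \<Longrightarrow> x - y \<in> K" "\<And>x. x \<in> K \<Longrightarrow> inverse x \<in> K"
    "\<And>x y. x \<in> K \<Longrightarrow> y \<in> K \<Longrightarrow> x / y \<in> K"
proof -
  show 1: "1 \<in> K" "\<And>x y. x \<in> K \<Longrightarrow> y \<in> K \<Longrightarrow> x + y \<in> K" "\<And>x y. x \<in> K \<Longrightarrow> y \<in> K \<Longrightarrow> x * y \<in> K"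
    "\<And>x. x \<in> K \<Longrightarrow> - x \<in> K" "\<And>x. x \<in> K \<Longrightarrow> inverse x \<in> K"
    using assms by (auto simp: field_set_def)
  show "0 \<in> K" using 1(2)[OF 1(1) 1(4)[OF 1(1)]] by simp
  show "x - y \<in> K" if "x \<in> K" "y \<in> K" for x y using 1(2)[OF that(1) 1(4)[OF that(2)]] by simp
  show "x / y \<in> K" if "x \<in> K" "y \<in> K" for x y using 1(3)[OF that(1) 1(5)[OF that(2)]] by (simp add: field_class.field_divide_inverse)
qed

lemma field_set_sum: "field_set K \<Longrightarrow> (\<And>i. i \<in> I \<Longrightarrow> f i \<in> K) \<Longrightarrow> sum f I \<in> K"
  by (induction I rule: infinite_finite_induct) (auto intro: field_setD)

lemma embedsD:
  assumes "field_set K" "embeds K \<phi>"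
  shows "\<phi> 1 = 1" "\<phi> 0 = 0" "\<And>x y. x \<in> K \<Longrightarrow> y \<in> K \<Longrightarrow> \<phi> (x + y) = \<phi> x + \<phi> y"
    "\<And>x y. x \<in> K \<Longrightarrow> y \<in> K \<Longrightarrow> \<phi> (x * y) = \<phi> x * \<phi> y" "\<And>x. x \<in> K \<Longrightarrow> \<phi> (- x) = - \<phi> x"
    "\<And>x. x \<in> K \<Longrightarrow> \<phi> x = 0 \<Longrightarrow> x = 0"
proof -
  note K = field_setD[OF assms(1)]
  show 1: "\<phi> 1 = 1" "\<And>x y. x \<in> K \<Longrightarrow> y \<in> K \<Longrightarrow> \<phi> (x + y) = \<phi> x + \<phi> y" "\<And>x y. x \<in> K \<Longrightarrow> y \<in> K \<Longrightarrow> \<phi> (x * y) = \<phi> x * \<phi> y"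
    using assms(2) by (auto simp: embeds_def)
  show z: "\<phi> 0 = 0" using 1(2)[OF K(2,2)] by simp
  show "\<phi> (- x) = - \<phi> x" if "x \<in> K" for x
    using 1(2)[OF that K(5)[OF that]] z by (simp add: add_eq_0_iff)
  show "x = 0" if x: "x \<in> K" "\<phi> x = 0" for x
  proof (rule ccontr)
    assume "x \<noteq> 0"
    then have "\<phi> (x * inverse x) = 1" using 1(1) by simp
    then show False using 1(3)[OF x(1) K(7)[OF x(1)]] x(2) by simp
  qed
qed

lemma embeds_sum:
  assumes "field_set K" "embeds K \<phi>" "\<And>i. i \<in> I \<Longrightarrow> f i \<in> K"
  shows "\<phi> (sum f I) = (\<Sum>i\<in>I. \<phi> (f i))"
  using assms(3)
proof (induction I rule: infinite_finite_induct)
  case (insert x F)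
  have "f x \<in> K" "sum f F \<in> K" using insert.prems by (auto intro: field_set_sum[OF assms(1)])
  then have "\<phi> (f x + sum f F) = \<phi> (f x) + \<phi> (sum f F)" by (rule embedsD(3)[OF assms(1,2)])
  then show ?case using insert by simp
qed (simp_all add: embedsD(2)[OF assms(1,2)])

lemma poly_over_closed:
  assumes "field_set K"
  shows "poly_over K 0" "c \<in> K \<Longrightarrow> poly_over K [:c:]" "c \<in> K \<Longrightarrow> poly_over K (Polynomial.monom c n)"
    "poly_over K p \<Longrightarrow> poly_over K q \<Longrightarrow> poly_over K (p + q)"
    "poly_over K p \<Longrightarrow> poly_over K q \<Longrightarrow> poly_over K (p - q)"
    "poly_over K p \<Longrightarrow> poly_over K q \<Longrightarrow> poly_over K (p * q)"
    "poly_over K p \<Longrightarrow> poly_over K (- p)" "poly_over K p \<Longrightarrow> c \<in> K \<Longrightarrow> poly_over K (pCons c p)"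
proof -
  show "poly_over K (p * q)" if "poly_over K p" "poly_over K q"
    unfolding poly_over_def coeff_mult
  proof (intro allI field_set_sum[OF assms] field_setD(4)[OF assms])
    show "Polynomial.coeff p i \<in> K" "Polynomial.coeff q i \<in> K" for i using that by (auto simp: poly_over_def)
  qed
qed (use field_setD[OF assms] in \<open>auto simp: poly_over_def coeff_pCons split: nat.split\<close>)

lemma map_poly_embeds:
  assumes K: "field_set K" and \<phi>: "embeds K \<phi>" and p: "poly_over K p" and q: "poly_over K q"
  shows "map_poly \<phi> (p + q) = map_poly \<phi> p + map_poly \<phi> q" "map_poly \<phi> (p * q) = map_poly \<phi> p * map_poly \<phi> q"
proof -
  note E = embedsD[OF K \<phi>]
  have c: "Polynomial.coeff p i \<in> K" "Polynomial.coeff q i \<in> K" for i using p q by (auto simp: poly_over_def)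
  show "map_poly \<phi> (p + q) = map_poly \<phi> p + map_poly \<phi> q"
    by (rule poly_eqI) (simp add: coeff_map_poly E c)
  show "map_poly \<phi> (p * q) = map_poly \<phi> p * map_poly \<phi> q"
  proof (rule poly_eqI)
    fix n
    have "\<phi> (\<Sum>i\<le>n. Polynomial.coeff p i * Polynomial.coeff q (n - i)) = (\<Sum>i\<le>n. \<phi> (Polynomial.coeff p i * Polynomial.coeff q (n - i)))"
      by (rule embeds_sum[OF K \<phi>]) (intro field_setD(4)[OF K] c)
    also have "\<dots> = (\<Sum>i\<le>n. \<phi> (Polynomial.coeff p i) * \<phi> (Polynomial.coeff q (n - i)))" by (intro sum.cong refl E c)
    finally show "Polynomial.coeff (map_poly \<phi> (p * q)) n = Polynomial.coeff (map_poly \<phi> p * map_poly \<phi> q) n"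
      by (simp add: coeff_map_poly E coeff_mult)
  qed
qed

lemma poly_over_division:
  assumes K: "field_set K" and m: "poly_over K m" "m \<noteq> 0" and p: "poly_over K p"
  shows "\<exists>q s. poly_over K q \<and> poly_over K s \<and> p = m * q + s \<and> (s = 0 \<or> Polynomial.degree s < Polynomial.degree m)"
  using p
proof (induction "Polynomial.degree p" arbitrary: p rule: less_induct)
  case less
  note C = poly_over_closed[OF K]
  show ?case
  proof (cases "p = 0 \<or> Polynomial.degree p < Polynomial.degree m")
    case True
    then show ?thesis using less.prems C(1) by (intro exI[of _ 0] exI[of _ p]) auto
  next
    case False
    define c where "c = Polynomial.lead_coeff p / Polynomial.lead_coeff m"
    have cK: "c \<in> K" unfolding c_def using less.prems m(1) by (intro field_setD(8)[OF K]) (auto simp: poly_over_def)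
    have c0: "c \<noteq> 0" using False m(2) by (simp add: c_def)
    define t where "t = Polynomial.monom c (Polynomial.degree p - Polynomial.degree m)"
    define p' where "p' = p - m * t"
    have tK: "poly_over K t" unfolding t_def by (rule C(3)[OF cK])
    have p'K: "poly_over K p'" unfolding p'_def by (intro C(5,6) less.prems m tK)
    have dt: "Polynomial.degree t = Polynomial.degree p - Polynomial.degree m" "t \<noteq> 0" using c0 by (simp_all add: t_def degree_monom_eq)
    have dmt: "Polynomial.degree (m * t) = Polynomial.degree p" using False m(2) dt by (simp add: degree_mult_eq)
    have "Polynomial.lead_coeff (m * t) = Polynomial.lead_coeff p"
    proof -
      have "Polynomial.lead_coeff t = c" unfolding dt(1) by (simp add: t_def)
      then show ?thesis unfolding lead_coeff_mult using m(2) by (simp add: c_def)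
    qed
    then have "Polynomial.coeff p' (Polynomial.degree p) = 0" using dmt by (simp add: p'_def)
    moreover have "Polynomial.degree p' \<le> Polynomial.degree p" unfolding p'_def using dmt by (intro degree_diff_le) auto
    ultimately have dp': "p' = 0 \<or> Polynomial.degree p' < Polynomial.degree p"
      by (metis le_neq_implies_less leading_coeff_0_iff)
    have "\<exists>q s. poly_over K q \<and> poly_over K s \<and> p' = m * q + s \<and> (s = 0 \<or> Polynomial.degree s < Polynomial.degree m)"
    proof (cases "p' = 0")
      case True then show ?thesis using C(1) by (intro exI[of _ 0]) auto
    next
      case False then show ?thesis using less.hyps[OF _ p'K] dp' by auto
    qed
    then obtain q s where qs: "poly_over K q" "poly_over K s" "p' = m * q + s" "s = 0 \<or> Polynomial.degree s < Polynomial.degree m" by blast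
    have "p = m * (q + t) + s" using qs(3) by (simp add: p'_def algebra_simps)
    then show ?thesis using qs C(4)[OF qs(1) tK] by blast
  qed
qed

text \<open>An annihilating polynomial of least degree, which is unique up to a constant factor.\<close>
definition minimal_poly :: "real set \<Rightarrow> real \<Rightarrow> real poly \<Rightarrow> bool" where
  "minimal_poly K y m \<longleftrightarrow> poly_over K m \<and> m \<noteq> 0 \<and> poly m y = 0 \<and>
     (\<forall>p. poly_over K p \<and> p \<noteq> 0 \<and> poly p y = 0 \<longrightarrow> Polynomial.degree m \<le> Polynomial.degree p)"

lemma minimal_poly_exists:
  assumes "poly_over K p" "p \<noteq> 0" "poly p y = 0"
  obtains m where "minimal_poly K y m"
proof -
  let ?Q = "\<lambda>p. poly_over K p \<and> p \<noteq> 0 \<and> poly p y = 0"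
  have "?Q (arg_min Polynomial.degree ?Q) \<and> (\<forall>q. ?Q q \<longrightarrow> Polynomial.degree (arg_min Polynomial.degree ?Q) \<le> Polynomial.degree q)"
    using arg_min_nat_lemma[of ?Q p Polynomial.degree] assms by blast
  then show ?thesis using that unfolding minimal_poly_def by blast
qed

lemma minimal_poly_dvd:
  assumes K: "field_set K" and m: "minimal_poly K y m" and p: "poly_over K p" "poly p y = 0"
  shows "\<exists>q. poly_over K q \<and> p = m * q"
proof -
  obtain q s where qs: "poly_over K q" "poly_over K s" "p = m * q + s" "s = 0 \<or> Polynomial.degree s < Polynomial.degree m"
    using poly_over_division[OF K _ _ p(1), of m] m by (auto simp: minimal_poly_def)
  have "poly s y = 0" using qs(3) p(2) m by (simp add: minimal_poly_def)
  then have "s = 0" using qs(2,4) m unfolding minimal_poly_def by (metis not_le)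
  then show ?thesis using qs by auto
qed

text \<open>Among the combinations \<open>a p + b m\<close> one of least degree divides \<open>m\<close> and \<open>p\<close>. Its cofactor in \<open>m\<close>
  vanishes at \<open>y\<close>, so it is constant by minimality of \<open>m\<close>.\<close>
lemma minimal_poly_bezout:
  assumes K: "field_set K" and m: "minimal_poly K y m" and p: "poly_over K p" "poly p y \<noteq> 0"
  shows "\<exists>a. poly_over K a \<and> poly a y * poly p y = 1"
proof -
  note C = poly_over_closed[OF K]
  have mK: "poly_over K m" "m \<noteq> 0" "poly m y = 0" using m by (auto simp: minimal_poly_def)
  let ?Q = "\<lambda>u. u \<noteq> 0 \<and> (\<exists>a b. poly_over K a \<and> poly_over K b \<and> u = a * p + b * m)"
  define u where "u = arg_min Polynomial.degree ?Q"
  have one: "poly_over K 1" using C(2)[OF field_setD(1)[OF K]] by (simp add: one_pCons)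
  have "?Q m" using mK C(1) one by (intro conjI exI[of _ 0] exI[of _ 1]) auto
  then have uQ: "?Q u" and umin: "\<And>q. ?Q q \<Longrightarrow> Polynomial.degree u \<le> Polynomial.degree q"
    using arg_min_nat_lemma[of ?Q m Polynomial.degree] unfolding u_def by blast+
  obtain a b where ab: "poly_over K a" "poly_over K b" "u = a * p + b * m" using uQ by blast
  have uK: "poly_over K u" unfolding ab(3) by (intro C ab p mK)
  have div: "\<exists>w. poly_over K w \<and> v = u * w" if v: "poly_over K v" "\<exists>a b. poly_over K a \<and> poly_over K b \<and> v = a * p + b * m" for v
  proof -
    obtain q s where qs: "poly_over K q" "poly_over K s" "v = u * q + s" "s = 0 \<or> Polynomial.degree s < Polynomial.degree u"
      using poly_over_division[OF K uK _ v(1)] uQ by blast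
    obtain a' b' where ab': "poly_over K a'" "poly_over K b'" "v = a' * p + b' * m" using v(2) by blast
    have "s = (a' - a * q) * p + (b' - b * q) * m" using qs(3) unfolding ab'(3) ab(3) by (simp add: algebra_simps)
    moreover have "poly_over K (a' - a * q)" "poly_over K (b' - b * q)" by (intro C ab ab' qs)+
    ultimately have "s \<noteq> 0 \<Longrightarrow> Polynomial.degree u \<le> Polynomial.degree s" using umin[of s] by blast
    then have "s = 0" using qs(4) by (meson leD)
    then show ?thesis using qs by auto
  qed
  obtain w where w: "poly_over K w" "m = u * w"
    using div[OF mK(1)] C(1) one by (metis add.left_neutral mult.left_neutral mult_zero_left)
  obtain w' where w': "poly_over K w'" "p = u * w'"
    using div[OF p(1)] C(1) one by (metis add.right_neutral mult.left_neutral mult_zero_left)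
  have uy: "poly u y \<noteq> 0" using p(2) unfolding w'(2) by auto
  then have "poly w y = 0" using mK(3) unfolding w(2) by simp
  moreover have "w \<noteq> 0" using mK(2) w(2) by auto
  ultimately have "Polynomial.degree m \<le> Polynomial.degree w" using m w(1) by (auto simp: minimal_poly_def)
  moreover have "Polynomial.degree m = Polynomial.degree u + Polynomial.degree w" unfolding w(2) using uQ \<open>w \<noteq> 0\<close> by (intro degree_mult_eq) auto
  ultimately have "Polynomial.degree u = 0" by simp
  then obtain c where c: "u = [:c:]" by (rule degree_eq_zeroE)
  have c0: "c \<noteq> 0" using uQ c by auto
  have cK: "c \<in> K" using uK by (metis c coeff_pCons_0 poly_over_def)
  have "poly u y = poly a y * poly p y" unfolding ab(3) using mK(3) by simp
  then have "c = poly a y * poly p y" by (simp add: c)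
  then have "poly ([:inverse c:] * a) y * poly p y = 1" using c0 by (simp add: field_simps)
  then show ?thesis using C(6)[OF C(2)[OF field_setD(7)[OF K cK]] ab(1)] by blast
qed

text \<open>The values at \<open>y\<close> of polynomials over \<open>K\<close> form a field isomorphic to the quotient modulo \<open>m\<close>; the
  embedding sends the value at \<open>y\<close> to the value of the transported polynomial at the root \<open>r\<close>.\<close>
theorem embedding_extend:
  assumes K: "field_set K" and \<phi>: "embeds K \<phi>" and m: "minimal_poly K y m" and r: "poly (map_poly \<phi> m) r = 0"
  shows "\<exists>K' \<psi>. field_set K' \<and> K \<subseteq> K' \<and> y \<in> K' \<and> embeds K' \<psi> \<and> (\<forall>x\<in>K. \<psi> x = \<phi> x) \<and> \<psi> y = r"
proof -
  note C = poly_over_closed[OF K] and E = embedsD[OF K \<phi>] and M = map_poly_embeds[OF K \<phi>] and F = field_setD[OF K]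
  define K' where "K' = {poly p y | p. poly_over K p}"
  define \<psi> where "\<psi> z = poly (map_poly \<phi> (SOME p. poly_over K p \<and> poly p y = z)) r" for z
  have mK: "poly_over K m" using m by (simp add: minimal_poly_def)
  have well: "poly (map_poly \<phi> p) r = poly (map_poly \<phi> q) r"
    if pq: "poly_over K p" "poly_over K q" "poly p y = poly q y" for p q
  proof -
    have "poly_over K (p - q)" "poly (p - q) y = 0" using pq C by simp_all
    then obtain d where d: "poly_over K d" "p - q = m * d" using minimal_poly_dvd[OF K m] by blast
    have "map_poly \<phi> p = map_poly \<phi> (m * d + q)" using d(2) by (simp add: algebra_simps)
    also have "\<dots> = map_poly \<phi> m * map_poly \<phi> d + map_poly \<phi> q"
      using M(1)[OF C(6)[OF mK d(1)] pq(2)] M(2)[OF mK d(1)] by simp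
    finally show ?thesis using r by simp
  qed
  have val: "\<psi> (poly p y) = poly (map_poly \<phi> p) r" if p: "poly_over K p" for p
  proof -
    have "poly_over K (SOME q. poly_over K q \<and> poly q y = poly p y) \<and> poly (SOME q. poly_over K q \<and> poly q y = poly p y) y = poly p y"
      by (rule someI[of _ p]) (simp add: p)
    then show ?thesis unfolding \<psi>_def using well p by blast
  qed
  have sub: "c \<in> K' \<and> \<psi> c = \<phi> c" if "c \<in> K" for c
  proof -
    have "poly_over K [:c:]" using C(2)[OF that] .
    moreover have "map_poly \<phi> [:c:] = [:\<phi> c:]" by (rule poly_eqI) (simp add: coeff_map_poly E coeff_pCons split: nat.split)
    ultimately show ?thesis using val[of "[:c:]"] unfolding K'_def by (auto intro!: exI[of _ "[:c:]"])
  qed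
  have yy: "y \<in> K' \<and> \<psi> y = r"
  proof -
    have v: "poly_over K [:0, 1:]" by (intro C F)
    have "map_poly \<phi> [:0, 1:] = [:0, 1:]" by (rule poly_eqI) (simp add: coeff_map_poly E coeff_pCons split: nat.split)
    then show ?thesis using val[OF v] v unfolding K'_def by (auto intro!: exI[of _ "[:0, 1:]"])
  qed
  have "field_set K'"
    unfolding field_set_def
  proof (intro conjI ballI)
    show "1 \<in> K'" using sub F by blast
    fix x assume "x \<in> K'"
    then obtain p where p: "poly_over K p" "x = poly p y" by (auto simp: K'_def)
    show "- x \<in> K'" using C(7)[OF p(1)] p(2) unfolding K'_def by (auto intro!: exI[of _ "- p"])
    show "inverse x \<in> K'"
    proof (cases "x = 0")
      case True then show ?thesis using sub[OF F(2)] by simp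
    next
      case False
      then obtain a where a: "poly_over K a" "poly a y * poly p y = 1"
        using minimal_poly_bezout[OF K m p(1)] p(2) by blast
      then have "inverse x = poly a y" using inverse_unique[of x "poly a y"] p(2) by (simp add: mult.commute)
      then show ?thesis using a(1) by (auto simp: K'_def)
    qed
    fix z assume "z \<in> K'"
    then obtain q where q: "poly_over K q" "z = poly q y" by (auto simp: K'_def)
    show "x + z \<in> K'" using C(4)[OF p(1) q(1)] p(2) q(2) unfolding K'_def by (auto intro!: exI[of _ "p + q"])
    show "x * z \<in> K'" using C(6)[OF p(1) q(1)] p(2) q(2) unfolding K'_def by (auto intro!: exI[of _ "p * q"])
  qed
  moreover have "embeds K' \<psi>"
    unfolding embeds_def
  proof (intro conjI ballI)
    show "\<psi> 1 = 1" using sub F(1) E(1) by simp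
    fix x z assume "x \<in> K'" "z \<in> K'"
    then obtain p q where pq: "poly_over K p" "x = poly p y" "poly_over K q" "z = poly q y" by (auto simp: K'_def)
    show "\<psi> (x + z) = \<psi> x + \<psi> z" "\<psi> (x * z) = \<psi> x * \<psi> z"
      using val[OF C(4)[OF pq(1,3)]] val[OF C(6)[OF pq(1,3)]] M[OF pq(1,3)] by (simp_all add: pq(2,4) val[OF pq(1)] val[OF pq(3)])
  qed
  ultimately show ?thesis using sub yy by blast
qed

lemma embedding_extend_list:
  assumes "field_set K" "embeds K \<phi>" "\<And>b. b \<in> set bs \<Longrightarrow> \<exists>p. poly_over \<rat> p \<and> p \<noteq> 0 \<and> poly p b = 0" "\<rat> \<subseteq> K"
  shows "\<exists>K' \<psi>. field_set K' \<and> K \<union> set bs \<subseteq> K' \<and> embeds K' \<psi> \<and> (\<forall>x\<in>K. \<psi> x = \<phi> x)"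
  using assms
proof (induction bs arbitrary: K \<phi>)
  case Nil then show ?case by auto
next
  case (Cons b bs)
  obtain p where p: "poly_over \<rat> p" "p \<noteq> 0" "poly p b = 0" using Cons.prems(3)[of b] by auto
  have "poly_over K p" using p(1) Cons.prems(4) by (auto simp: poly_over_def)
  then obtain m where m: "minimal_poly K b m" using p minimal_poly_exists by blast
  have mK: "poly_over K m" "m \<noteq> 0" "poly m b = 0" using m by (auto simp: minimal_poly_def)
  have "Polynomial.degree m \<noteq> 0"
  proof
    assume "Polynomial.degree m = 0"
    then obtain c where "m = [:c:]" by (rule degree_eq_zeroE)
    then show False using mK by simp
  qed
  moreover have "Polynomial.coeff (map_poly \<phi> m) (Polynomial.degree m) \<noteq> 0"
    using embedsD(2,6)[OF Cons.prems(1,2)] mK by (metis coeff_map_poly leading_coeff_0_iff poly_over_def)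
  then have "Polynomial.degree (map_poly \<phi> m) \<ge> Polynomial.degree m" by (rule le_degree)
  ultimately have "\<not> constant (poly (map_poly \<phi> m))" by (simp add: constant_degree)
  then obtain r where r: "poly (map_poly \<phi> m) r = 0" using fundamental_theorem_of_algebra by blast
  obtain K1 \<psi>1 where 1: "field_set K1" "K \<subseteq> K1" "b \<in> K1" "embeds K1 \<psi>1" "\<forall>x\<in>K. \<psi>1 x = \<phi> x"
    using embedding_extend[OF Cons.prems(1,2) m r] by blast
  have "\<exists>K' \<psi>. field_set K' \<and> K1 \<union> set bs \<subseteq> K' \<and> embeds K' \<psi> \<and> (\<forall>x\<in>K1. \<psi> x = \<psi>1 x)"
    using Cons.prems 1 by (intro Cons.IH) auto
  then obtain K2 \<psi>2 where 2: "field_set K2" "K1 \<union> set bs \<subseteq> K2" "embeds K2 \<psi>2" "\<forall>x\<in>K1. \<psi>2 x = \<psi>1 x" by blast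
  have "\<forall>x\<in>K. \<psi>2 x = \<phi> x" using 1(2,5) 2(4) by auto
  then show ?case using 1(2,3) 2 by (intro exI[of _ K2] exI[of _ \<psi>2]) auto
qed

lemma field_set_Rats: "field_set \<rat>" by (simp add: field_set_def)

text \<open>The minimal polynomial of an irrational number has degree at least \<open>2\<close> and simple roots, so it has
  a complex root different from \<open>x\<close>.\<close>
lemma irrational_moved:
  assumes x: "x \<notin> \<rat>" and p: "poly_over \<rat> p" "p \<noteq> 0" "poly p x = 0"
  shows "\<exists>K \<phi>. field_set K \<and> \<rat> \<subseteq> K \<and> x \<in> K \<and> embeds K \<phi> \<and> \<phi> x \<noteq> of_real x"
proof -
  note C = poly_over_closed[OF field_set_Rats]
  obtain m where m: "minimal_poly \<rat> x m" using minimal_poly_exists[OF p] .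
  have mK: "poly_over \<rat> m" "m \<noteq> 0" "poly m x = 0" using m by (auto simp: minimal_poly_def)
  have emb: "embeds \<rat> of_real" by (simp add: embeds_def)
  define f where "f = map_poly complex_of_real m"
  have fx: "poly f (of_real z) = of_real (poly m z)" for z unfolding f_def by (induction m) (simp_all add: map_poly_pCons)
  have df: "Polynomial.degree f = Polynomial.degree m" unfolding f_def by (rule degree_map_poly) simp
  obtain g where g: "f = [:- of_real x, 1:] * g" using fx[of x] mK(3) by (auto simp: poly_eq_0_iff_dvd elim: dvdE)
  have f0: "f \<noteq> 0" using mK(2) by (auto simp: f_def map_poly_eq_0_iff)
  have g0: "g \<noteq> 0" using f0 g by auto
  have dg: "Polynomial.degree m = Polynomial.degree g + 1" unfolding df[symmetric] g using g0 by (subst degree_mult_eq) auto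
  have pdK: "poly_over \<rat> (pderiv m)" using mK(1) by (simp add: poly_over_def coeff_pderiv)
  have "poly (pderiv m) x \<noteq> 0"
  proof
    assume "poly (pderiv m) x = 0"
    moreover have "pderiv m \<noteq> 0" using dg by (simp add: pderiv_eq_0_iff)
    ultimately have "Polynomial.degree m \<le> Polynomial.degree (pderiv m)" using m pdK by (auto simp: minimal_poly_def)
    then show False using dg by (simp add: degree_pderiv)
  qed
  moreover have "poly (pderiv f) (of_real z) = of_real (poly (pderiv m) z)" for z
  proof -
    have "pderiv f = map_poly of_real (pderiv m)"
      by (rule poly_eqI) (simp add: f_def coeff_map_poly coeff_pderiv)
    moreover have "poly (map_poly complex_of_real q) (of_real z) = of_real (poly q z)" for q
      by (induction q) (simp_all add: map_poly_pCons)
    ultimately show ?thesis by simp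
  qed
  ultimately have "poly (pderiv f) (of_real x) \<noteq> 0" by simp
  then have gx: "poly g (of_real x) \<noteq> 0" unfolding g pderiv_mult by (simp add: pderiv_pCons)
  have "Polynomial.degree g \<noteq> 0"
  proof
    assume "Polynomial.degree g = 0"
    then have "Polynomial.degree m = 1" using dg by simp
    then obtain a b where ab: "m = [:b, a:]" "a \<noteq> 0" by (metis degree1_coeffs)
    have "a \<in> \<rat>" "b \<in> \<rat>" using mK(1) unfolding poly_over_def ab(1) by (metis coeff_pCons_0 coeff_pCons_Suc)+
    moreover have "x = - b / a" using mK(3) ab by (simp add: field_simps add_eq_0_iff)
    ultimately show False using x by simp
  qed
  then have "\<not> constant (poly g)" by (simp add: constant_degree)
  then obtain r where r: "poly g r = 0" using fundamental_theorem_of_algebra by blast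
  have "poly (map_poly of_real m) r = 0" using r g unfolding f_def[symmetric] by simp
  from embedding_extend[OF field_set_Rats emb m this] show ?thesis using r gx by metis
qed

lemma embeddings_iff: "\<phi> \<in> embeddings F \<longleftrightarrow> embeds F \<phi>"
  by (auto simp: embeddings_def ring_hom_def embeds_def ring_of_type_algebra_def)

lemma real_field: "Ring.field real_ring" by (rule field_from_type_algebra)

lemma subfield_field_set:
  assumes "subfield F real_ring" shows "field_set F"
proof -
  interpret R: Ring.field real_ring by (rule real_field)
  note S = subringE[OF subfieldE(1)[OF assms]]
  have neg: "\<ominus>\<^bsub>real_ring\<^esub> x = - x" for x
    by (rule R.minus_equality) (simp_all add: ring_of_type_algebra_def)
  have inv: "inv\<^bsub>real_ring\<^esub> x = inverse x" if "x \<noteq> 0" for x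
    using that by (intro R.comm_inv_char) (simp_all add: ring_of_type_algebra_def)
  have "inverse x \<in> F" if "x \<in> F" for x
  proof (cases "x = 0")
    case True then show ?thesis using that by simp
  next
    case False
    then have "inv\<^bsub>real_ring\<^esub> x \<in> F" using R.subfield_m_inv(1)[OF assms, of x] that by (simp add: ring_of_type_algebra_def)
    then show ?thesis using inv[OF False] by simp
  qed
  then show ?thesis using S neg unfolding field_set_def by (simp add: ring_of_type_algebra_def)
qed

lemma field_set_subfield:
  assumes "field_set F" shows "subfield F real_ring"
proof -
  interpret R: Ring.field real_ring by (rule real_field)
  note F = field_setD[OF assms]
  have neg: "\<ominus>\<^bsub>real_ring\<^esub> x = - x" for x
    by (rule R.minus_equality) (simp_all add: ring_of_type_algebra_def)
  have inv: "inv\<^bsub>real_ring\<^esub> x = inverse x" if "x \<noteq> 0" for x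
    using that by (intro R.comm_inv_char) (simp_all add: ring_of_type_algebra_def)
  have "subring F real_ring"
    by (rule R.subringI) (use F neg in \<open>simp_all add: ring_of_type_algebra_def\<close>)
  moreover have "inv\<^bsub>real_ring\<^esub> k \<in> F" if "k \<in> F - {\<zero>\<^bsub>real_ring\<^esub>}" for k
    using that inv[of k] F(7)[of k] by (simp add: ring_of_type_algebra_def)
  ultimately show ?thesis by (rule R.subfieldI')
qed

lemma Rats_subset_field_set:
  assumes "field_set F" shows "\<rat> \<subseteq> F"
proof
  note F = field_setD[OF assms]
  have nat: "of_nat n \<in> F" for n by (induction n) (auto intro: F)
  have int: "of_int n \<in> F" for n
    using nat[of "nat n"] nat[of "nat (- n)"] F(5)[of "of_nat (nat (- n))"] by (cases "n \<ge> 0") auto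
  fix x :: real assume "x \<in> \<rat>"
  then obtain a b :: int where "b > 0" "x = of_int a / of_int b" by (metis Rats_cases')
  then show "x \<in> F" using F(8)[OF int int] by simp
qed

text \<open>Polynomials over rings with carrier are coefficient lists with the leading coefficient first.\<close>
lemma eval_poly:
  "ring.eval real_ring p x = poly (Poly (rev p)) x"
proof -
  interpret R: Ring.field real_ring by (rule real_field)
  have pow: "y [^]\<^bsub>real_ring\<^esub> n = y ^ n" for y :: real and n :: nat
    by (induction n) (simp_all add: ring_of_type_algebra_def)
  show ?thesis
  proof (induction p)
    case Nil show ?case unfolding R.eval.simps by (simp add: ring_of_type_algebra_def)
  next
    case (Cons a p)
    have "poly (Poly (xs @ [a])) x = poly (Poly xs) x + a * x ^ length xs" for xs
      by (induction xs) (simp_all add: algebra_simps)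
    then show ?case unfolding R.eval.simps list.sel Cons.IH pow by (simp add: ring_of_type_algebra_def)
  qed
qed

text \<open>An irrational element can be moved by an embedding of a field that contains it. That
  embedding extends along a finite list of generators to all of \<open>F\<close>.\<close>
theorem rational_if_only_identity_embedding:
  assumes F: "real_number_field F" and id: "\<And>\<phi> x. \<phi> \<in> embeddings F \<Longrightarrow> x \<in> F \<Longrightarrow> \<phi> x = of_real x"
  shows "F = \<rat>"
proof -
  interpret R: Ring.field real_ring by (rule real_field)
  have sf: "subfield F real_ring" and dim: "\<exists>n. R.dimension n \<rat> F" using F by (auto simp: real_number_field_def)
  have fs: "field_set F" by (rule subfield_field_set[OF sf])
  have Qs: "subfield \<rat> real_ring" by (rule field_set_subfield[OF field_set_Rats])
  have gen: "\<exists>bs. set bs \<subseteq> E \<and> 0 \<in> E \<and> (\<forall>K. field_set K \<and> set bs \<subseteq> K \<longrightarrow> E \<subseteq> K)" if "R.dimension n K0 E" "K0 = \<rat>" for n K0 E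
    using that
  proof (induction rule: R.dimension.induct)
    case (zero_dim K)
    then show ?case using field_setD(2) by (intro exI[of _ "[]"]) (auto simp: ring_of_type_algebra_def)
  next
    case (Suc_dim v E n K)
    then obtain bs where bs: "set bs \<subseteq> E" "0 \<in> E" "\<And>K. field_set K \<Longrightarrow> set bs \<subseteq> K \<Longrightarrow> E \<subseteq> K" by auto
    have le: "R.line_extension K v E = {k * v + e | k e. k \<in> \<rat> \<and> e \<in> E}"
      unfolding R.line_extension_def r_coset_def set_add_def set_mult_def \<open>K = \<rat>\<close>
      by (auto simp: ring_of_type_algebra_def)
    have sub: "E \<subseteq> R.line_extension K v E"
    proof
      fix x assume "x \<in> E"
      moreover have "x = 0 * v + x" by simp
      ultimately show "x \<in> R.line_extension K v E" unfolding le using Rats_0 by blast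
    qed
    have v: "v \<in> R.line_extension K v E"
    proof -
      have "v = 1 * v + 0" by simp
      then show ?thesis unfolding le using Rats_1 bs(2) by blast
    qed
    show ?case
    proof (intro exI[of _ "v # bs"] conjI allI impI)
      show "set (v # bs) \<subseteq> R.line_extension K v E" using v sub bs(1) by auto
      show "0 \<in> R.line_extension K v E" using sub bs(2) by auto
      fix L assume L: "field_set L \<and> set (v # bs) \<subseteq> L"
      then have EL: "E \<subseteq> L" using bs(3)[of L] by auto
      have "\<rat> \<subseteq> L" using L Rats_subset_field_set by blast
      have "k * v + e \<in> L" if "k \<in> \<rat>" "e \<in> E" for k e
        using that L EL \<open>\<rat> \<subseteq> L\<close> by (intro field_setD(3)[of L] field_setD(4)[of L]) auto
      then show "R.line_extension K v E \<subseteq> L" unfolding le by blast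
    qed
  qed
  obtain bs where bs: "set bs \<subseteq> F" "\<And>K. field_set K \<Longrightarrow> set bs \<subseteq> K \<Longrightarrow> F \<subseteq> K"
  proof -
    obtain n where "R.dimension n \<rat> F" using dim by blast
    from gen[OF this refl] show ?thesis using that by blast
  qed
  have alg: "\<exists>p. poly_over \<rat> p \<and> p \<noteq> 0 \<and> poly p y = 0" if y: "y \<in> F" for y
  proof -
    have "R.finite_dimension \<rat> F" using dim by (simp add: R.finite_dimension_def)
    then have "(R.algebraic over \<rat>) y"
      by (rule R.finite_dimension_imp_algebraic[OF Qs subfieldE(1)[OF sf] _ y])
    then obtain p where p: "p \<in> carrier (\<rat> [X]\<^bsub>real_ring\<^esub>)" "p \<noteq> []" "R.eval p y = \<zero>\<^bsub>real_ring\<^esub>"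
      using R.algebraicE[OF subfieldE(1)[OF Qs]] by (metis UNIV_I ring_of_type_algebra_def partial_object.select_convs(1))
    have pp: "polynomial\<^bsub>real_ring\<^esub> \<rat> p" using p(1) by (simp add: univ_poly_def)
    then have set: "set p \<subseteq> \<rat>" "hd p \<noteq> 0" using p(2) by (auto simp: polynomial_def ring_of_type_algebra_def)
    have "poly_over \<rat> (Poly (rev p))" unfolding poly_over_def
    proof
      fix i
      show "Polynomial.coeff (Poly (rev p)) i \<in> \<rat>"
      proof (cases "i < length (rev p)")
        case True
        then have "rev p ! i \<in> \<rat>" using nth_mem[OF True] set(1) by auto
        then show ?thesis using True by (simp add: coeff_Poly_eq nth_default_def)
      qed (simp add: coeff_Poly_eq nth_default_def)
    qed
    moreover have "Poly (rev p) \<noteq> 0"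
    proof
      assume "Poly (rev p) = 0"
      then obtain n where "rev p = replicate n 0" by (auto simp: Poly_eq_0)
      then have "p = replicate n 0" by (metis rev_replicate rev_rev_ident)
      then show False using set(2) p(2) by (cases n) auto
    qed
    moreover have "poly (Poly (rev p)) y = 0" using p(3) unfolding eval_poly by (simp add: ring_of_type_algebra_def)
    ultimately show ?thesis by blast
  qed
  have "x \<in> \<rat>" if x: "x \<in> F" for x
  proof (rule ccontr)
    assume irr: "x \<notin> \<rat>"
    obtain p where p: "poly_over \<rat> p" "p \<noteq> 0" "poly p x = 0" using alg[OF x] by blast
    obtain K \<phi> where K: "field_set K" "\<rat> \<subseteq> K" "x \<in> K" "embeds K \<phi>" "\<phi> x \<noteq> of_real x"
      using irrational_moved[OF irr p] by blast
    have "\<exists>K' \<psi>. field_set K' \<and> K \<union> set bs \<subseteq> K' \<and> embeds K' \<psi> \<and> (\<forall>x\<in>K. \<psi> x = \<phi> x)"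
      using alg bs(1) by (intro embedding_extend_list K) auto
    then obtain K' \<psi> where K': "field_set K'" "K \<union> set bs \<subseteq> K'" "embeds K' \<psi>" "\<forall>x\<in>K. \<psi> x = \<phi> x" by blast
    have "F \<subseteq> K'" using bs(2)[OF K'(1)] K'(2) by simp
    then have "embeds F \<psi>" using K'(3) by (auto simp: embeds_def)
    then have "\<psi> x = of_real x" using id x by (simp add: embeddings_iff)
    then show False using K' K by simp
  qed
  then show ?thesis using Rats_subset_field_set[OF fs] by blast
qed

lemma embeds_rational:
  assumes \<phi>: "embeds \<rat> \<phi>" and q: "q \<in> \<rat>" shows "\<phi> q = of_real q"
proof -
  note E = embedsD[OF field_set_Rats \<phi>]
  have nat: "\<phi> (of_nat n) = of_nat n" for n by (induction n) (simp_all add: E)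
  have int: "\<phi> (of_int n) = of_int n" for n
    using nat[of "nat n"] nat[of "nat (- n)"] E(5)[of "of_nat (nat (- n))"] by (cases "n \<ge> 0") auto
  obtain a b :: int where ab: "b > 0" "q = of_int a / of_int b" using q by (metis Rats_cases')
  have "\<phi> (q * of_int b) = \<phi> q * \<phi> (of_int b)" using q by (intro E) auto
  also have "q * of_int b = of_int a" using ab by simp
  finally have "\<phi> q * of_int b = of_int a" by (simp only: int)
  then have "\<phi> q = of_int a / of_int b" using ab(1) by (simp add: eq_divide_eq)
  also have "\<dots> = of_real q" by (simp add: ab(2))
  finally show ?thesis .
qed

section \<open>Traces of arithmetic groups with a parabolic element\<close>

definition qconj :: "quat \<Rightarrow> quat" where
  "qconj x = (case x of (x0, x1, x2, x3) \<Rightarrow> (x0, - x1, - x2, - x3))"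

lemma qmult_qconj: "qmult a b x (qconj x) = (nrd a b x, 0, 0, 0)"
  by (cases x) (simp add: qconj_def power2_eq_square algebra_simps)

lemma nrd_qmult: "nrd a b (qmult a b x y) = nrd a b x * nrd a b y"
  by (cases x; cases y) (simp add: power2_eq_square algebra_simps)

lemma real_algebra_isoD:
  assumes "\<rho> \<in> real_algebra_iso (quaternion_algebra UNIV a b) (S :: 'b::real_vector ring)"
  shows "\<rho> (qmult a b x y) = \<rho> x \<otimes>\<^bsub>S\<^esub> \<rho> y" "\<rho> (x + y) = \<rho> x \<oplus>\<^bsub>S\<^esub> \<rho> y" "\<rho> (1, 0, 0, 0) = \<one>\<^bsub>S\<^esub>"
    "\<rho> (c *\<^sub>R x) = c *\<^sub>R \<rho> x" "inj \<rho>" "range \<rho> = carrier S"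
proof -
  have c: "carrier (quaternion_algebra UNIV a b) = UNIV" by (simp add: quaternion_algebra_def)
  have hom: "\<rho> \<in> ring_hom (quaternion_algebra UNIV a b) S"
    and bij: "bij_betw \<rho> (carrier (quaternion_algebra UNIV a b)) (carrier S)"
    and sc: "\<And>c x. \<rho> (c *\<^sub>R x) = c *\<^sub>R \<rho> x"
    using assms unfolding real_algebra_iso_def ring_iso_def c by blast+
  show "\<rho> (c *\<^sub>R x) = c *\<^sub>R \<rho> x" by (rule sc)
  show "inj \<rho>" "range \<rho> = carrier S" using bij by (simp_all add: c bij_betw_def)
  show "\<rho> (1, 0, 0, 0) = \<one>\<^bsub>S\<^esub>" using ring_hom_one[OF hom] by (simp add: quaternion_algebra_def)
  show "\<rho> (qmult a b x y) = \<rho> x \<otimes>\<^bsub>S\<^esub> \<rho> y" "\<rho> (x + y) = \<rho> x \<oplus>\<^bsub>S\<^esub> \<rho> y"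
    using ring_hom_mult[OF hom, of x y] ring_hom_add[OF hom, of x y] unfolding c by (simp_all add: quaternion_algebra_def)
qed

text \<open>An isomorphism sends \<open>z * qconj z = 0\<close> to a product that vanishes in the Hamilton quaternions.
  The norm there is multiplicative and definite.\<close>
lemma hamilton_no_isotropic:
  assumes iso: "real_algebra_iso (quaternion_algebra UNIV a b) (quaternion_algebra UNIV (-1) (-1)) \<noteq> {}"
    and z: "nrd a b z = 0"
  shows "z = 0"
proof -
  obtain \<sigma> where "\<sigma> \<in> real_algebra_iso (quaternion_algebra UNIV a b) (quaternion_algebra UNIV (-1) (-1))" using iso by blast
  note S = real_algebra_isoD[OF this]
  have mult: "\<sigma> (qmult a b x y) = qmult (-1) (-1) (\<sigma> x) (\<sigma> y)" for x y using S(1) by (simp add: quaternion_algebra_def)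
  have zero: "\<sigma> 0 = 0" using S(4)[of 0 0] by simp
  have "qmult a b z (qconj z) = 0" unfolding qmult_qconj z by (simp add: zero_prod_def)
  then have "qmult (-1) (-1) (\<sigma> z) (\<sigma> (qconj z)) = 0" using mult[of z "qconj z"] zero by simp
  then have "nrd (-1) (-1) (\<sigma> z) * nrd (-1) (-1) (\<sigma> (qconj z)) = 0"
    unfolding nrd_qmult[symmetric] by (simp add: zero_prod_def)
  moreover have pos: "w = 0" if "nrd (-1) (-1) w = 0" for w :: quat
  proof -
    obtain w0 w1 w2 w3 where w: "w = (w0, w1, w2, w3)" by (rule prod_cases4)
    have s: "w0\<^sup>2 + w1\<^sup>2 + w2\<^sup>2 + w3\<^sup>2 = 0" using that by (simp add: w)
    have "w0\<^sup>2 = 0" "w1\<^sup>2 = 0" "w2\<^sup>2 = 0" "w3\<^sup>2 = 0"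
      using s zero_le_power2[of w0] zero_le_power2[of w1] zero_le_power2[of w2] zero_le_power2[of w3] by linarith+
    then show ?thesis by (simp add: w zero_prod_def)
  qed
  ultimately have "\<sigma> z = \<sigma> 0 \<or> \<sigma> (qconj z) = \<sigma> 0"
    unfolding zero mult_eq_0_iff using pos[of "\<sigma> z"] pos[of "\<sigma> (qconj z)"] by blast
  then have "z = 0 \<or> qconj z = 0" using S(5) by (meson injD)
  then show ?thesis by (cases z) (auto simp: qconj_def zero_prod_def)
qed

text \<open>The images of \<open>i\<close>, \<open>j\<close>, \<open>k\<close> have trace \<open>0\<close> because they anticommute and have nonzero scalar squares.
  Hence the matrix trace is the reduced trace for every isomorphism.\<close>
lemma matrix_representation:
  assumes \<rho>: "\<rho> \<in> real_algebra_iso (quaternion_algebra UNIV a b) M2R" and ab: "a \<noteq> 0" "b \<noteq> 0"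
  shows "\<rho> (qmult a b x y) = \<rho> x ** \<rho> y" "\<rho> (x + y) = \<rho> x + \<rho> y" "\<rho> (c *\<^sub>R x) = c *\<^sub>R \<rho> x"
    "\<rho> (1, 0, 0, 0) = mat 1" "inj \<rho>" "trace (\<rho> x) = 2 * fst x"
proof -
  note S = real_algebra_isoD[OF \<rho>, unfolded M2R_def, simplified]
  show m: "\<rho> (qmult a b x y) = \<rho> x ** \<rho> y" and p: "\<rho> (x + y) = \<rho> x + \<rho> y" and sc: "\<rho> (c *\<^sub>R x) = c *\<^sub>R \<rho> x"
    and o: "\<rho> (1, 0, 0, 0) = mat 1" and inj: "inj \<rho>" for x y c
    using S by simp_all
  define I J K where "I = \<rho> (0, 1, 0, 0)" and "J = \<rho> (0, 0, 1, 0)" and "K = \<rho> (0, 0, 0, 1)"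
  have neg: "\<rho> (- x) = - \<rho> x" for x using sc[of "-1" x] by simp
  have IJ: "I ** J = K" and JI: "J ** I = - K"
    using m[of "(0, 1, 0, 0)" "(0, 0, 1, 0)"] m[of "(0, 0, 1, 0)" "(0, 1, 0, 0)"] neg[of "(0, 0, 0, 1)"]
    by (simp_all add: I_def J_def K_def)
  have JJ: "J ** J = b *\<^sub>R mat 1" and II: "I ** I = a *\<^sub>R mat 1"
    using m[of "(0, 0, 1, 0)" "(0, 0, 1, 0)"] m[of "(0, 1, 0, 0)" "(0, 1, 0, 0)"] sc[of _ "(1, 0, 0, 0)"] o
    by (simp_all add: I_def J_def)
  have smul: "A ** (c *\<^sub>R mat 1) = c *\<^sub>R A" for A :: "real^2^2" and c by (simp add: eq_2x2_iff mult_2x2)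
  have tsc: "trace (c *\<^sub>R A) = c * trace A" "trace (- A) = - trace A" "trace (A + B) = trace A + trace B"
    for A B :: "real^2^2" and c by (simp_all add: trace_2x2 algebra_simps)
  have tK: "trace K = 0" using trace_mul_sym[of I J] unfolding IJ JI tsc by simp
  have "trace (J ** (I ** J)) = trace ((I ** J) ** J)" by (rule trace_mul_sym)
  moreover have "J ** (I ** J) = - ((I ** J) ** J)"
  proof -
    have "J ** (I ** J) = (J ** I) ** J" by (rule matrix_mul_assoc)
    also have "\<dots> = - (K ** J)" by (simp only: JI uminus_matrix_mult)
    finally show ?thesis by (simp only: IJ)
  qed
  ultimately have "trace ((I ** J) ** J) = 0" by (simp add: tsc)
  then have tI: "trace I = 0" using ab by (simp add: matrix_mul_assoc[symmetric] JJ smul tsc)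
  have "trace (I ** (J ** I)) = trace ((J ** I) ** I)" by (rule trace_mul_sym)
  moreover have "I ** (J ** I) = - ((J ** I) ** I)"
  proof -
    have "I ** (J ** I) = (I ** J) ** I" by (rule matrix_mul_assoc)
    then show ?thesis by (simp add: IJ JI uminus_matrix_mult)
  qed
  ultimately have "trace ((J ** I) ** I) = 0" by (simp add: tsc)
  then have tJ: "trace J = 0" using ab by (simp add: matrix_mul_assoc[symmetric] II smul tsc)
  obtain x0 x1 x2 x3 where x: "x = (x0, x1, x2, x3)" by (metis prod.exhaust)
  have "x = x0 *\<^sub>R (1, 0, 0, 0) + (x1 *\<^sub>R (0, 1, 0, 0) + (x2 *\<^sub>R (0, 0, 1, 0) + x3 *\<^sub>R (0, 0, 0, 1)))" by (simp add: x)
  then have "\<rho> x = x0 *\<^sub>R mat 1 + (x1 *\<^sub>R I + (x2 *\<^sub>R J + x3 *\<^sub>R K))"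
    by (simp only: p sc o I_def J_def K_def)
  then show "trace (\<rho> x) = 2 * fst x" unfolding \<open>\<rho> x = _\<close> tsc tI tJ tK by (simp add: x trace_2x2)
qed

text \<open>The quaternion \<open>z = s x - 1\<close> with the sign \<open>s\<close> chosen so that \<open>s x\<close> has matrix \<open>A\<close> is nonzero, has real part
  \<open>0\<close>, and norm \<open>0\<close>. Its conjugate under a nonidentity embedding would be isotropic in the
  Hamilton quaternions.\<close>
lemma arithmetic_with_parabolic_rational:
  assumes dat: "arithmetic_datum F a b \<rho> \<O>"
    and x: "x \<in> \<O>" "nrd a b x = 1" "\<rho> x = A \<or> \<rho> x = - A" and A: "trace A = 2" "A \<noteq> mat 1"
  shows "F = \<rat>"
proof -
  have F: "real_number_field F" "totally_real F" and ab: "a \<in> F" "b \<in> F" "a \<noteq> 0" "b \<noteq> 0"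
    and \<rho>: "\<rho> \<in> real_algebra_iso (quaternion_algebra UNIV a b) M2R"
    and ham: "\<And>\<phi>. \<phi> \<in> embeddings F \<Longrightarrow> (\<exists>x\<in>F. \<phi> x \<noteq> complex_of_real x) \<Longrightarrow>
        real_algebra_iso (quaternion_algebra UNIV (Re (\<phi> a)) (Re (\<phi> b))) (quaternion_algebra UNIV (-1) (-1)) \<noteq> {}"
    and ord: "is_order F a b \<O>"
    using dat by (auto simp: arithmetic_datum_def)
  note R = matrix_representation[OF \<rho> ab(3,4)]
  have fs: "field_set F" using F(1) by (auto simp: real_number_field_def intro: subfield_field_set)
  note FS = field_setD[OF fs]
  have "subring \<O> (quaternion_algebra F a b)" using ord unfolding is_order_def by blast
  then have "\<O> \<subseteq> F \<times> F \<times> F \<times> F" using subringE(1) by (fastforce simp: quaternion_algebra_def)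
  then obtain x0 x1 x2 x3 where xx: "x = (x0, x1, x2, x3)" "x0 \<in> F" "x1 \<in> F" "x2 \<in> F" "x3 \<in> F" using x(1) by blast
  define s :: real where "s = (if \<rho> x = A then 1 else -1)"
  have sF: "s \<in> F" "s * s = 1" using FS(1,5) by (simp_all add: s_def)
  have "\<rho> x = s *\<^sub>R A" using x(3) by (auto simp: s_def)
  then have rx: "\<rho> (s *\<^sub>R x) = A" using sF(2) by (simp add: R(3))
  then have x0: "s * x0 = 1" using R(6)[of "s *\<^sub>R x"] A(1) by (simp add: xx)
  define z where "z = (s * x0 - 1, s * x1, s * x2, s * x3)"
  have z0: "z \<noteq> 0"
  proof
    assume "z = 0"
    then have "s *\<^sub>R x = (1, 0, 0, 0)" by (simp add: z_def xx zero_prod_def)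
    then show False using rx R(4) A(2) by simp
  qed
  have n1: "x0\<^sup>2 - x1\<^sup>2 * a - x2\<^sup>2 * b + x3\<^sup>2 * a * b = 1" using x(2) by (simp add: xx)
  have s2: "s\<^sup>2 = 1" using sF(2) by (simp add: power2_eq_square)
  have "x0\<^sup>2 = 1" using x0 s2 by (metis power_mult_distrib mult_1 one_power2)
  then have n0: "- (x1\<^sup>2 * a) - x2\<^sup>2 * b + x3\<^sup>2 * a * b = 0" using n1 by simp
  have "\<phi> y = of_real y" if \<phi>: "\<phi> \<in> embeddings F" and y: "y \<in> F" for \<phi> y
  proof (rule ccontr)
    assume "\<phi> y \<noteq> of_real y"
    then have iso: "real_algebra_iso (quaternion_algebra UNIV (Re (\<phi> a)) (Re (\<phi> b))) (quaternion_algebra UNIV (-1) (-1)) \<noteq> {}"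
      using ham[OF \<phi>] y by blast
    have emb: "embeds F \<phi>" using \<phi> by (simp add: embeddings_iff)
    note E = embedsD[OF fs emb]
    have real: "Im (\<phi> u) = 0" if "u \<in> F" for u
    proof -
      have "\<phi> u \<in> \<real>" using F(2) \<phi> that unfolding totally_real_def by blast
      then show ?thesis by (simp add: complex_is_Real_iff)
    qed
    define r where "r u = Re (\<phi> u)" for u
    have rh: "r (u + v) = r u + r v" "r (u * v) = r u * r v" "r (- u) = - r u" if "u \<in> F" "v \<in> F" for u v
      using that real by (simp_all add: r_def E)
    have rs: "r (u - v) = r u - r v" if "u \<in> F" "v \<in> F" for u v
      using rh(1)[OF that(1) FS(5)[OF that(2)]] rh(3)[OF that(2,2)] by simp
    have r00: "r 0 = 0" by (simp add: r_def E)
    have r0: "u = 0" if "u \<in> F" "r u = 0" for u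
      using E(6)[OF that(1)] real[OF that(1)] that(2) by (simp add: r_def complex_eq_iff)
    have "r (- (x1\<^sup>2 * a) + - (x2\<^sup>2 * b) + x3\<^sup>2 * a * b) = - ((r x1)\<^sup>2 * r a) + - ((r x2)\<^sup>2 * r b) + (r x3)\<^sup>2 * r a * r b"
      unfolding power2_eq_square using FS(3-6) xx ab by (simp add: rh rs)
    then have "nrd (r a) (r b) (0, r x1, r x2, r x3) = 0" using n0 r00 by simp
    then have "(0, r x1, r x2, r x3) = (0::quat)" using hamilton_no_isotropic[OF iso] unfolding r_def by blast
    then have "x1 = 0" "x2 = 0" "x3 = 0" using r0 xx by (auto simp: zero_prod_def)
    then show False using z0 x0 by (simp add: z_def zero_prod_def)
  qed
  then show ?thesis by (rule rational_if_only_identity_embedding[OF F(1)])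
qed

lemma integers_of_Rats: "integers_of \<rat> = \<int>"
  by (auto simp: integers_of_def rational_algebraic_int_is_int elim!: Ints_cases)

text \<open>Two powers of \<open>A\<close> lie in the same coset.\<close>
lemma finite_rcosets_power:
  assumes \<Gamma>: "subgroup \<Gamma> PSL2R" and I: "\<one>\<^bsub>PSL2R\<^esub> \<in> I" "I \<subseteq> \<Gamma>"
    and fin: "finite (rcosets\<^bsub>PSL2R\<lparr>carrier := \<Gamma>\<rparr>\<^esub> I)" and A: "A \<in> lift \<Gamma>"
  shows "\<exists>n>0. mpow A n \<in> lift I"
proof -
  interpret group PSL2R by (rule group_PSL2R)
  have LG: "sl2_group (lift \<Gamma>)" by (rule lift_group[OF \<Gamma>])
  have dA: "det A = 1" using A by (simp add: lift_def)
  have inG: "proj (mpow A n) \<in> \<Gamma>" for n using sl2_mpow[OF LG A, of n] by (simp add: lift_def)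
  define c where "c n = I #>\<^bsub>PSL2R\<^esub> proj (mpow A n)" for n
  have "range c \<subseteq> rcosets\<^bsub>PSL2R\<lparr>carrier := \<Gamma>\<rparr>\<^esub> I" using inG by (auto simp: RCOSETS_def r_coset_def c_def)
  then have "finite (range c)" using fin finite_subset by blast
  then have "\<not> inj c" using finite_imageD[of c UNIV] by auto
  then obtain m n where mn: "m < n" "c m = c n" unfolding inj_def by (metis linorder_neqE_nat)
  have add: "mpow A (i + j) = mpow A i ** mpow A j" for i j by (induction i) (simp_all add: matrix_mul_assoc)
  have "proj (mpow A n) \<in> c m"
  proof -
    have "proj (mpow A n) \<in> carrier PSL2R" using dA by (simp add: proj_carrier det_mpow)
    then have "proj (mpow A n) = \<one>\<^bsub>PSL2R\<^esub> \<otimes>\<^bsub>PSL2R\<^esub> proj (mpow A n)" by simp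
    then show ?thesis unfolding mn(2) unfolding c_def r_coset_def by (intro UN_I[OF I(1)]) simp
  qed
  then have "\<exists>h\<in>I. proj (mpow A n) = h \<otimes>\<^bsub>PSL2R\<^esub> proj (mpow A m)" by (simp add: c_def r_coset_def)
  then obtain h where h: "h \<in> I" "proj (mpow A n) = h \<otimes>\<^bsub>PSL2R\<^esub> proj (mpow A m)" by (elim bexE)
  have hc: "h \<in> carrier PSL2R" using subgroup.mem_carrier[OF \<Gamma>] I(2) h(1) by blast
  have "proj (mpow A (n - m)) \<otimes>\<^bsub>PSL2R\<^esub> proj (mpow A m) = proj (mpow A n)"
    using add[of "n - m" m] mn(1) dA by (simp add: proj_mult det_mpow)
  then have "proj (mpow A (n - m)) = h"
    using h(2) hc dA by (metis det_mpow proj_carrier right_cancel)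
  then show ?thesis using h(1) mn(1) dA by (intro exI[of _ "n - m"]) (simp add: lift_def det_mpow)
qed

lemma finite_rcosets_representatives:
  assumes \<Gamma>: "subgroup \<Gamma> PSL2R" and I: "\<one>\<^bsub>PSL2R\<^esub> \<in> I" "I \<subseteq> \<Gamma>"
    and fin: "finite (rcosets\<^bsub>PSL2R\<lparr>carrier := \<Gamma>\<rparr>\<^esub> I)"
  shows "\<exists>R. finite R \<and> R \<subseteq> lift \<Gamma> \<and> (\<forall>A\<in>lift \<Gamma>. \<exists>r\<in>R. A ** adj2 r \<in> lift I)"
proof -
  interpret group PSL2R by (rule group_PSL2R)
  define c where "c A = I #>\<^bsub>PSL2R\<^esub> proj A" for A
  have "c ` lift \<Gamma> \<subseteq> rcosets\<^bsub>PSL2R\<lparr>carrier := \<Gamma>\<rparr>\<^esub> I" by (auto simp: RCOSETS_def r_coset_def c_def lift_def)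
  then have f: "finite (c ` lift \<Gamma>)" using fin finite_subset by blast
  define s where "s v = (SOME A. A \<in> lift \<Gamma> \<and> c A = v)" for v
  have s: "s (c A) \<in> lift \<Gamma> \<and> c (s (c A)) = c A" if "A \<in> lift \<Gamma>" for A
    unfolding s_def by (rule someI[of _ A]) (simp add: that)
  have "A ** adj2 (s (c A)) \<in> lift I" if A: "A \<in> lift \<Gamma>" for A
  proof -
    define r where "r = s (c A)"
    have r: "r \<in> lift \<Gamma>" "c r = c A" using s[OF A] by (simp_all add: r_def)
    have d: "det A = 1" "det r = 1" using A r by (simp_all add: lift_def)
    have "proj A \<in> c r"
    proof -
      have "proj A = \<one>\<^bsub>PSL2R\<^esub> \<otimes>\<^bsub>PSL2R\<^esub> proj A" using d by (simp add: proj_carrier)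
      then show ?thesis unfolding r(2) unfolding c_def r_coset_def by (intro UN_I[OF I(1)]) simp
    qed
    then have "\<exists>h\<in>I. proj A = h \<otimes>\<^bsub>PSL2R\<^esub> proj r" by (simp add: c_def r_coset_def)
    then obtain h where h: "h \<in> I" "proj A = h \<otimes>\<^bsub>PSL2R\<^esub> proj r" by (elim bexE)
    have hc: "h \<in> carrier PSL2R" using subgroup.mem_carrier[OF \<Gamma>] I(2) h(1) by blast
    have "proj (A ** adj2 r) \<otimes>\<^bsub>PSL2R\<^esub> proj r = proj A"
      using d adj2_mult(1)[OF d(2)] by (simp add: proj_mult det_mul matrix_mul_assoc[symmetric])
    then have "proj (A ** adj2 r) \<otimes>\<^bsub>PSL2R\<^esub> proj r = h \<otimes>\<^bsub>PSL2R\<^esub> proj r" by (simp only: h(2))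
    moreover have "proj r \<in> carrier PSL2R" "proj (A ** adj2 r) \<in> carrier PSL2R" using d by (simp_all add: proj_carrier det_mul)
    ultimately have "proj (A ** adj2 r) = h" using hc by (simp only: right_cancel)
    then show ?thesis using h(1) d by (simp add: lift_def det_mul r_def[symmetric])
  qed
  then show ?thesis using f s by (intro exI[of _ "s ` c ` lift \<Gamma>"]) blast
qed

text \<open>A progression \<open>\<kappa> \<int>\<close> has at most \<open>1 / \<bar>\<kappa>\<bar> + 1\<close> points in an interval of length \<open>1\<close>.\<close>
lemma progressions_bounded_clustering:
  assumes R: "finite R" "\<And>r. r \<in> R \<Longrightarrow> \<kappa> r \<noteq> (0::real)" and S: "\<And>x. x \<in> S \<Longrightarrow> \<exists>r\<in>R. \<exists>k::int. x = \<kappa> r * of_int k"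
  shows "bounded_clustering S"
proof -
  define N where "N r = nat \<lceil>1 / \<bar>\<kappa> r\<bar>\<rceil> + 2" for r
  have each: "finite ({x. \<exists>k::int. x = \<kappa> r * of_int k} \<inter> {of_int n..of_int n + 1}) \<and>
      card ({x. \<exists>k::int. x = \<kappa> r * of_int k} \<inter> {of_int n..of_int n + 1}) \<le> N r" if "r \<in> R" for r and n :: int
  proof -
    have k: "\<kappa> r \<noteq> 0" using R(2)[OF that] .
    define K where "K = \<bar>\<kappa> r\<bar>"
    have K: "K > 0" using k by (simp add: K_def)
    define W where "W = {\<lceil>of_int n / K\<rceil>..\<lfloor>(of_int n + 1) / K\<rfloor>}"
    have sub: "{x. \<exists>k::int. x = \<kappa> r * of_int k} \<inter> {of_int n..of_int n + 1} \<subseteq> (\<lambda>k. K * of_int k) ` W"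
    proof
      fix x assume x: "x \<in> {x. \<exists>k::int. x = \<kappa> r * of_int k} \<inter> {of_int n..of_int n + 1}"
      then obtain k :: int where "x = \<kappa> r * of_int k" by blast
      then have "\<exists>l::int. x = K * of_int l"
        by (cases "\<kappa> r > 0") (auto simp: K_def intro: exI[of _ k] exI[of _ "- k"])
      then obtain l :: int where l: "x = K * of_int l" by blast
      have "of_int n / K \<le> of_int l" "of_int l \<le> (of_int n + 1) / K"
        using x K by (auto simp: l divide_le_eq le_divide_eq mult.commute)
      then have "l \<in> W" unfolding W_def by (simp add: ceiling_le_iff le_floor_iff)
      then show "x \<in> (\<lambda>k. K * of_int k) ` W" using l by blast
    qed
    have "card ({x. \<exists>k::int. x = \<kappa> r * of_int k} \<inter> {of_int n..of_int n + 1}) \<le> card W"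
      using card_mono[OF _ sub] card_image_le[of W "\<lambda>k. K * of_int k"] by (simp add: W_def)
    also have "card W \<le> N r"
    proof -
      have "real_of_int (\<lfloor>(of_int n + 1) / K\<rfloor> + 1 - \<lceil>of_int n / K\<rceil>) \<le> (of_int n + 1) / K + 1 - of_int n / K" by linarith
      also have "\<dots> = 1 / K + 1" by (simp add: add_divide_distrib)
      finally have "\<lfloor>(of_int n + 1) / K\<rfloor> + 1 - \<lceil>of_int n / K\<rceil> \<le> \<lceil>1 / K\<rceil> + 1" by linarith
      then show ?thesis unfolding W_def N_def K_def[symmetric] by simp
    qed
    finally show ?thesis using finite_subset[OF sub] by (simp add: W_def)
  qed
  have "finite (S \<inter> {of_int n..of_int n + 1}) \<and> card (S \<inter> {of_int n..of_int n + 1}) < (\<Sum>r\<in>R. N r) + 1" for n :: int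
  proof -
    let ?Z = "\<lambda>r. {x. \<exists>k::int. x = \<kappa> r * of_int k} \<inter> {of_int n..of_int n + 1}"
    have sub: "S \<inter> {of_int n..of_int n + 1} \<subseteq> (\<Union>r\<in>R. ?Z r)" using S by blast
    have fin: "finite (\<Union>r\<in>R. ?Z r)" using each R(1) by blast
    have "card (S \<inter> {of_int n..of_int n + 1}) \<le> card (\<Union>r\<in>R. ?Z r)" by (rule card_mono[OF fin sub])
    also have "\<dots> \<le> (\<Sum>r\<in>R. card (?Z r))" by (rule card_UN_le[OF R(1)])
    also have "\<dots> \<le> (\<Sum>r\<in>R. N r)" using each by (intro sum_mono) blast
    finally show ?thesis using finite_subset[OF sub fin] by simp
  qed
  then show ?thesis unfolding bounded_clustering_def by blast
qed

text \<open>A parabolic matrix is unipotent: \<open>(A - 1)\<^sup>2 = 0\<close>.\<close>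
lemma mpow_parabolic:
  assumes "det A = 1" "trace A = 2"
  shows "mpow A n = mat 1 + of_nat n *\<^sub>R (A - mat 1)"
proof (induction n)
  case (Suc n)
  have tr: "A$2$2 = 2 - A$1$1" using assms(2) by (simp add: trace_2x2)
  have dt: "A$1$2 * A$2$1 = A$1$1 * (2 - A$1$1) - 1" using assms(1) by (simp add: det_2x2 tr algebra_simps)
  have "(A - mat 1) ** (A - mat 1) = 0"
    using dt unfolding eq_2x2_iff by (simp add: mult_2x2 tr algebra_simps)
  then have "A ** (A - mat 1) = A - mat 1"
    unfolding eq_2x2_iff by (simp add: mult_2x2 algebra_simps)
  moreover have "A ** (mat 1 + c *\<^sub>R N) = A + c *\<^sub>R (A ** N)" for c N
    unfolding eq_2x2_iff by (simp add: mult_2x2 algebra_simps)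
  ultimately have "A ** (mat 1 + of_nat n *\<^sub>R (A - mat 1)) = A + of_nat n *\<^sub>R (A - mat 1)"
    by simp
  also have "\<dots> = mat 1 + of_nat (Suc n) *\<^sub>R (A - mat 1)" by (simp add: scaleR_add_left)
  finally show ?case using Suc by simp
qed simp

text \<open>The entries are recovered from traces of products with \<open>shear 1\<close> and \<open>Y\<close>. The condition
  \<open>Y$1$1 = 0\<close> is a normalisation by a shear, which removes the last freedom of conjugation.\<close>
lemma rational_algebra_coordinates:
  fixes S :: "(real^2^2) set"
  assumes closed: "\<And>A B. A \<in> S \<Longrightarrow> B \<in> S \<Longrightarrow> A ** B \<in> S" "\<And>A B. A \<in> S \<Longrightarrow> B \<in> S \<Longrightarrow> A - B \<in> S"
    and tr: "\<And>A. A \<in> S \<Longrightarrow> trace A \<in> \<rat>" and S: "mat 1 \<in> S" "shear 1 \<in> S"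
    and Y: "Y \<in> S" "Y$2$1 \<noteq> 0" "Y$1$1 = 0" and A: "A \<in> S"
  shows "A$i$j \<in> \<rat>"
proof -
  have low: "C$2$1 \<in> \<rat>" if "C \<in> S" for C
  proof -
    have "trace ((shear 1 - mat 1) ** C) \<in> \<rat>" by (intro tr closed S that)
    then show ?thesis by (simp add: trace_2x2 mult_2x2)
  qed
  have tA: "A$1$1 + A$2$2 \<in> \<rat>" and tY: "Y$2$2 \<in> \<rat>" using tr[OF A] tr[OF Y(1)] Y(3) by (simp_all add: trace_2x2)
  have "trace (Y ** Y) - (Y$2$2)\<^sup>2 \<in> \<rat>" using tr[OF closed(1)[OF Y(1,1)]] tY by simp
  then have "2 * (Y$1$2 * Y$2$1) \<in> \<rat>" by (simp add: trace_2x2 mult_2x2 Y(3) power2_eq_square algebra_simps)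
  then have "2 * (Y$1$2 * Y$2$1) / (2 * Y$2$1) \<in> \<rat>"
    by (rule Rats_divide[OF _ Rats_mult[OF Rats_number_of low[OF Y(1)]]])
  then have Y12: "Y$1$2 \<in> \<rat>" using Y(2) by simp
  have "(A ** Y)$2$1 / Y$2$1 \<in> \<rat>" using low[OF closed(1)[OF A Y(1)]] low[OF Y(1)] by (rule Rats_divide)
  then have A22: "A$2$2 \<in> \<rat>" using Y(2,3) by (simp add: mult_2x2)
  have "A$1$1 + A$2$2 - A$2$2 \<in> \<rat>" using tA A22 by (rule Rats_diff)
  then have A11: "A$1$1 \<in> \<rat>" by simp
  have "(trace (A ** Y) - A$2$1 * Y$1$2 - A$2$2 * Y$2$2) / Y$2$1 \<in> \<rat>"
    using tr[OF closed(1)[OF A Y(1)]] low A Y(1) Y12 A22 tY by (intro Rats_divide Rats_diff Rats_mult) auto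
  then have A12: "A$1$2 \<in> \<rat>" using Y(2,3) by (simp add: trace_2x2 mult_2x2)
  have "\<forall>i j. A$i$j \<in> \<rat>" unfolding forall_2 using A11 A12 A22 low[OF A] by simp
  then show ?thesis by blast
qed

text \<open>A power of the parabolic \<open>C (shear 1) C\<^sup>-\<^sup>1\<close> is \<open>C (shear n) C\<^sup>-\<^sup>1\<close>, whose entries show that
  \<open>a c\<close> and \<open>c\<^sup>2\<close> are rational; for the inverse the same holds with \<open>d c\<close>. Dividing by \<open>c\<close> makes all
  entries rational.\<close>
lemma commensurator_rational_multiple:
  assumes det: "det T = 1" and pow: "\<And>C. C \<in> {T, adj2 T} \<Longrightarrow> \<exists>n>0. \<forall>i j. (mpow (C ** shear 1 ** adj2 C) n)$i$j \<in> \<rat>"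
    and T: "T$2$1 \<noteq> 0"
  shows "\<exists>s. s \<noteq> 0 \<and> (\<forall>i j. T$i$j / s \<in> \<rat>)"
proof -
  have key: "C$1$1 * C$2$1 \<in> \<rat> \<and> (C$2$1)\<^sup>2 \<in> \<rat>" if C: "C \<in> {T, adj2 T}" for C
  proof -
    obtain n where n: "n > 0" "\<forall>i j. (mpow (C ** shear 1 ** adj2 C) n)$i$j \<in> \<rat>" using pow[OF C] by blast
    have dC: "det C = 1" using C det by auto
    have "mpow (C ** shear 1 ** adj2 C) n = C ** shear n ** adj2 C"
      using conj_mpow[OF dC, of "shear 1" n] by (simp add: mpow_shear)
    then have r: "(C ** shear n ** adj2 C)$2$1 \<in> \<rat>" "(C ** shear n ** adj2 C)$1$1 \<in> \<rat>" using n(2) by simp_all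
    have e: "(C ** shear n ** adj2 C)$2$1 = - (n * (C$2$1)\<^sup>2)"
      "(C ** shear n ** adj2 C)$1$1 = 1 - n * (C$1$1 * C$2$1)"
      using dC by (simp_all add: mult_2x2 det_2x2 power2_eq_square algebra_simps)
    have "- (- (n * (C$2$1)\<^sup>2)) / of_nat n \<in> \<rat>" using r(1) unfolding e by (intro Rats_divide) auto
    moreover have "(1 - (1 - n * (C$1$1 * C$2$1))) / of_nat n \<in> \<rat>"
      using r(2) unfolding e by (rule Rats_divide[OF Rats_diff[OF Rats_1] Rats_of_nat])
    ultimately show ?thesis using n(1) by simp
  qed
  define c where "c = T$2$1"
  have c: "c \<noteq> 0" "c\<^sup>2 \<in> \<rat>" using T key[of T] by (simp_all add: c_def)
  have ac: "T$1$1 * c \<in> \<rat>" using key[of T] by (simp add: c_def)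
  have "- (T$2$2 * c) \<in> \<rat>" using key[of "adj2 T"] by (simp add: c_def)
  then have dc: "T$2$2 * c \<in> \<rat>" by simp
  have "T$1$1 * c / c\<^sup>2 \<in> \<rat>" "T$2$2 * c / c\<^sup>2 \<in> \<rat>" using ac dc c(2) by (auto intro: Rats_divide)
  then have a: "T$1$1 / c \<in> \<rat>" "T$2$2 / c \<in> \<rat>" using c(1) by (simp_all add: power2_eq_square)
  have "T$1$2 * c = T$1$1 * T$2$2 - 1" using det by (simp add: det_2x2 c_def)
  then have "T$1$2 / c = (T$1$1 / c) * (T$2$2 / c) - 1 / c\<^sup>2" using c(1) by (simp add: field_simps power2_eq_square)
  then have b: "T$1$2 / c \<in> \<rat>" using Rats_diff[OF Rats_mult[OF a] Rats_divide[OF Rats_1 c(2)]] by (simp only:)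
  have "T$2$1 / c \<in> \<rat>" using c(1) by (simp add: c_def)
  then have "\<forall>i j. T$i$j / c \<in> \<rat>" unfolding forall_2 using a b by blast
  then show ?thesis using c(1) by blast
qed

text \<open>Let \<open>I\<close> be the intersection of \<open>\<Gamma>\<close> with the arithmetic group. A conjugation by \<open>h\<close>, built from two
  parabolic elements of \<open>I\<close> with different fixed points, makes the order rational with denominator \<open>M0 * M1\<close>. Any \<open>A\<close> is
  a matrix of \<open>I\<close> times one of finitely many representatives \<open>r\<close>, and \<open>r\<close> is \<open>s\<close> times a rational matrix.
  So the traces over the coset of \<open>r\<close> are multiples of one number.\<close>
theorem arithmetic_imp_bounded_clustering:
  assumes co: "cofinite_area \<Gamma>" and par: "\<exists>T\<in>\<Gamma>. parabolic T" and ar: "arithmetic \<Gamma>"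
  shows "bounded_clustering (Tr \<Gamma>)"
proof -
  obtain F a b \<rho> \<O> where \<Gamma>: "fuchsian \<Gamma>" and dat: "arithmetic_datum F a b \<rho> \<O>" and com: "commensurable \<Gamma> (\<Gamma>_of a b \<rho> \<O>)"
    using ar unfolding arithmetic_def by blast
  have sub: "subgroup \<Gamma> PSL2R" using \<Gamma> by (simp add: fuchsian_def)
  have ab: "a \<noteq> 0" "b \<noteq> 0" and \<rho>: "\<rho> \<in> real_algebra_iso (quaternion_algebra UNIV a b) M2R" and ord: "is_order F a b \<O>"
    using dat by (auto simp: arithmetic_datum_def)
  note R = matrix_representation[OF \<rho> ab]
  have neg: "\<rho> (- x) = - \<rho> x" for x using R(3)[of "-1" x] by simp
  have diff: "\<rho> (x - y) = \<rho> x - \<rho> y" for x y using R(2)[of x "- y"] by (simp add: neg)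
  define I where "I = \<Gamma> \<inter> \<Gamma>_of a b \<rho> \<O>"
  note LG = lift_group[OF sub]
  have quatO: "\<O> \<subseteq> F \<times> F \<times> F \<times> F" "(1, 0, 0, 0) \<in> \<O>"
  proof -
    have S: "subring \<O> (quaternion_algebra F a b)" using ord unfolding is_order_def by blast
    show "\<O> \<subseteq> F \<times> F \<times> F \<times> F" "(1, 0, 0, 0) \<in> \<O>"
      using subringE(1)[OF S] subringE(3)[OF S] by (simp_all add: quaternion_algebra_def)
  qed
  have "proj (\<rho> (1, 0, 0, 0)) \<in> \<Gamma>_of a b \<rho> \<O>"
    unfolding \<Gamma>_of_def by (intro imageI) (simp add: norm_one_group_def quatO(2))
  then have I1: "\<one>\<^bsub>PSL2R\<^esub> \<in> I" using subgroup.one_closed[OF sub] by (simp add: I_def R(4) one_PSL2R)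
  have I\<Gamma>: "I \<subseteq> \<Gamma>" by (simp add: I_def)
  have fin: "finite (rcosets\<^bsub>PSL2R\<lparr>carrier := \<Gamma>\<rparr>\<^esub> I)" using com by (simp add: commensurable_def I_def)
  have pow: "\<exists>n>0. mpow A n \<in> lift I" if "A \<in> lift \<Gamma>" for A
    by (rule finite_rcosets_power[OF sub I1 I\<Gamma> fin that])
  have liftI: "\<exists>x\<in>\<O>. nrd a b x = 1 \<and> (\<rho> x = A \<or> \<rho> x = - A)" if A: "A \<in> lift I" for A
  proof -
    obtain x where x: "x \<in> \<O>" "nrd a b x = 1" "proj A = proj (\<rho> x)"
      using A by (auto simp: lift_def I_def \<Gamma>_of_def norm_one_group_def)
    have "\<rho> x = A \<or> \<rho> x = - A" using x(3) by (auto simp: proj_eq_iff)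
    then show ?thesis using x by blast
  qed
  obtain A0 where A0: "A0 \<in> lift \<Gamma>" "trace A0 = 2" "A0 \<noteq> mat 1" using par parabolic_lift[OF sub] by blast
  obtain n0 where n0: "n0 > 0" "mpow A0 n0 \<in> lift I" using pow[OF A0(1)] by blast
  define P where "P = mpow A0 n0"
  have Pform: "P = mat 1 + of_nat n0 *\<^sub>R (A0 - mat 1)" unfolding P_def by (rule mpow_parabolic[OF sl2_det[OF LG A0(1)] A0(2)])
  have P: "P \<in> lift I" "P \<in> lift \<Gamma>" "trace P = 2" "P \<noteq> mat 1"
  proof -
    show "P \<in> lift I" using n0 by (simp add: P_def)
    then show "P \<in> lift \<Gamma>" using I\<Gamma> by (auto simp: lift_def)
    have "A0$1$1 + A0$2$2 = 2" using A0(2) by (simp add: trace_2x2)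
    then have "of_nat n0 * (A0$1$1 + A0$2$2 - 2) = (0::real)" by simp
    then show "trace P = 2" unfolding Pform trace_2x2 by (simp add: algebra_simps)
    show "P \<noteq> mat 1" unfolding Pform using A0(3) n0(1) by simp
  qed
  have FQ: "F = \<rat>"
  proof -
    obtain x where "x \<in> \<O>" "nrd a b x = 1" "\<rho> x = P \<or> \<rho> x = - P" using liftI[OF P(1)] by blast
    then show ?thesis using arithmetic_with_parabolic_rational[OF dat _ _ _ P(3,4)] by blast
  qed
  have abQ: "a \<in> \<rat>" "b \<in> \<rat>" using dat FQ by (auto simp: arithmetic_datum_def)
  define Q4 :: "quat set" where "Q4 = \<rat> \<times> \<rat> \<times> \<rat> \<times> \<rat>"
  have OQ: "\<O> \<subseteq> Q4" using quatO(1) by (simp add: Q4_def FQ)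
  have Q4c: "qmult a b x y \<in> Q4" "x - y \<in> Q4" "- x \<in> Q4" if "x \<in> Q4" "y \<in> Q4" for x y
    using that abQ by (cases x; cases y; auto simp: Q4_def)+
  have IQ: "\<exists>x\<in>Q4. \<rho> x = A" if A: "A \<in> lift I" for A
  proof -
    obtain x where x: "x \<in> \<O>" "\<rho> x = A \<or> \<rho> x = - A" using liftI[OF A] by blast
    show ?thesis
    proof (cases "\<rho> x = A")
      case False
      then have "\<rho> (- x) = A" using x(2) by (simp add: neg)
      moreover have "- x \<in> Q4" using x(1) OQ Q4c(3) by blast
      ultimately show ?thesis by blast
    qed (use x OQ in blast)
  qed
  obtain g where g: "det g = 1" "g ** P ** adj2 g = shear 1 \<or> g ** P ** adj2 g = shear (-1)"
    using conj_to_shear[OF sl2_det[OF LG P(2)] P(3,4)] by blast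
  have gG: "sl2_group (conj_set g (lift \<Gamma>))" by (rule conj_set_group[OF g(1) LG])
  have gPG: "g ** P ** adj2 g \<in> conj_set g (lift \<Gamma>)" using P(2) by (simp add: conj_set_def)
  have shg: "shear 1 \<in> conj_set g (lift \<Gamma>)"
    using g(2) gPG sl2_adj2[OF gG gPG] by (auto simp: adj2_shear)
  obtain D where D: "covers (lift \<Gamma>) D" using lift_covers[OF sub co] by blast
  obtain \<gamma> where \<gamma>: "\<gamma> \<in> conj_set g (lift \<Gamma>)" "\<gamma>$2$1 \<noteq> 0"
    using exists_lower_left_nonzero[OF gG shg conj_covers[OF g(1) LG D] conj_shear_discrete[OF \<Gamma> g(1)]] by blast
  have d\<gamma>: "det \<gamma> = 1" by (rule sl2_det[OF gG \<gamma>(1)])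
  have "\<gamma> ** shear 1 ** adj2 \<gamma> \<in> conj_set g (lift \<Gamma>)"
    by (intro sl2_mult[OF gG] sl2_adj2[OF gG] \<gamma> shg)
  then obtain \<delta> where \<delta>: "\<delta> \<in> lift \<Gamma>" "\<gamma> ** shear 1 ** adj2 \<gamma> = g ** \<delta> ** adj2 g" by (auto simp: conj_set_def)
  obtain n1 where n1: "n1 > 0" "mpow \<delta> n1 \<in> lift I" using pow[OF \<delta>(1)] by blast
  define Y0 where "Y0 = g ** mpow \<delta> n1 ** adj2 g"
  have "Y0 = \<gamma> ** shear n1 ** adj2 \<gamma>"
    unfolding Y0_def conj_mpow[OF g(1), symmetric] \<delta>(2)[symmetric] conj_mpow[OF d\<gamma>] mpow_shear by simp
  then have Y021: "Y0$2$1 \<noteq> 0" using n1(1) \<gamma>(2) by (simp add: mult_2x2 algebra_simps)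
  \<comment> \<open>the shear by \<open>t\<close> annihilates the upper left entry of \<open>Y0\<close>\<close>
  define t where "t = - (Y0$1$1) / Y0$2$1"
  define h where "h = shear t ** g"
  have h: "det h = 1" by (simp add: h_def det_mul g)
  have hg: "h ** A ** adj2 h = shear t ** (g ** A ** adj2 g) ** adj2 (shear t)" for A
    by (simp add: h_def adj2_mult_distrib matrix_mul_assoc)
  define \<psi> where "\<psi> x = h ** \<rho> x ** adj2 h" for x
  have \<psi>m: "\<psi> (qmult a b x y) = \<psi> x ** \<psi> y" for x y by (simp add: \<psi>_def R(1) conj_mult[OF h])
  have \<psi>d: "\<psi> (x - y) = \<psi> x - \<psi> y" and \<psi>a: "\<psi> (x + y) = \<psi> x + \<psi> y" and \<psi>s: "\<psi> (c *\<^sub>R x) = c *\<^sub>R \<psi> x" for x y c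
    by (simp_all add: \<psi>_def diff R(2,3) eq_2x2_iff mult_2x2 algebra_simps)
  have \<psi>1: "\<psi> (1, 0, 0, 0) = mat 1" using adj2_mult(2)[OF h] by (simp add: \<psi>_def R(4))
  have \<psi>t: "trace (\<psi> x) = 2 * fst x" for x by (simp add: \<psi>_def conj_set_trace[OF h] R(6))
  have I\<psi>: "h ** A ** adj2 h \<in> \<psi> ` Q4" if "A \<in> lift I" for A using IQ[OF that] by (auto simp: \<psi>_def)
  have one: "mat 1 \<in> \<psi> ` Q4" using \<psi>1 by (intro image_eqI[of _ _ "(1, 0, 0, 0)"]) (auto simp: Q4_def)
  have sd: "A - B \<in> \<psi> ` Q4" if "A \<in> \<psi> ` Q4" "B \<in> \<psi> ` Q4" for A B
    using that Q4c(2) \<psi>d[symmetric] by auto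
  have sm: "A ** B \<in> \<psi> ` Q4" if "A \<in> \<psi> ` Q4" "B \<in> \<psi> ` Q4" for A B
    using that Q4c(1) \<psi>m[symmetric] by auto
  have hP: "h ** P ** adj2 h = g ** P ** adj2 g"
    using g(2) by (auto simp: hg adj2_shear shear_add)
  have sh: "shear 1 \<in> \<psi> ` Q4"
  proof -
    have "shear 1 \<in> \<psi> ` Q4 \<or> shear (-1) \<in> \<psi> ` Q4" using I\<psi>[OF P(1)] g(2) hP by auto
    moreover have "mat 1 - (shear (-1) - mat 1) = shear 1" by (simp add: eq_2x2_iff)
    ultimately show ?thesis using sd[OF one sd[OF _ one], of "shear (-1)"] by auto
  qed
  define Y where "Y = h ** mpow \<delta> n1 ** adj2 h"
  have Yin: "Y \<in> \<psi> ` Q4" unfolding Y_def by (rule I\<psi>[OF n1(2)])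
  have Yent: "Y$2$1 \<noteq> 0" "Y$1$1 = 0"
    unfolding Y_def hg Y0_def[symmetric] using Y021 by (simp_all add: mult_2x2 t_def)
  have rat: "A$i$j \<in> \<rat>" if "A \<in> \<psi> ` Q4" for A i j
  proof (rule rational_algebra_coordinates[OF sm sd _ one sh Yin Yent that])
    fix A assume "A \<in> \<psi> ` Q4"
    then show "trace A \<in> \<rat>" by (auto simp: \<psi>t Q4_def)
  qed
  define G' where "G' = conj_set h (lift \<Gamma>)"
  have G': "sl2_group G'" unfolding G'_def by (rule conj_set_group[OF h LG])
  have shG': "shear 1 \<in> G'"
  proof -
    have "h ** P ** adj2 h \<in> G'" using P(2) by (simp add: G'_def conj_set_def)
    then show ?thesis using g(2) sl2_adj2[OF G', of "shear (-1)"] unfolding hP by (auto simp: adj2_shear)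
  qed
  have YG': "Y \<in> G'" unfolding Y_def G'_def conj_set_def by (intro imageI sl2_mpow[OF LG] \<delta>)
  have mult0: "\<exists>s. s \<noteq> 0 \<and> (\<forall>i j. T$i$j / s \<in> \<rat>)" if T: "T \<in> G'" "T$2$1 \<noteq> 0" for T
  proof (rule commensurator_rational_multiple[OF sl2_det[OF G' T(1)] _ T(2)])
    fix C assume "C \<in> {T, adj2 T}"
    then have C: "C \<in> G'" using T sl2_adj2[OF G'] by auto
    have "C ** shear 1 ** adj2 C \<in> G'" by (intro sl2_mult[OF G'] sl2_adj2[OF G'] C shG')
    then obtain E where E: "E \<in> lift \<Gamma>" "C ** shear 1 ** adj2 C = h ** E ** adj2 h" by (auto simp: G'_def conj_set_def)
    obtain n where n: "n > 0" "mpow E n \<in> lift I" using pow[OF E(1)] by blast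
    have "mpow (C ** shear 1 ** adj2 C) n \<in> \<psi> ` Q4" unfolding E(2) conj_mpow[OF h] by (rule I\<psi>[OF n(2)])
    then show "\<exists>n>0. \<forall>i j. (mpow (C ** shear 1 ** adj2 C) n)$i$j \<in> \<rat>" using n(1) rat by blast
  qed
  have mult: "\<exists>s. s \<noteq> 0 \<and> (\<forall>i j. T$i$j / s \<in> \<rat>)" if T: "T \<in> G'" for T
  proof (cases "T$2$1 = 0")
    case True
    have "T$1$1 * T$2$2 = 1" using sl2_det[OF G' T] True by (simp add: det_2x2)
    then have "(Y ** T)$2$1 \<noteq> 0" using Yent(1) True by (auto simp: mult_2x2)
    then obtain s where s: "s \<noteq> 0" "\<forall>i j. (Y ** T)$i$j / s \<in> \<rat>" using mult0[OF sl2_mult[OF G' YG' T]] by blast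
    have "T = adj2 Y ** (Y ** T)" using adj2_mult(1)[OF sl2_det[OF G' YG']] by (simp add: matrix_mul_assoc)
    then have eq: "T$i$j / s = adj2 Y$i$1 * ((Y ** T)$1$j / s) + adj2 Y$i$2 * ((Y ** T)$2$j / s)" for i j
      by (metis (no_types) mult_2x2 add_divide_distrib times_divide_eq_right)
    have Yr: "\<forall>i j. adj2 Y$i$j \<in> \<rat>" unfolding forall_2 using rat[OF Yin] by simp
    have "T$i$j / s \<in> \<rat>" for i j unfolding eq by (intro Rats_add Rats_mult Yr[rule_format] s(2)[rule_format])
    then show ?thesis using s(1) by blast
  qed (use mult0 T in blast)
  obtain S where S: "finite S" "\<O> = lin_span \<int> S" using ord by (auto simp: is_order_def FQ integers_of_Rats)
  have SO: "S \<subseteq> \<O>"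
  proof
    fix v assume v: "v \<in> S"
    have "(\<Sum>w\<in>{v}. (\<lambda>_. 1) w *\<^sub>R w) \<in> lin_span \<int> S"
      unfolding lin_span_def using v by (intro CollectI exI[of _ "{v}"] exI[of _ "\<lambda>_. 1"] conjI refl) auto
    then show "v \<in> \<O>" using S(2) by simp
  qed
  define E where "E = (\<lambda>(x0, x1, x2, x3). {x0, x1, x2, x3 :: real})"
  have "finite (\<Union>v\<in>S. E v)" using S(1) by (intro finite_UN_I) (auto simp: E_def split: prod.split)
  moreover have "(\<Union>v\<in>S. E v) \<subseteq> \<rat>" using SO OQ by (force simp: E_def Q4_def)
  ultimately obtain M0 :: nat where M0: "M0 > 0" "\<And>v x. v \<in> S \<Longrightarrow> x \<in> E v \<Longrightarrow> of_nat M0 * x \<in> \<int>"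
    using rational_common_denominator[of "\<Union>v\<in>S. E v"] by blast
  define e :: "nat \<Rightarrow> quat" where "e i = (if i = 0 then (1, 0, 0, 0) else if i = 1 then (0, 1, 0, 0) else if i = 2 then (0, 0, 1, 0) else (0, 0, 0, 1))" for i
  have eQ: "e i \<in> Q4" for i by (simp add: e_def Q4_def)
  define W where "W = (\<lambda>(m, i, j). \<psi> (e m)$i$j) ` ({..3} \<times> (UNIV :: 2 set) \<times> (UNIV :: 2 set))"
  have "finite W" "W \<subseteq> \<rat>" unfolding W_def using rat eQ by auto
  then obtain M1 :: nat where M1: "M1 > 0" "\<And>w. w \<in> W \<Longrightarrow> of_nat M1 * w \<in> \<int>"
    using rational_common_denominator[of W] by blast
  have M1e: "of_nat M1 * \<psi> (e m)$i$j \<in> \<int>" if "m \<le> 3" for m i j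
    using that by (intro M1(2)[unfolded W_def] image_eqI[of _ _ "(m, i, j)"]) auto
  have int: "of_nat (M0 * M1) * \<psi> x$i$j \<in> \<int>" if x: "x \<in> \<O>" for x i j
  proof -
    have coord: "of_nat M0 * y \<in> \<int>" if "y \<in> E x" for y
    proof -
      obtain S' c where S': "finite S'" "S' \<subseteq> S" "c ` S' \<subseteq> \<int>" "x = (\<Sum>v\<in>S'. c v *\<^sub>R v)" using x S(2) by (auto simp: lin_span_def)
      have "\<forall>y\<in>E (\<Sum>v\<in>S'. c v *\<^sub>R v). of_nat M0 * y \<in> \<int>" using S'(1-3)
      proof (induction S')
        case empty then show ?case by (simp add: E_def zero_prod_def)
      next
        case (insert v S')
        obtain v0 v1 v2 v3 where v: "v = (v0, v1, v2, v3)" by (metis prod.exhaust)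
        obtain w0 w1 w2 w3 where w: "(\<Sum>v\<in>S'. c v *\<^sub>R v) = (w0, w1, w2, w3)" by (rule prod_cases4)
        have wi: "of_nat M0 * w0 \<in> \<int>" "of_nat M0 * w1 \<in> \<int>" "of_nat M0 * w2 \<in> \<int>" "of_nat M0 * w3 \<in> \<int>"
          using insert.IH insert.prems by (simp_all add: w E_def)
        have vi: "of_nat M0 * v0 \<in> \<int>" "of_nat M0 * v1 \<in> \<int>" "of_nat M0 * v2 \<in> \<int>" "of_nat M0 * v3 \<in> \<int>"
          using M0(2)[of v] insert.prems by (simp_all add: v E_def)
        have cv: "c v \<in> \<int>" using insert.prems by simp
        have gen: "of_nat M0 * (c v * p + q) \<in> \<int>" if "of_nat M0 * p \<in> \<int>" "of_nat M0 * q \<in> \<int>" for p q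
        proof -
          have "of_nat M0 * (c v * p + q) = c v * (of_nat M0 * p) + of_nat M0 * q" by (simp add: algebra_simps)
          then show ?thesis using that cv by simp
        qed
        show ?case using insert.hyps w v gen wi vi by (simp add: E_def)
      qed
      then show ?thesis using that S'(4) by blast
    qed
    obtain x0 x1 x2 x3 where xx: "x = (x0, x1, x2, x3)" by (metis prod.exhaust)
    have xi: "of_nat M0 * x0 \<in> \<int>" "of_nat M0 * x1 \<in> \<int>" "of_nat M0 * x2 \<in> \<int>" "of_nat M0 * x3 \<in> \<int>"
      using coord by (simp_all add: xx E_def)
    have "x = x0 *\<^sub>R e 0 + (x1 *\<^sub>R e 1 + (x2 *\<^sub>R e 2 + x3 *\<^sub>R e 3))" by (simp add: xx e_def)
    then have "\<psi> x = x0 *\<^sub>R \<psi> (e 0) + (x1 *\<^sub>R \<psi> (e 1) + (x2 *\<^sub>R \<psi> (e 2) + x3 *\<^sub>R \<psi> (e 3)))"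
      by (simp only: \<psi>a \<psi>s)
    then have "of_nat (M0 * M1) * \<psi> x$i$j = (of_nat M0 * x0) * (of_nat M1 * \<psi> (e 0)$i$j) + (of_nat M0 * x1) * (of_nat M1 * \<psi> (e 1)$i$j)
        + (of_nat M0 * x2) * (of_nat M1 * \<psi> (e 2)$i$j) + (of_nat M0 * x3) * (of_nat M1 * \<psi> (e 3)$i$j)"
      by (simp add: algebra_simps)
    also have "\<dots> \<in> \<int>" by (intro Ints_add Ints_mult xi M1e) auto
    finally show ?thesis .
  qed
  have intI: "of_nat (M0 * M1) * (h ** A ** adj2 h)$i$j \<in> \<int>" if A: "A \<in> lift I" for A i j
  proof -
    obtain x where x: "x \<in> \<O>" "\<rho> x = A \<or> \<rho> x = - A" using liftI[OF A] by blast
    have "h ** (- A) ** adj2 h = - (h ** A ** adj2 h)" by (simp add: uminus_matrix_mult)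
    then have "(h ** A ** adj2 h)$i$j = \<psi> x$i$j \<or> (h ** A ** adj2 h)$i$j = - (\<psi> x$i$j)" using x(2) by (auto simp: \<psi>_def)
    then show ?thesis using int[OF x(1), of i j] by auto
  qed
  obtain Reps where Reps: "finite Reps" "Reps \<subseteq> lift \<Gamma>" "\<forall>A\<in>lift \<Gamma>. \<exists>r\<in>Reps. A ** adj2 r \<in> lift I"
    using finite_rcosets_representatives[OF sub I1 I\<Gamma> fin] by blast
  have "\<exists>k. k \<noteq> 0 \<and> (\<forall>A. A ** adj2 r \<in> lift I \<longrightarrow> (\<exists>m::int. trace A = k * of_int m))" if r: "r \<in> Reps" for r
  proof -
    have rG: "r \<in> lift \<Gamma>" using r Reps by blast
    define q where "q = h ** r ** adj2 h"
    have "q \<in> G'" using rG by (simp add: q_def G'_def conj_set_def)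
    then obtain s where s: "s \<noteq> 0" "\<forall>i j. q$i$j / s \<in> \<rat>" using mult by blast
    define W' where "W' = (\<lambda>(i, j). q$i$j / s) ` UNIV"
    have "finite W'" "W' \<subseteq> \<rat>" unfolding W'_def using s(2) by auto
    then obtain M2 :: nat where M2: "M2 > 0" "\<And>w. w \<in> W' \<Longrightarrow> of_nat M2 * w \<in> \<int>"
      using rational_common_denominator[of W'] by blast
    have qi: "of_nat M2 * (q$i$j / s) \<in> \<int>" for i j
      by (rule M2(2)) (auto simp: W'_def intro!: image_eqI[of _ _ "(i, j)"])
    have "\<exists>m::int. trace A = s / of_nat (M0 * M1 * M2) * of_int m" if A: "A ** adj2 r \<in> lift I" for A
    proof -
      define N where "N = h ** (A ** adj2 r) ** adj2 h"
      have Ni: "of_nat (M0 * M1) * N$i$j \<in> \<int>" for i j unfolding N_def by (rule intI[OF A])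
      have "A = A ** adj2 r ** r" using adj2_mult(1)[OF sl2_det[OF LG rG]] by (simp add: matrix_mul_assoc[symmetric])
      then have "h ** A ** adj2 h = N ** q" unfolding N_def q_def using conj_mult[OF h, of "A ** adj2 r" r] by simp
      then have "trace A = trace (N ** q)" using conj_set_trace[OF h, of A] by simp
      define V where "V i j = (of_nat (M0 * M1) * N$i$j) * (of_nat M2 * (q$j$i / s))" for i j
      have "V 1 1 + V 1 2 + V 2 1 + V 2 2 \<in> \<int>" unfolding V_def by (intro Ints_add Ints_mult Ni qi)
      then obtain m :: int where m: "V 1 1 + V 1 2 + V 2 1 + V 2 2 = of_int m" by (auto elim: Ints_cases)
      have Vs: "s / of_nat (M0 * M1 * M2) * V i j = N$i$j * q$j$i" for i j
        using s(1) M0(1) M1(1) M2(1) by (simp add: V_def)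
      have "trace (N ** q) = s / of_nat (M0 * M1 * M2) * V 1 1 + s / of_nat (M0 * M1 * M2) * V 1 2
          + s / of_nat (M0 * M1 * M2) * V 2 1 + s / of_nat (M0 * M1 * M2) * V 2 2"
        unfolding Vs by (simp add: trace_2x2 mult_2x2)
      also have "\<dots> = s / of_nat (M0 * M1 * M2) * of_int m" unfolding m[symmetric] by (simp only: distrib_left)
      finally show ?thesis using \<open>trace A = trace (N ** q)\<close> by metis
    qed
    moreover have "s / of_nat (M0 * M1 * M2) \<noteq> 0" using s(1) M0(1) M1(1) M2(1) by simp
    ultimately show ?thesis by blast
  qed
  then obtain \<kappa> where \<kappa>: "\<And>r. r \<in> Reps \<Longrightarrow> \<kappa> r \<noteq> 0"
    "\<And>r A. r \<in> Reps \<Longrightarrow> A ** adj2 r \<in> lift I \<Longrightarrow> \<exists>m::int. trace A = \<kappa> r * of_int m" by metis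
  show ?thesis
  proof (rule progressions_bounded_clustering[OF Reps(1) \<kappa>(1)])
    fix x assume "x \<in> Tr \<Gamma>"
    then obtain A where A: "A \<in> lift \<Gamma>" "x = \<bar>trace A\<bar>" by (auto simp: Tr_lift[OF sub])
    obtain r where r: "r \<in> Reps" "A ** adj2 r \<in> lift I" using Reps(3) A(1) by blast
    obtain m :: int where m: "trace A = \<kappa> r * of_int m" using \<kappa>(2)[OF r] by blast
    have "x = \<kappa> r * of_int m \<or> x = \<kappa> r * of_int (- m)" using A(2) m by (auto simp: abs_if)
    then show "\<exists>r\<in>Reps. \<exists>k::int. x = \<kappa> r * of_int k" using r(1) by blast
  qed
qed

section \<open>The modular group as an arithmetic group\<close>

lemma lin_span_subset:
  assumes Y: "Y \<subseteq> M" and M: "0 \<in> M" "\<And>x y. x \<in> M \<Longrightarrow> y \<in> M \<Longrightarrow> x + y \<in> M"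
    "\<And>c x. c \<in> C \<Longrightarrow> x \<in> M \<Longrightarrow> c *\<^sub>R x \<in> M"
  shows "lin_span C Y \<subseteq> M"
proof
  fix z assume "z \<in> lin_span C Y"
  then obtain S c where S: "finite S" "S \<subseteq> Y" "c ` S \<subseteq> C" "z = (\<Sum>s\<in>S. c s *\<^sub>R s)" unfolding lin_span_def by blast
  have "S \<subseteq> Y \<Longrightarrow> c ` S \<subseteq> C \<Longrightarrow> (\<Sum>s\<in>S. c s *\<^sub>R s) \<in> M" using S(1)
  proof (induction S)
    case (insert v S)
    then have "c v *\<^sub>R v \<in> M" "(\<Sum>s\<in>S. c s *\<^sub>R s) \<in> M" using M(3)[of "c v" v] Y by auto
    then show ?case using M(2) insert.hyps by simp
  qed (simp add: M(1))
  then show "z \<in> M" using S by blast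
qed

lemma lin_span_four:
  assumes "distinct [v1, v2, v3, v4]" "{v1, v2, v3, v4} \<subseteq> Y" "{c1, c2, c3, c4} \<subseteq> C"
  shows "c1 *\<^sub>R v1 + (c2 *\<^sub>R v2 + (c3 *\<^sub>R v3 + c4 *\<^sub>R v4)) \<in> lin_span C Y"
proof -
  define c where "c v = (if v = v1 then c1 else if v = v2 then c2 else if v = v3 then c3 else c4)" for v
  have "c1 *\<^sub>R v1 + (c2 *\<^sub>R v2 + (c3 *\<^sub>R v3 + c4 *\<^sub>R v4)) = (\<Sum>v\<in>{v1, v2, v3, v4}. c v *\<^sub>R v)"
    using assms(1) by (auto simp: c_def)
  moreover have "c ` {v1, v2, v3, v4} \<subseteq> C" using assms(3) by (auto simp: c_def)
  ultimately show ?thesis unfolding lin_span_def using assms(2) by (intro CollectI exI[of _ "{v1, v2, v3, v4}"] exI[of _ c]) simp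
qed

text \<open>The isomorphism of the quaternion algebra with \<open>a = b = 1\<close> with the matrix algebra, and its inverse
  \<open>matrix_quat\<close>.\<close>
definition quat_matrix :: "quat \<Rightarrow> real^2^2" where
  "quat_matrix x = (case x of (x0, x1, x2, x3) \<Rightarrow> vector [vector [x0 + x1, x2 + x3], vector [x2 - x3, x0 - x1]])"

lemma quat_matrix_nth [simp]:
  "quat_matrix (x0, x1, x2, x3)$1$1 = x0 + x1" "quat_matrix (x0, x1, x2, x3)$1$2 = x2 + x3"
  "quat_matrix (x0, x1, x2, x3)$2$1 = x2 - x3" "quat_matrix (x0, x1, x2, x3)$2$2 = x0 - x1"
  by (simp_all add: quat_matrix_def)

definition matrix_quat :: "real^2^2 \<Rightarrow> quat" where
  "matrix_quat A = ((A$1$1 + A$2$2) / 2, (A$1$1 - A$2$2) / 2, (A$1$2 + A$2$1) / 2, (A$1$2 - A$2$1) / 2)"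

lemma matrix_quat_inverse: "matrix_quat (quat_matrix x) = x" "quat_matrix (matrix_quat A) = A"
  by (cases x; simp add: matrix_quat_def) (simp add: matrix_quat_def eq_2x2_iff field_simps)

lemma quat_matrix_hom:
  "quat_matrix (qmult 1 1 x y) = quat_matrix x ** quat_matrix y" "quat_matrix (x + y) = quat_matrix x + quat_matrix y"
  "quat_matrix (c *\<^sub>R x) = c *\<^sub>R quat_matrix x" "quat_matrix (- x) = - quat_matrix x" "quat_matrix (1, 0, 0, 0) = mat 1"
  by (cases x; cases y; simp add: eq_2x2_iff mult_2x2 algebra_simps; fail)+

lemma det_quat_matrix: "det (quat_matrix x) = nrd 1 1 x"
  by (cases x) (simp add: det_2x2 power2_eq_square algebra_simps)

text \<open>The order that corresponds to integral matrices. It contains \<open>(1 + i) / 2\<close>, so it is larger than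
  the order of integral coordinates.\<close>
definition integral_quats :: "quat set" where
  "integral_quats = {x. \<forall>i j. quat_matrix x$i$j \<in> \<int>}"

lemma integral_quats_closed:
  "0 \<in> integral_quats" "(1, 0, 0, 0) \<in> integral_quats"
  "x \<in> integral_quats \<Longrightarrow> y \<in> integral_quats \<Longrightarrow> x + y \<in> integral_quats"
  "x \<in> integral_quats \<Longrightarrow> y \<in> integral_quats \<Longrightarrow> qmult 1 1 x y \<in> integral_quats"
  "x \<in> integral_quats \<Longrightarrow> - x \<in> integral_quats"
  "c \<in> \<int> \<Longrightarrow> x \<in> integral_quats \<Longrightarrow> c *\<^sub>R x \<in> integral_quats"
proof -
  show "0 \<in> integral_quats" "(1, 0, 0, 0) \<in> integral_quats"
    by (simp_all add: integral_quats_def forall_2 zero_prod_def)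
qed (simp_all add: integral_quats_def quat_matrix_hom forall_2 mult_2x2)

lemma integral_quats_rational: "integral_quats \<subseteq> \<rat> \<times> \<rat> \<times> \<rat> \<times> \<rat>"
proof
  fix x assume x: "x \<in> integral_quats"
  have "quat_matrix x$i$j \<in> \<rat>" for i j using x Ints_subset_Rats by (auto simp: integral_quats_def)
  then have "matrix_quat (quat_matrix x) \<in> \<rat> \<times> \<rat> \<times> \<rat> \<times> \<rat>"
    unfolding matrix_quat_def by (intro SigmaI Rats_divide Rats_add Rats_diff) auto
  then show "x \<in> \<rat> \<times> \<rat> \<times> \<rat> \<times> \<rat>" by (simp only: matrix_quat_inverse)
qed

lemma integral_quats_order: "is_order \<rat> 1 1 integral_quats"
  unfolding is_order_def
proof (intro conjI)
  let ?Q = "quaternion_algebra \<rat> 1 1"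
  interpret Q: ring ?Q
    by (rule ring_quaternion_algebra[OF subfieldE(1)[OF field_set_subfield[OF field_set_Rats]]]) simp_all
  have neg: "\<ominus>\<^bsub>?Q\<^esub> x = - x" if "x \<in> integral_quats" for x
  proof (rule Q.minus_equality)
    show "- x \<oplus>\<^bsub>?Q\<^esub> x = \<zero>\<^bsub>?Q\<^esub>" by (simp add: quaternion_algebra_def)
    show "x \<in> carrier ?Q" "- x \<in> carrier ?Q"
      using that integral_quats_closed(5)[OF that] integral_quats_rational by (auto simp: quaternion_algebra_def)
  qed
  show "subring integral_quats ?Q"
  proof (rule Q.subringI)
    show "integral_quats \<subseteq> carrier ?Q" using integral_quats_rational by (simp add: quaternion_algebra_def)
    show "\<ominus>\<^bsub>?Q\<^esub> x \<in> integral_quats" if "x \<in> integral_quats" for x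
      using neg[OF that] integral_quats_closed(5)[OF that] by simp
  qed (simp_all add: quaternion_algebra_def integral_quats_closed)
  define v :: "nat \<Rightarrow> quat" where "v n = [(1/2, 1/2, 0, 0), (1/2, -1/2, 0, 0), (0, 0, 1/2, 1/2), (0, 0, 1/2, -1/2)] ! n" for n
  let ?S = "{v 0, v (Suc 0), v 2, v 3}"
  have v: "v 0 = (1/2, 1/2, 0, 0)" "v (Suc 0) = (1/2, -1/2, 0, 0)" "v 2 = (0, 0, 1/2, 1/2)" "v 3 = (0, 0, 1/2, -1/2)"
    by (simp_all add: v_def numeral_eq_Suc)
  have "integral_quats = lin_span \<int> ?S"
  proof
    show "lin_span \<int> ?S \<subseteq> integral_quats"
    proof (rule lin_span_subset)
      show "?S \<subseteq> integral_quats" unfolding v by (simp add: integral_quats_def forall_2)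
    qed (simp_all add: integral_quats_closed)
    show "integral_quats \<subseteq> lin_span \<int> ?S"
    proof
      fix x assume x: "x \<in> integral_quats"
      define A where "A = quat_matrix x"
      have A: "A$i$j \<in> \<int>" for i j using x by (simp add: A_def integral_quats_def)
      have "x = matrix_quat A" by (simp add: A_def matrix_quat_inverse)
      also have "\<dots> = A$1$1 *\<^sub>R v 0 + (A$2$2 *\<^sub>R v (Suc 0) + (A$1$2 *\<^sub>R v 2 + A$2$1 *\<^sub>R v 3))"
        unfolding v by (simp add: matrix_quat_def add_divide_distrib diff_divide_distrib)
      also have "\<dots> \<in> lin_span \<int> ?S" by (rule lin_span_four) (use A in \<open>simp_all add: v\<close>)
      finally show "x \<in> lin_span \<int> ?S" .
    qed
  qed
  then show "\<exists>S. finite S \<and> integral_quats = lin_span (integers_of \<rat>) S"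
    unfolding integers_of_Rats by (intro exI[of _ ?S]) simp
  show "lin_span \<rat> integral_quats = carrier ?Q"
  proof
    show "lin_span \<rat> integral_quats \<subseteq> carrier ?Q"
      by (rule lin_span_subset) (use integral_quats_rational in \<open>auto simp: quaternion_algebra_def zero_prod_def\<close>)
    show "carrier ?Q \<subseteq> lin_span \<rat> integral_quats"
    proof
      fix x assume "x \<in> carrier ?Q"
      then obtain x0 x1 x2 x3 where x: "x = (x0, x1, x2, x3)" "x0 \<in> \<rat>" "x1 \<in> \<rat>" "x2 \<in> \<rat>" "x3 \<in> \<rat>"
        by (auto simp: quaternion_algebra_def)
      have "x = x0 *\<^sub>R (1, 0, 0, 0) + (x1 *\<^sub>R (0, 1, 0, 0) + (x2 *\<^sub>R (0, 0, 1, 0) + x3 *\<^sub>R (0, 0, 0, 1)))"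
        by (simp add: x(1))
      also have "\<dots> \<in> lin_span \<rat> integral_quats"
        by (rule lin_span_four) (use x in \<open>simp_all add: integral_quats_def forall_2\<close>)
      finally show "x \<in> lin_span \<rat> integral_quats" .
    qed
  qed
qed

text \<open>The rational field has the identity as its only embedding, so the condition at the other embeddings
  is empty. The conjugation by \<open>k\<close> is part of the identification with matrices.\<close>
lemma rational_datum:
  assumes k: "det k = 1"
  shows "arithmetic_datum \<rat> 1 1 (\<lambda>x. adj2 k ** quat_matrix x ** k) integral_quats"
    "\<Gamma>_of 1 1 (\<lambda>x. adj2 k ** quat_matrix x ** k) integral_quats = proj ` conj_set (adj2 k) SL2Z"
proof -
  let ?\<rho> = "\<lambda>x. adj2 k ** quat_matrix x ** k"
  have sf: "subfield \<rat> real_ring" by (rule field_set_subfield[OF field_set_Rats])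
  interpret R: Ring.field real_ring by (rule real_field)
  have dim: "ring.dimension real_ring 1 \<rat> \<rat>" by (rule R.dimension_one[OF sf])
  have emb: "\<phi> q = complex_of_real q" if "\<phi> \<in> embeddings \<rat>" "q \<in> \<rat>" for \<phi> q
    using that by (simp add: embeddings_iff embeds_rational)
  have dk: "det (adj2 k) = 1" using k by simp
  have bij: "bij ?\<rho>"
  proof (rule bij_betw_byWitness[where f' = "\<lambda>A. matrix_quat (k ** A ** adj2 k)"])
    show "\<forall>x\<in>UNIV. matrix_quat (k ** ?\<rho> x ** adj2 k) = x"
      by (simp add: conj_inverse(2)[OF k] matrix_quat_inverse)
    show "\<forall>A\<in>UNIV. ?\<rho> (matrix_quat (k ** A ** adj2 k)) = A"
      by (simp add: conj_inverse(1)[OF k] matrix_quat_inverse)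
  qed auto
  have "?\<rho> \<in> ring_hom (quaternion_algebra UNIV 1 1) M2R"
  proof (rule ring_hom_memI)
    fix x y
    show "?\<rho> (x \<otimes>\<^bsub>quaternion_algebra UNIV 1 1\<^esub> y) = ?\<rho> x \<otimes>\<^bsub>M2R\<^esub> ?\<rho> y"
      using conj_mult[OF dk, of "quat_matrix x" "quat_matrix y"]
      by (simp add: quaternion_algebra_def M2R_def quat_matrix_hom)
    show "?\<rho> (x \<oplus>\<^bsub>quaternion_algebra UNIV 1 1\<^esub> y) = ?\<rho> x \<oplus>\<^bsub>M2R\<^esub> ?\<rho> y"
      by (simp add: quaternion_algebra_def M2R_def quat_matrix_hom eq_2x2_iff mult_2x2 algebra_simps)
  qed (simp_all add: quaternion_algebra_def M2R_def quat_matrix_hom adj2_mult[OF k])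
  moreover have "?\<rho> (c *\<^sub>R x) = c *\<^sub>R ?\<rho> x" for c x
    by (simp add: quat_matrix_hom eq_2x2_iff mult_2x2 algebra_simps)
  ultimately have "?\<rho> \<in> real_algebra_iso (quaternion_algebra UNIV 1 1) M2R"
    using bij unfolding real_algebra_iso_def ring_iso_def
    by (intro CollectI conjI allI ballI) (simp_all add: quaternion_algebra_def M2R_def)
  moreover have "totally_real \<rat>" unfolding totally_real_def
  proof (intro ballI subsetI)
    fix \<phi> z assume \<phi>: "\<phi> \<in> embeddings \<rat>" and "z \<in> \<phi> ` \<rat>"
    then obtain q where "q \<in> \<rat>" "z = \<phi> q" by blast
    then show "z \<in> \<real>" using emb[OF \<phi>] by simp
  qed
  ultimately show "arithmetic_datum \<rat> 1 1 ?\<rho> integral_quats"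
    unfolding arithmetic_datum_def real_number_field_def using sf dim integral_quats_order
    by (intro conjI exI[of _ 1] ballI impI) (auto simp: emb)
  have "quat_matrix ` norm_one_group 1 1 integral_quats = SL2Z"
  proof
    show "quat_matrix ` norm_one_group 1 1 integral_quats \<subseteq> SL2Z"
      by (auto simp: norm_one_group_def integral_quats_def SL2Z_def det_quat_matrix)
    show "SL2Z \<subseteq> quat_matrix ` norm_one_group 1 1 integral_quats"
    proof
      fix A assume A: "A \<in> SL2Z"
      then have "matrix_quat A \<in> norm_one_group 1 1 integral_quats"
        by (simp add: norm_one_group_def integral_quats_def SL2Z_def det_quat_matrix[symmetric] matrix_quat_inverse)
      then have "quat_matrix (matrix_quat A) \<in> quat_matrix ` norm_one_group 1 1 integral_quats" by (rule imageI)
      then show "A \<in> quat_matrix ` norm_one_group 1 1 integral_quats" by (simp only: matrix_quat_inverse)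
    qed
  qed
  then show "\<Gamma>_of 1 1 ?\<rho> integral_quats = proj ` conj_set (adj2 k) SL2Z"
    unfolding \<Gamma>_of_def conj_set_def adj2_adj2 by (simp add: image_image flip: \<open>_ = SL2Z\<close>)
qed

theorem bounded_clustering_imp_arithmetic:
  assumes \<Gamma>: "fuchsian \<Gamma>" and co: "cofinite_area \<Gamma>" and par: "\<exists>T\<in>\<Gamma>. parabolic T"
    and bc: "bounded_clustering (Tr \<Gamma>)"
  shows "arithmetic \<Gamma>"
proof -
  have sub: "subgroup \<Gamma> PSL2R" using \<Gamma> by (simp add: fuchsian_def)
  note LG = lift_group[OF sub]
  obtain k and f :: "real^2^2 \<Rightarrow> nat \<times> int \<times> int \<times> int \<times> int" and R :: "(real^2^2) set" where k: "det k = 1"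
    and f: "finite (f ` lift \<Gamma>)"
      "\<forall>x\<in>lift \<Gamma>. \<forall>y\<in>lift \<Gamma>. f x = f y \<longrightarrow> y ** adj2 x \<in> conj_set (adj2 k) SL2Z"
    and R: "finite R" "\<forall>x\<in>SL2Z. \<exists>r\<in>R. det r = 1 \<and> x ** adj2 r \<in> conj_set k (lift \<Gamma>)"
    using bounded_clustering_integral_cosets[OF \<Gamma> co par bc] by (elim exE conjE)
  define G where "G = conj_set (adj2 k) SL2Z"
  have G: "sl2_group G" unfolding G_def by (rule conj_set_group) (use k SL2Z_group in simp_all)
  define I where "I = \<Gamma> \<inter> proj ` G"
  interpret group PSL2R by (rule group_PSL2R)
  have I: "subgroup I PSL2R" unfolding I_def by (rule subgroups_Inter_pair[OF sub proj_subgroup[OF G]])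
  have II: "proj A \<in> I" if "A \<in> lift \<Gamma>" "A \<in> G" for A using that by (simp add: I_def lift_def)
  have "finite (rcosets\<^bsub>PSL2R\<lparr>carrier := proj ` lift \<Gamma>\<rparr>\<^esub> I)"
  proof (rule finite_rcosets[OF I _ f(1)])
    fix x y assume xy: "x \<in> lift \<Gamma>" "y \<in> lift \<Gamma>" "f x = f y"
    show "proj (y ** adj2 x) \<in> I"
      using II sl2_mult[OF LG xy(2) sl2_adj2[OF LG xy(1)]] f(2)[rule_format, OF xy] by (simp add: G_def)
  qed (rule sl2_det[OF LG])
  then have fin1: "finite (rcosets\<^bsub>PSL2R\<lparr>carrier := \<Gamma>\<rparr>\<^esub> I)" unfolding proj_lift[OF sub, symmetric] .
  define P where "P A r \<longleftrightarrow> r \<in> R \<and> det r = 1 \<and> (k ** A ** adj2 k) ** adj2 r \<in> conj_set k (lift \<Gamma>)" for A r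
  define c where "c A = (SOME r. P A r)" for A
  have c: "c A \<in> R \<and> det (c A) = 1 \<and> (k ** A ** adj2 k) ** adj2 (c A) \<in> conj_set k (lift \<Gamma>)" if A: "A \<in> G" for A
  proof -
    have "k ** A ** adj2 k \<in> SL2Z"
      using A unfolding G_def conj_set_def adj2_adj2 by (auto simp: conj_inverse(2)[OF k])
    then obtain r where "r \<in> R" "det r = 1" "(k ** A ** adj2 k) ** adj2 r \<in> conj_set k (lift \<Gamma>)" using R(2) by blast
    then have "P A r" by (simp add: P_def)
    then have "P A (c A)" unfolding c_def by (rule someI)
    then show ?thesis by (simp only: P_def)
  qed
  have fin2: "finite (rcosets\<^bsub>PSL2R\<lparr>carrier := proj ` G\<rparr>\<^esub> I)"
  proof (rule finite_rcosets[OF I])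
    show "finite (c ` G)" using c by (intro finite_subset[OF _ R(1)]) blast
    fix x y assume xy: "x \<in> G" "y \<in> G" "c x = c y"
    define r where "r = c x"
    have r: "det r = 1" "(k ** x ** adj2 k) ** adj2 r \<in> conj_set k (lift \<Gamma>)" "(k ** y ** adj2 k) ** adj2 r \<in> conj_set k (lift \<Gamma>)"
      using c[OF xy(1)] c[OF xy(2)] xy(3) by (simp_all add: r_def)
    note KG = conj_set_group[OF k LG]
    have "((k ** y ** adj2 k) ** adj2 r) ** adj2 ((k ** x ** adj2 k) ** adj2 r) \<in> conj_set k (lift \<Gamma>)"
      by (rule sl2_mult[OF KG r(3) sl2_adj2[OF KG r(2)]])
    also have "((k ** y ** adj2 k) ** adj2 r) ** adj2 ((k ** x ** adj2 k) ** adj2 r)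
        = (k ** y ** adj2 k) ** (adj2 r ** r) ** adj2 (k ** x ** adj2 k)"
      by (simp add: adj2_mult_distrib adj2_adj2 matrix_mul_assoc)
    also have "\<dots> = (k ** y ** adj2 k) ** (k ** adj2 x ** adj2 k)"
      by (simp add: adj2_mult[OF r(1)] adj2_mult_distrib adj2_adj2 matrix_mul_assoc)
    also have "\<dots> = k ** (y ** adj2 x) ** adj2 k" by (rule conj_mult[OF k])
    finally have "y ** adj2 x \<in> lift \<Gamma>" by (simp add: conj_set_mem_iff[OF k] conj_inverse(1)[OF k])
    then show "proj (y ** adj2 x) \<in> I" using II sl2_mult[OF G xy(2) sl2_adj2[OF G xy(1)]] by blast
  qed (rule sl2_det[OF G])
  have "commensurable \<Gamma> (\<Gamma>_of 1 1 (\<lambda>x. adj2 k ** quat_matrix x ** k) integral_quats)"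
    unfolding commensurable_def rational_datum(2)[OF k] using fin1 fin2 by (simp add: I_def G_def)
  then show ?thesis unfolding arithmetic_def using \<Gamma> rational_datum(1)[OF k] by blast
qed

theorem theorem7:
  fixes \<Gamma> :: "(real^2^2) set set"
  assumes "fuchsian \<Gamma>" and "cofinite_area \<Gamma>" and "\<exists>T\<in>\<Gamma>. parabolic T"
  shows "bounded_clustering (Tr \<Gamma>) \<longleftrightarrow> arithmetic \<Gamma>"
  using bounded_clustering_imp_arithmetic[OF assms] arithmetic_imp_bounded_clustering[OF assms(2,3)] by blast

end
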